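(* Let $\alpha \in (\frac12, 1)$ and let $\mathcal{G}_\alpha$ be the diagonal comb metric graph with parameter $\alpha$. Then there exist constants $c, C > 0$, depending on $\alpha$, such that for all sufficiently large $k \in \mathbb{N}$ \[ c\, k^{4\alpha - 2} \leq \lambda_k(\mathcal{G}_\alpha) \leq C\, k^{2\alpha}, \] where $\lambda_k(\mathcal{G}_\alpha)$ denotes the $k$-th eigenvalue of the Neumann Laplacian on $\mathcal{G}_\alpha$.
   Context: A metric graph $\mathcal{G}$ is a countable collection of intervals (edges) $(\mathsf{e})_{\mathsf{e}\in\mathsf{E}}$ of finite lengths $\ell_{\mathsf{e}}\in(0,\infty)$, glued at their endpoints to form a graph-like space, endowed with the shortest-path metric and the measure inherited from the Lebesgue measure on the edges. For $\alpha>0$ the diagonal comb $\mathcal{G}_\alpha$ is obtained by taking the interval $(0,1]$ as a "backbone" and attaching, for every $n=1,2,\dots$, an edge ("tooth") of length $n^{-\alpha}$ by one of its endpoints to the point $n^{-\alpha}\in(0,1]$. Thus the edges are the teeth, of lengths $n^{-\alpha}$ ($n\ge 1$), and the backbone edges of lengths $n^{-\alpha}-(n+1)^{-\alpha}$ ($n\geq 1$) joining the foot points of the $n$-th and $(n+1)$-st teeth. The point $0$ does not belong to $\mathcal{G}_\alpha$. $H^1(\mathcal{G})$ is the space of continuous functions $\phi:\mathcal{G}\to\mathbb{C}$ whose restriction to each edge $\mathsf{e}$ lies in $H^1(\mathsf{e})$ and for which $\sum_{\mathsf{e}\in\mathsf{E}}\|\phi|_{\mathsf{e}}\|_{H^1(\mathsf{e})}^2<\infty$.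 The Neumann Laplacian on $\mathcal{G}$ is the nonnegative self-adjoint operator in $L^2(\mathcal{G})$ associated with the quadratic form $\phi\mapsto\sum_{\mathsf{e}\in\mathsf{E}}\int_{\mathsf{e}}|\phi'(x)|^2\,\mathrm{d}x$ with domain $H^1(\mathcal{G})$. It is known that the Neumann Laplacian on $\mathcal{G}_\alpha$ has purely discrete spectrum if and only if $\alpha>\frac12$; in that case $\{\lambda_k(\mathcal{G}_\alpha)\}_{k\ge1}$ denotes its eigenvalues enumerated increasingly and counted with multiplicity. *)

theory Defs
  imports "HOL-Analysis.Analysis" "HOL-Library.Function_Algebras"
begin

section \<open>Metric graphs\<close>

text \<open>
  The edge \<open>e\<close> is the interval \<open>{0..len G e}\<close>, and \<open>param G e\<close> maps it into the type of points of
  the glued space: the points \<open>s\<close> of \<open>e\<close> and \<open>t\<close> of \<open>e'\<close> are glued iff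
  \<open>param G e s = param G e' t\<close>.
\<close>

record ('e, 'p) graph =
  edges :: "'e set"
  len :: "'e \<Rightarrow> real"
  param :: "'e \<Rightarrow> real \<Rightarrow> 'p"

definition points :: "('e, 'p) graph \<Rightarrow> 'p set" where
  "points G = (\<Union>e\<in>edges G. param G e ` {0..len G e})"

text \<open>\<open>walk G p r q\<close>: some chain of subintervals of edges leads from \<open>p\<close> to \<open>q\<close> and has total
  length \<open>r\<close>.\<close>

inductive walk :: "('e, 'p) graph \<Rightarrow> 'p \<Rightarrow> real \<Rightarrow> 'p \<Rightarrow> bool" for G p where
  refl: "p \<in> points G \<Longrightarrow> walk G p 0 p"
| step: "walk G p r (param G e s) \<Longrightarrow> e \<in> edges G \<Longrightarrow> s \<in> {0..len G e} \<Longrightarrow> t \<in> {0..len G e}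
    \<Longrightarrow> walk G p (r + \<bar>s - t\<bar>) (param G e t)"

text \<open>The value \<open>0\<close> outside of the graph only serves to meet the totality conventions of
  \<^locale>\<open>Metric_space\<close>.\<close>

definition path_dist :: "('e, 'p) graph \<Rightarrow> 'p \<Rightarrow> 'p \<Rightarrow> real" where
  "path_dist G p q = (if p \<in> points G \<and> q \<in> points G then Inf {r. walk G p r q} else 0)"

definition graph_topology :: "('e, 'p) graph \<Rightarrow> 'p topology" where
  "graph_topology G = Metric_space.mtopology (points G) (path_dist G)"

definition metric_graph :: "('e, 'p) graph \<Rightarrow> bool" where
  "metric_graph G \<longleftrightarrow>
     countable (edges G) \<and>
     (\<forall>e\<in>edges G. 0 < len G e) \<and>
     (\<forall>e\<in>edges G. \<forall>e'\<in>edges G. \<forall>s\<in>{0..len G e}. \<forall>t\<in>{0..len G e'}.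
        param G e s = param G e' t \<longrightarrow>
          e = e' \<and> s = t \<or> s \<in> {0, len G e} \<and> t \<in> {0, len G e'}) \<and>
     (\<forall>p\<in>points G. \<forall>q\<in>points G. \<exists>r. walk G p r q) \<and>
     Metric_space (points G) (path_dist G)"


section \<open>The space \<open>H\<^sup>1\<close>\<close>

definition L2_on :: "real \<Rightarrow> (real \<Rightarrow> complex) \<Rightarrow> bool" where
  "L2_on l f \<longleftrightarrow> f \<in> borel_measurable (lebesgue_on {0..l}) \<and>
     integrable (lebesgue_on {0..l}) (\<lambda>x. (cmod (f x))\<^sup>2)"

text \<open>\<open>test_function l \<phi> \<phi>'\<close>: \<open>\<phi>\<close> is a \<open>C\<^sup>1\<close> function with derivative \<open>\<phi>'\<close> and with compact support
  in the open interval \<open>{0<..<l}\<close>.\<close>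

definition test_function :: "real \<Rightarrow> (real \<Rightarrow> real) \<Rightarrow> (real \<Rightarrow> real) \<Rightarrow> bool" where
  "test_function l \<phi> \<phi>' \<longleftrightarrow>
     (\<forall>x. (\<phi> has_real_derivative \<phi>' x) (at x)) \<and> continuous_on UNIV \<phi>' \<and>
     (\<exists>a b. 0 < a \<and> b < l \<and> (\<forall>x. x \<notin> {a..b} \<longrightarrow> \<phi> x = 0))"

definition is_weak_deriv :: "real \<Rightarrow> (real \<Rightarrow> complex) \<Rightarrow> (real \<Rightarrow> complex) \<Rightarrow> bool" where
  "is_weak_deriv l f g \<longleftrightarrow>
     (\<forall>\<phi> \<phi>'. test_function l \<phi> \<phi>' \<longrightarrow>
        (LINT x|lebesgue_on {0..l}. complex_of_real (\<phi>' x) * f x) =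
        - (LINT x|lebesgue_on {0..l}. complex_of_real (\<phi> x) * g x))"

definition H1_on :: "real \<Rightarrow> (real \<Rightarrow> complex) \<Rightarrow> bool" where
  "H1_on l f \<longleftrightarrow> L2_on l f \<and> (\<exists>g. L2_on l g \<and> is_weak_deriv l f g)"

text \<open>The weak derivative is unique up to null sets; only integrals of it are used below.\<close>

definition weak_deriv :: "real \<Rightarrow> (real \<Rightarrow> complex) \<Rightarrow> real \<Rightarrow> complex" where
  "weak_deriv l f = (SOME g. L2_on l g \<and> is_weak_deriv l f g)"

definition H1_norm_sq :: "real \<Rightarrow> (real \<Rightarrow> complex) \<Rightarrow> real" where
  "H1_norm_sq l f =
     (LINT x|lebesgue_on {0..l}. (cmod (f x))\<^sup>2) +
     (LINT x|lebesgue_on {0..l}. (cmod (weak_deriv l f x))\<^sup>2)"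

definition on_edge :: "('e, 'p) graph \<Rightarrow> 'e \<Rightarrow> ('p \<Rightarrow> complex) \<Rightarrow> real \<Rightarrow> complex" where
  "on_edge G e u = (\<lambda>s. u (param G e s))"

text \<open>A function on the graph is represented by its extension by \<open>0\<close> to the type of points, so that
  functions which agree on the graph are equal. The measure on the graph is the sum of the Lebesgue
  measures on the edges.\<close>

definition graph_L2 :: "('e, 'p) graph \<Rightarrow> ('p \<Rightarrow> complex) set" where
  "graph_L2 G = {f. (\<forall>p. p \<notin> points G \<longrightarrow> f p = 0) \<and>
     (\<forall>e\<in>edges G. L2_on (len G e) (on_edge G e f)) \<and>
     (\<lambda>e. LINT x|lebesgue_on {0..len G e}. (cmod (on_edge G e f x))\<^sup>2) summable_on edges G}"

definition graph_inner :: "('e, 'p) graph \<Rightarrow> ('p \<Rightarrow> complex) \<Rightarrow> ('p \<Rightarrow> complex) \<Rightarrow> complex" where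
  "graph_inner G f v =
     (\<Sum>\<^sub>\<infinity>e\<in>edges G. LINT x|lebesgue_on {0..len G e}. on_edge G e f x * cnj (on_edge G e v x))"

definition graph_H1 :: "('e, 'p) graph \<Rightarrow> ('p \<Rightarrow> complex) set" where
  "graph_H1 G = {u. (\<forall>p. p \<notin> points G \<longrightarrow> u p = 0) \<and>
     continuous_map (graph_topology G) euclidean u \<and>
     (\<forall>e\<in>edges G. H1_on (len G e) (on_edge G e u)) \<and>
     (\<lambda>e. H1_norm_sq (len G e) (on_edge G e u)) summable_on edges G}"


section \<open>The Neumann Laplacian and its eigenvalues\<close>

text \<open>The sesquilinear form whose quadratic form is \<open>u \<mapsto> (\<Sum>e. \<integral>\<bar>u'\<bar>\<^sup>2)\<close>.\<close>

definition energy_form :: "('e, 'p) graph \<Rightarrow> ('p \<Rightarrow> complex) \<Rightarrow> ('p \<Rightarrow> complex) \<Rightarrow> complex" where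
  "energy_form G u v =
     (\<Sum>\<^sub>\<infinity>e\<in>edges G. LINT x|lebesgue_on {0..len G e}.
        weak_deriv (len G e) (on_edge G e u) x * cnj (weak_deriv (len G e) (on_edge G e v) x))"

text \<open>The operator associated with the form, given by its graph: \<open>u\<close> is in the domain and is mapped
  to \<open>f\<close> iff \<open>u\<close> is in the form domain and the form satisfies \<open>a(u,v) = \<langle>f,v\<rangle>\<close> for all \<open>v\<close> in the
  form domain. (The function \<open>f\<close> is any representative of its class in \<open>L\<^sup>2\<close>, while \<open>u\<close> is the
  continuous representative.)\<close>

definition neumann_laplacian :: "('e, 'p) graph \<Rightarrow> (('p \<Rightarrow> complex) \<times> ('p \<Rightarrow> complex)) set" where
  "neumann_laplacian G = {(u, f). u \<in> graph_H1 G \<and> f \<in> graph_L2 G \<and>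
     (\<forall>v\<in>graph_H1 G. energy_form G u v = graph_inner G f v)}"

global_interpretation cfun: vector_space "\<lambda>(c::complex) (u::'p \<Rightarrow> complex) p. c * u p"
  by unfold_locales (auto simp: fun_eq_iff plus_fun_def algebra_simps)

definition eigenspace :: "(('p \<Rightarrow> complex) \<times> ('p \<Rightarrow> complex)) set \<Rightarrow> real \<Rightarrow> ('p \<Rightarrow> complex) set" where
  "eigenspace A \<mu> = {u. (u, \<lambda>p. complex_of_real \<mu> * u p) \<in> A}"

text \<open>\<open>lam 0 \<le> lam 1 \<le> \<dots>\<close> lists all (real) eigenvalues with multiplicity: each \<open>\<mu>\<close> occurs exactly
  as often as the dimension of its eigenspace, which is \<open>0\<close> if \<open>\<mu>\<close> is not an eigenvalue. The finite
  basis is spelled out because \<^term>\<open>cfun.dim\<close> is \<open>0\<close> for infinite-dimensional spaces.\<close>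

definition enumerates_eigenvalues ::
  "(('p \<Rightarrow> complex) \<times> ('p \<Rightarrow> complex)) set \<Rightarrow> (nat \<Rightarrow> real) \<Rightarrow> bool" where
  "enumerates_eigenvalues A lam \<longleftrightarrow> incseq lam \<and>
     (\<forall>\<mu>. finite {k. lam k = \<mu>} \<and>
        (\<exists>B. finite B \<and> \<not> cfun.dependent B \<and> cfun.span B = eigenspace A \<mu> \<and>
             card B = card {k. lam k = \<mu>}))"

text \<open>The \<open>k\<close>-th eigenvalue, for \<open>k \<ge> 1\<close>.\<close>

definition eigenvalue :: "(('p \<Rightarrow> complex) \<times> ('p \<Rightarrow> complex)) set \<Rightarrow> nat \<Rightarrow> real" where
  "eigenvalue A k = (THE lam. enumerates_eigenvalues A lam) (k - 1)"

lemma enumerates_eigenvalues_unique: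
  assumes "enumerates_eigenvalues A lam" and "enumerates_eigenvalues A lam'"
  shows "lam = lam'"
proof -
  have card_eq: "card {k. lam k = \<mu>} = card {k. lam' k = \<mu>}" for \<mu>
  proof -
    obtain B where B: "finite B" "\<not> cfun.dependent B" "cfun.span B = eigenspace A \<mu>"
        "card B = card {k. lam k = \<mu>}"
      using assms(1) unfolding enumerates_eigenvalues_def by blast
    obtain B' where B': "finite B'" "\<not> cfun.dependent B'" "cfun.span B' = eigenspace A \<mu>"
        "card B' = card {k. lam' k = \<mu>}"
      using assms(2) unfolding enumerates_eigenvalues_def by blast
    have "card B = cfun.dim (eigenspace A \<mu>)" "card B' = cfun.dim (eigenspace A \<mu>)"
      using cfun.dim_span_eq_card_independent[OF B(2)] cfun.dim_span_eq_card_independent[OF B'(2)]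
        B(3) B'(3) by auto
    thus ?thesis using B(4) B'(4) by simp
  qed
  have le: "f k \<le> g k"
    if f: "incseq f" and g: "incseq g" and fin: "\<And>\<mu>. finite {k. f k = \<mu>}" "\<And>\<mu>. finite {k. g k = \<mu>}"
      and eq: "\<And>\<mu>. card {k. f k = \<mu>} = card {k. g k = \<mu>}" for f g :: "nat \<Rightarrow> real" and k
  proof (rule ccontr)
    assume "\<not> f k \<le> g k"
    define S where "S = g ` {..k}"
    have S: "finite S" by (simp add: S_def)
    have "{..k} \<subseteq> (\<Union>\<mu>\<in>S. {i. g i = \<mu>})" by (auto simp: S_def)
    hence "k + 1 \<le> card (\<Union>\<mu>\<in>S. {i. g i = \<mu>})"
      using card_mono[of "\<Union>\<mu>\<in>S. {i. g i = \<mu>}" "{..k}"] S fin(2) by simp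
    also have "\<dots> = (\<Sum>\<mu>\<in>S. card {i. g i = \<mu>})"
      using S fin(2) by (intro card_UN_disjoint) auto
    also have "\<dots> = (\<Sum>\<mu>\<in>S. card {i. f i = \<mu>})" by (simp add: eq)
    also have "\<dots> = card (\<Union>\<mu>\<in>S. {i. f i = \<mu>})"
      using S fin(1) by (intro card_UN_disjoint[symmetric]) auto
    also have "\<dots> \<le> card {..<k}"
    proof (rule card_mono)
      show "(\<Union>\<mu>\<in>S. {i. f i = \<mu>}) \<subseteq> {..<k}"
      proof
        fix i assume "i \<in> (\<Union>\<mu>\<in>S. {i. f i = \<mu>})"
        then obtain j where j: "j \<le> k" "f i = g j" by (auto simp: S_def)
        have "f i < f k" using \<open>\<not> f k \<le> g k\<close> incseqD[OF g j(1)] j(2) by simp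
        thus "i \<in> {..<k}" using incseqD[OF f, of k i] by (cases "i < k") auto
      qed
    qed simp
    finally show False by simp
  qed
  show ?thesis
    using assms card_eq le[of lam lam'] le[of lam' lam]
    by (intro ext antisym) (auto simp: enumerates_eigenvalues_def)
qed

lemma eigenvalue_eq:
  assumes "enumerates_eigenvalues A lam"
  shows "eigenvalue A k = lam (k - 1)"
  unfolding eigenvalue_def
  using the_equality[of "enumerates_eigenvalues A", OF assms] assms enumerates_eigenvalues_unique
  by metis


section \<open>The diagonal comb\<close>

text \<open>The comb is drawn in the plane, with the backbone on the horizontal axis and vertical teeth.\<close>

datatype comb_edge = Tooth nat | Backbone nat

definition diagonal_comb :: "real \<Rightarrow> (comb_edge, real \<times> real) graph" where
  "diagonal_comb \<alpha> = \<lparr>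
     edges = Tooth ` {1..} \<union> Backbone ` {1..},
     len = (\<lambda>e. case e of
         Tooth n \<Rightarrow> real n powr (-\<alpha>)
       | Backbone n \<Rightarrow> real n powr (-\<alpha>) - real (n + 1) powr (-\<alpha>)),
     param = (\<lambda>e s. case e of
         Tooth n \<Rightarrow> (real n powr (-\<alpha>), s)
       | Backbone n \<Rightarrow> (real (n + 1) powr (-\<alpha>) + s, 0))\<rparr>"

lemma param_in_points: "e \<in> edges G \<Longrightarrow> s \<in> {0..len G e} \<Longrightarrow> param G e s \<in> points G"
  unfolding points_def by blast

lemma walk_in_points: "walk G p r q \<Longrightarrow> p \<in> points G \<and> q \<in> points G"
  by (induction rule: walk.induct) (blast intro: param_in_points)+

lemma walk_nonneg: "walk G p r q \<Longrightarrow> 0 \<le> r"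
  by (induction rule: walk.induct) auto

lemma walk_edge:
  assumes "e \<in> edges G" "s \<in> {0..len G e}" "t \<in> {0..len G e}"
  shows "walk G (param G e s) \<bar>s - t\<bar> (param G e t)"
proof -
  have "walk G (param G e s) 0 (param G e s)"
    using assms by (intro walk.refl param_in_points)
  from walk.step[OF this assms] show ?thesis by simp
qed

lemma walk_trans:
  assumes "walk G p r q" "walk G q r' w"
  shows "walk G p (r + r') w"
  using assms(2)
proof (induction rule: walk.induct)
  case refl
  show ?case using assms(1) by simp
next
  case (step r' e s t)
  from walk.step[OF step.IH step.hyps(2-4)] show ?case by (simp add: add.assoc)
qed

lemma walk_sym: "walk G p r q \<Longrightarrow> walk G q r p"
proof (induction rule: walk.induct)
  case refl
  thus ?case by (rule walk.refl)
next
  case (step r e s t)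
  from walk_trans[OF walk_edge[OF step.hyps(2,4,3)] step.IH]
  show ?case by (simp add: add.commute abs_minus_commute)
qed

lemma path_dist_le: "walk G p r q \<Longrightarrow> path_dist G p q \<le> r"
  using walk_in_points[of G p r q]
  by (auto simp: path_dist_def intro!: cInf_lower bdd_belowI[of _ 0] walk_nonneg)

lemma path_dist_ge:
  assumes "p \<in> points G" "q \<in> points G" "walk G p r0 q"
    and "\<And>r. walk G p r q \<Longrightarrow> d \<le> r"
  shows "d \<le> path_dist G p q"
  using assms by (auto simp: path_dist_def intro!: cInf_greatest)

text \<open>Lower bounds for the lengths of walks turn the shortest-path pseudometric of a connected graph
  into a metric.\<close>

lemma Metric_space_path_dist:
  assumes conn: "\<And>p q. p \<in> points G \<Longrightarrow> q \<in> points G \<Longrightarrow> \<exists>r. walk G p r q"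
    and sep: "\<And>p q. p \<in> points G \<Longrightarrow> q \<in> points G \<Longrightarrow> p \<noteq> q \<Longrightarrow>
      \<exists>d>0. \<forall>r. walk G p r q \<longrightarrow> d \<le> r"
  shows "Metric_space (points G) (path_dist G)"
proof
  fix x y
  show "0 \<le> path_dist G x y"
  proof (cases "x \<in> points G \<and> y \<in> points G")
    case True
    with conn obtain r where "walk G x r y" by blast
    with True show ?thesis by (intro path_dist_ge) (auto intro: walk_nonneg)
  qed (auto simp: path_dist_def)
  have "walk G x r y \<longleftrightarrow> walk G y r x" for r by (auto intro: walk_sym)
  thus "path_dist G x y = path_dist G y x" by (simp add: path_dist_def conj_commute)
next
  fix x y assume xy: "x \<in> points G" "y \<in> points G"
  show "path_dist G x y = 0 \<longleftrightarrow> x = y"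
  proof
    assume 0: "path_dist G x y = 0"
    show "x = y"
    proof (rule ccontr)
      assume "x \<noteq> y"
      with sep xy obtain d where "0 < d" "\<And>r. walk G x r y \<Longrightarrow> d \<le> r" by metis
      moreover obtain r where "walk G x r y" using conn xy by blast
      ultimately have "d \<le> path_dist G x y" using xy by (intro path_dist_ge) auto
      with 0 \<open>0 < d\<close> show False by simp
    qed
  next
    assume "x = y"
    hence "walk G x 0 y" using xy by (auto intro: walk.refl)
    hence "path_dist G x y \<le> 0" "0 \<le> path_dist G x y"
      using xy by (auto intro: path_dist_le path_dist_ge walk_nonneg)
    thus "path_dist G x y = 0" by simp
  qed
next
  fix x y z assume xyz: "x \<in> points G" "y \<in> points G" "z \<in> points G"
  obtain r0 r1 where r: "walk G x r0 y" "walk G y r1 z" using conn xyz by blast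
  have "path_dist G x z - path_dist G y z \<le> path_dist G x y"
  proof (rule path_dist_ge[OF xyz(1,2) r(1)])
    fix a assume a: "walk G x a y"
    have "path_dist G x z - a \<le> path_dist G y z"
    proof (rule path_dist_ge[OF xyz(2,3) r(2)])
      fix b assume "walk G y b z"
      from path_dist_le[OF walk_trans[OF a this]] show "path_dist G x z - a \<le> b" by simp
    qed
    thus "path_dist G x z - path_dist G y z \<le> a" by simp
  qed
  thus "path_dist G x z \<le> path_dist G x y + path_dist G y z" by simp
qed

lemma foot_less: "\<alpha> > 0 \<Longrightarrow> 1 \<le> m \<Longrightarrow> m < n \<Longrightarrow> real n powr (-\<alpha>) < real m powr (-\<alpha>)"
  by (intro powr_less_mono2_neg) auto

lemma foot_le: "\<alpha> > 0 \<Longrightarrow> 1 \<le> m \<Longrightarrow> m \<le> n \<Longrightarrow> real n powr (-\<alpha>) \<le> real m powr (-\<alpha>)"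
  using foot_less[of \<alpha> m n] by (cases "m = n") auto

lemma points_diagonal_comb:
  assumes "\<alpha> > 0"
  shows "points (diagonal_comb \<alpha>) =
    {0<..1} \<times> {0} \<union> (\<Union>n\<in>{1..}. {real n powr (-\<alpha>)} \<times> {0..real n powr (-\<alpha>)})"
    (is "_ = ?B \<union> ?T")
proof
  show "points (diagonal_comb \<alpha>) \<subseteq> ?B \<union> ?T"
  proof
    fix p assume "p \<in> points (diagonal_comb \<alpha>)"
    then obtain n s where n: "1 \<le> n" and
      "p = (real n powr (-\<alpha>), s) \<and> 0 \<le> s \<and> s \<le> real n powr (-\<alpha>) \<or>
       p = (real (n + 1) powr (-\<alpha>) + s, 0) \<and> 0 \<le> s \<and>
         s \<le> real n powr (-\<alpha>) - real (n + 1) powr (-\<alpha>)"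
      by (fastforce simp: points_def diagonal_comb_def)
    thus "p \<in> ?B \<union> ?T"
    proof (elim disjE conjE, goal_cases)
      case 1
      with n show ?case by auto
    next
      case 2
      have "0 < real (n + 1) powr (-\<alpha>)" unfolding powr_gt_zero by linarith
      hence pos: "0 < real (n + 1) powr (-\<alpha>) + s" using 2(3) by (rule add_pos_nonneg)
      have "real (n + 1) powr (-\<alpha>) + s \<le> real n powr (-\<alpha>)" using 2(4) by (simp add: algebra_simps)
      also have "\<dots> \<le> 1" using foot_le[OF assms order.refl n] by simp
      finally have "real (n + 1) powr (-\<alpha>) + s \<in> {0<..1}" using pos by simp
      thus ?case unfolding 2(2) by blast
    qed
  qed
next
  have "p \<in> points (diagonal_comb \<alpha>)" if "p \<in> ?T" for p
    using that by (force simp: points_def diagonal_comb_def)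
  moreover have "(x, 0) \<in> points (diagonal_comb \<alpha>)" if x: "0 < x" "x \<le> 1" for x
  proof -
    define y where "y = x powr (-1/\<alpha>)"
    define n where "n = nat \<lfloor>y\<rfloor>"
    have y: "1 \<le> y"
    proof -
      have "1 powr (-1/\<alpha>) \<le> x powr (-1/\<alpha>)"
        using x assms by (intro powr_mono2') auto
      thus ?thesis by (simp add: y_def)
    qed
    have yx: "y powr (-\<alpha>) = x"
      using x assms by (simp add: y_def powr_powr)
    have n: "1 \<le> n" "real n \<le> y" "y \<le> real (n + 1)"
      using y unfolding n_def by (simp_all add: le_nat_iff le_floor_iff) linarith
    have a: "x \<le> real n powr (-\<alpha>)"
      unfolding yx[symmetric] using n assms by (intro powr_mono2') auto
    have b: "real (n + 1) powr (-\<alpha>) \<le> x"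
      unfolding yx[symmetric] using n y assms by (intro powr_mono2') auto
    have "(x, 0) \<in> param (diagonal_comb \<alpha>) (Backbone n) ` {0..len (diagonal_comb \<alpha>) (Backbone n)}"
      using a b
      by (auto simp: diagonal_comb_def intro!: image_eqI[of _ _ "x - real (n + 1) powr (-\<alpha>)"])
    moreover have "Backbone n \<in> edges (diagonal_comb \<alpha>)"
      using n by (auto simp: diagonal_comb_def)
    ultimately show ?thesis unfolding points_def by blast
  qed
  ultimately show "?B \<union> ?T \<subseteq> points (diagonal_comb \<alpha>)" by auto
qed

lemma diagonal_comb_simps:
  "edges (diagonal_comb \<alpha>) = Tooth ` {1..} \<union> Backbone ` {1..}"
  "len (diagonal_comb \<alpha>) (Tooth n) = real n powr (-\<alpha>)"
  "len (diagonal_comb \<alpha>) (Backbone n) = real n powr (-\<alpha>) - real (n + 1) powr (-\<alpha>)"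
  "param (diagonal_comb \<alpha>) (Tooth n) s = (real n powr (-\<alpha>), s)"
  "param (diagonal_comb \<alpha>) (Backbone n) s = (real (n + 1) powr (-\<alpha>) + s, 0)"
  by (simp_all add: diagonal_comb_def)

lemma walk_diagonal_comb_ge:
  "walk (diagonal_comb \<alpha>) p r q \<Longrightarrow> \<bar>fst p - fst q\<bar> + \<bar>snd p - snd q\<bar> \<le> r"
proof (induction rule: walk.induct)
  case (step r e s t)
  thus ?case by (cases e) (auto simp: diagonal_comb_def)
qed auto

lemma diagonal_comb_glue:
  assumes \<alpha>: "\<alpha> > 0" and e: "e \<in> edges (diagonal_comb \<alpha>)" "e' \<in> edges (diagonal_comb \<alpha>)"
    and st: "s \<in> {0..len (diagonal_comb \<alpha>) e}" "t \<in> {0..len (diagonal_comb \<alpha>) e'}"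
    and eq: "param (diagonal_comb \<alpha>) e s = param (diagonal_comb \<alpha>) e' t"
  shows "e = e' \<and> s = t \<or>
    s \<in> {0, len (diagonal_comb \<alpha>) e} \<and> t \<in> {0, len (diagonal_comb \<alpha>) e'}"
proof -
  have inj: "m = n" if "real m powr (-\<alpha>) = real n powr (-\<alpha>)" "1 \<le> m" "1 \<le> n" for m n
    using that foot_less[OF \<alpha>, of m n] foot_less[OF \<alpha>, of n m] by (cases m n rule: linorder_cases) auto
  have TB: "t = 0 \<or> t = real m powr (-\<alpha>) - real (m + 1) powr (-\<alpha>)"
    if "real n powr (-\<alpha>) = real (m + 1) powr (-\<alpha>) + t" "1 \<le> n" "1 \<le> m" "0 \<le> t"
      "t \<le> real m powr (-\<alpha>) - real (m + 1) powr (-\<alpha>)" for n m t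
  proof -
    have "n \<ge> m" using that foot_less[OF \<alpha>, of n m] by force
    moreover have "n \<le> m + 1" using that foot_less[OF \<alpha>, of "m + 1" n] by force
    ultimately have "n = m \<or> n = m + 1" by auto
    thus ?thesis using that(1) by auto
  qed
  have BB: "s = 0 \<and> t = real k powr (-\<alpha>) - real (k + 1) powr (-\<alpha>)"
    if "real (m + 1) powr (-\<alpha>) + s = real (k + 1) powr (-\<alpha>) + t" "1 \<le> m" "m < k" "0 \<le> s" "0 \<le> t"
      "t \<le> real k powr (-\<alpha>) - real (k + 1) powr (-\<alpha>)" for m k s t
    using that foot_le[OF \<alpha>, of "m + 1" k] by linarith
  show ?thesis
  proof (cases e; cases e')
    fix n m assume "e = Tooth n" "e' = Tooth m"
    thus ?thesis using e st eq inj[of n m] by (auto simp: diagonal_comb_def)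
  next
    fix n m assume "e = Tooth n" "e' = Backbone m"
    thus ?thesis using e st eq TB[of n m t] by (auto simp: diagonal_comb_def)
  next
    fix n m assume "e = Backbone m" "e' = Tooth n"
    thus ?thesis using e st eq TB[of n m s] by (auto simp: diagonal_comb_def)
  next
    fix m k assume "e = Backbone m" "e' = Backbone k"
    thus ?thesis using e st eq BB[of m s k t] BB[of k t m s]
      by (cases m k rule: linorder_cases) (auto simp: diagonal_comb_def)
  qed
qed

lemma diagonal_comb_connected:
  assumes \<alpha>: "\<alpha> > 0" and "p \<in> points (diagonal_comb \<alpha>)" "q \<in> points (diagonal_comb \<alpha>)"
  shows "\<exists>r. walk (diagonal_comb \<alpha>) p r q"
proof -
  let ?G = "diagonal_comb \<alpha>"
  have len: "0 \<le> len ?G e" if "e \<in> edges ?G" for e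
    using that foot_le[OF \<alpha>, of n "n + 1" for n] by (auto simp: diagonal_comb_def)
  have edge: "\<exists>r. walk ?G (1, 0) r (param ?G e t)"
    if "\<exists>r. walk ?G (1, 0) r (param ?G e s)" "e \<in> edges ?G" "s \<in> {0..len ?G e}" "t \<in> {0..len ?G e}"
    for e s t
    using that by (meson walk.step)
  have foot: "\<exists>r. walk ?G (1, 0) r (real n powr (-\<alpha>), 0)" if "1 \<le> n" for n
    using that
  proof (induction n rule: dec_induct)
    case base
    have "(1, 0) \<in> points ?G" by (simp add: points_diagonal_comb[OF \<alpha>])
    hence "walk ?G (1, 0) 0 (1, 0)" by (rule walk.refl)
    thus ?case by auto
  next
    case (step n)
    have B: "Backbone n \<in> edges ?G" using step by (auto simp: diagonal_comb_def)
    show ?case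
      using edge[of "Backbone n" "len ?G (Backbone n)" 0] step.IH B len[OF B]
      by (simp add: diagonal_comb_simps add.commute)
  qed
  have reach: "\<exists>r. walk ?G (1, 0) r x" if "x \<in> points ?G" for x
  proof -
    from that obtain e t where e: "e \<in> edges ?G" "t \<in> {0..len ?G e}" "x = param ?G e t"
      by (auto simp: points_def)
    have "\<exists>r. walk ?G (1, 0) r (param ?G e 0)"
    proof (cases e)
      case (Tooth n)
      thus ?thesis using e(1) foot[of n] by (auto simp: diagonal_comb_simps)
    next
      case (Backbone n)
      thus ?thesis using foot[of "n + 1"] by (simp add: diagonal_comb_simps)
    qed
    from edge[OF this e(1) _ e(2)] len[OF e(1)] e(3) show ?thesis by simp
  qed
  from reach assms(2,3) show ?thesis by (meson walk_sym walk_trans)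
qed

lemma metric_graph_diagonal_comb:
  assumes \<alpha>: "\<alpha> > 0"
  shows "metric_graph (diagonal_comb \<alpha>)"
  unfolding metric_graph_def
proof (intro conjI ballI impI)
  show "countable (edges (diagonal_comb \<alpha>))" by (simp add: diagonal_comb_def)
  show "0 < len (diagonal_comb \<alpha>) e" if "e \<in> edges (diagonal_comb \<alpha>)" for e
    using that foot_less[OF \<alpha>, of n "n + 1" for n] by (auto simp: diagonal_comb_def)
  show "Metric_space (points (diagonal_comb \<alpha>)) (path_dist (diagonal_comb \<alpha>))"
  proof (rule Metric_space_path_dist)
    fix p q :: "real \<times> real" assume "p \<noteq> q"
    hence "0 < \<bar>fst p - fst q\<bar> + \<bar>snd p - snd q\<bar>" by (auto simp: prod_eq_iff)
    thus "\<exists>d>0. \<forall>r. walk (diagonal_comb \<alpha>) p r q \<longrightarrow> d \<le> r"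
      using walk_diagonal_comb_ge by blast
  qed (use diagonal_comb_connected[OF \<alpha>] in blast)
qed (use diagonal_comb_glue[OF \<alpha>] diagonal_comb_connected[OF \<alpha>] in blast)+

end

theory Submission
  imports Defs "HOL-Complex_Analysis.Great_Picard"
begin

text \<open>
  Write \<open>a\<close> for the energy form and \<open>h\<close> for the inner product of \<open>L\<^sup>2\<close>, both on the Sobolev space
  \<open>V = H\<^sup>1\<close> of the comb, and \<open>E = a(u,u)\<close>.

  Existence of the eigenvalues. The spectral theorem is proved by minimising the Rayleigh quotient
  \<open>a(u,u) / h(u,u)\<close> successively on the orthogonal complements of the minimisers found before. This
  works if \<open>V\<close> is complete for \<open>a\<close>, if \<open>h \<le> C a\<close>, and if every sequence of bounded energy has a
  subsequence that is Cauchy for \<open>h\<close> (\<open>Rayleigh_minimizer\<close>, \<open>eigenvector\<close>, \<open>eigenspace_eq_span\<close>). The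
  construction yields both halves of the min-max principle: \<open>k + 1\<close> independent functions on whose
  span \<open>a \<le> L h\<close> bound the eigenvalue with index \<open>k\<close> (counted from \<open>0\<close>) from above
  (\<open>lam_le_if_subspace\<close>), and \<open>k\<close> linear functionals such that \<open>a \<ge> L h\<close> on their joint kernel bound
  it from below (\<open>lam_ge_if_functionals\<close>).

  Upper bound. On each of the first \<open>k\<close> teeth take the function that grows linearly from \<open>0\<close> at the
  foot. These functions have disjoint supports, and on a tooth of length \<open>l\<close> the quotient is
  \<open>3 / l\<^sup>2\<close>, which is at most \<open>3 k powr (2 \<alpha>)\<close>.

  Lower bound. The decisive point is that a function of \<open>V\<close> tends to \<open>0\<close> along the backbone towards the
  missing point \<open>0\<close>: its values at the feet \<open>n powr (-\<alpha>)\<close> form a Cauchy sequence, and a limit other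
  than \<open>0\<close> would force infinite mass on the teeth, whose total length is infinite because \<open>\<alpha> < 1\<close>
  (\<open>foot_val_tendsto_0\<close>). Hence the squared value at the \<open>n\<close>-th foot is at most \<open>n powr (-\<alpha>) E\<close>, and
  the mass of all teeth with \<open>n > N\<close> is at most of order \<open>N powr (1 - 2 \<alpha>) E\<close>. For \<open>N = K\<^sup>2\<close> this is \<open>K powr (2 - 4 \<alpha>) E\<close>. Now let \<open>u\<close> vanish on a set of order \<open>K\<close> points
  (\<open>grid\<close>). On the teeth and backbone edges with \<open>n \<le> K\<close> they are placed at distance at most
  \<open>K powr (-\<alpha>)\<close>, so that these edges carry mass at most of order \<open>K powr (-2 \<alpha>) E\<close>. On the
  remaining backbone, of length \<open>K powr (-\<alpha>)\<close>, they are feet chosen at distance about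
  \<open>K powr (-1 - \<alpha>)\<close>; then the squared values at all feet with \<open>n > K\<close> are of order
  \<open>K powr (-1 - \<alpha>) E\<close>, and the teeth with \<open>K < n \<le> K\<^sup>2\<close>, of total length of order
  \<open>K powr (2 - 2 \<alpha>)\<close>, carry mass at most of order \<open>K powr (1 - 3 \<alpha>) E\<close>. Since \<open>\<alpha> < 1\<close>, all
  these contributions are at most of order \<open>K powr (2 - 4 \<alpha>) E\<close> (\<open>mass_le_energy_grid\<close>), and the
  lower half of the min-max principle gives the bound.

  The same inequality, in a form that allows nonzero values on the grid, shows that sequences of
  bounded energy have subsequences that are Cauchy in \<open>L\<^sup>2\<close>: it suffices to make them converge at the
  countably many grid points (\<open>H1_compact\<close>).
\<close>

section \<open>Spectral theory of a pair of Hermitian forms\<close>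

text \<open>
  Gaussian elimination: one equation is solved for a pivot unknown \<open>p\<close>, which leaves one equation and
  one unknown less. This is the only dimension count behind the min-max principle.
\<close>

lemma homogeneous_system_nontrivial_solution:
  fixes M :: "nat \<Rightarrow> 'i \<Rightarrow> 'a::field"
  assumes "finite I" "m < card I"
  shows "\<exists>c. (\<exists>i\<in>I. c i \<noteq> 0) \<and> (\<forall>j<m. (\<Sum>i\<in>I. c i * M j i) = 0)"
  using assms
proof (induction m arbitrary: I M)
  case 0
  then obtain i where "i \<in> I" by fastforce
  thus ?case by (intro exI[of _ "\<lambda>_. 1"]) auto
next
  case (Suc m)
  show ?case
  proof (cases "\<forall>i\<in>I. M m i = 0")
    case True
    obtain c where c: "\<exists>i\<in>I. c i \<noteq> 0" "\<forall>j<m. (\<Sum>i\<in>I. c i * M j i) = 0"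
      using Suc.IH[of I M] Suc.prems by auto
    have "(\<Sum>i\<in>I. c i * M j i) = 0" if "j < Suc m" for j
      using that c(2) True by (cases "j = m") auto
    with c(1) show ?thesis by blast
  next
    case False
    then obtain p where p: "p \<in> I" "M m p \<noteq> 0" by blast
    let ?J = "I - {p}"
    define N where "N j i = M j i - M j p * M m i / M m p" for j i
    obtain c where c: "\<exists>i\<in>?J. c i \<noteq> 0" "\<forall>j<m. (\<Sum>i\<in>?J. c i * N j i) = 0"
      using Suc.IH[of ?J N] Suc.prems p card_Diff_singleton[of p I] by fastforce
    define t where "t = (\<Sum>i\<in>?J. c i * M m i)"
    define d where "d = c(p := - t / M m p)"
    have split: "(\<Sum>i\<in>I. d i * M j i) = (\<Sum>i\<in>?J. c i * M j i) - t * M j p / M m p" for j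
    proof -
      have "(\<Sum>i\<in>I. d i * M j i) = d p * M j p + (\<Sum>i\<in>?J. d i * M j i)"
        using Suc.prems(1) p(1) by (rule sum.remove)
      also have "(\<Sum>i\<in>?J. d i * M j i) = (\<Sum>i\<in>?J. c i * M j i)"
        by (intro sum.cong) (auto simp: d_def)
      finally show ?thesis by (simp add: d_def)
    qed
    have "(\<Sum>i\<in>I. d i * M j i) = 0" if "j < Suc m" for j
    proof (cases "j = m")
      case True
      thus ?thesis using p by (simp add: split t_def)
    next
      case False
      hence "0 = (\<Sum>i\<in>?J. c i * N j i)" using c(2) that by simp
      also have "\<dots> = (\<Sum>i\<in>?J. c i * M j i - c i * M m i * (M j p / M m p))"
        by (simp add: N_def algebra_simps)
      also have "\<dots> = (\<Sum>i\<in>?J. c i * M j i) - t * (M j p / M m p)"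
        by (simp only: sum_subtractf t_def sum_distrib_right)
      finally show ?thesis by (simp add: split)
    qed
    moreover have "\<exists>i\<in>I. d i \<noteq> 0" using c(1) by (auto simp: d_def)
    ultimately show ?thesis by blast
  qed
qed

text \<open>
  The laws are required on \<open>V\<close> only: for arbitrary functions on a graph the forms are given by
  integrals and infinite sums that may fail to converge.
\<close>

locale hermitian_form = vector_space scale
  for scale :: "complex \<Rightarrow> 'v::ab_group_add \<Rightarrow> 'v" (infixr \<open>\<odot>\<close> 75) +
  fixes V :: "'v set" and f :: "'v \<Rightarrow> 'v \<Rightarrow> complex"
  assumes subspace: "subspace V"
    and add_left: "u \<in> V \<Longrightarrow> v \<in> V \<Longrightarrow> w \<in> V \<Longrightarrow> f (u + v) w = f u w + f v w"
    and scale_left: "u \<in> V \<Longrightarrow> w \<in> V \<Longrightarrow> f (c \<odot> u) w = c * f u w"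
    and herm: "u \<in> V \<Longrightarrow> w \<in> V \<Longrightarrow> f w u = cnj (f u w)"
    and nonneg: "u \<in> V \<Longrightarrow> 0 \<le> Re (f u u)"
begin

abbreviation Q :: "'v \<Rightarrow> real" where "Q u \<equiv> Re (f u u)"

lemma in_V [intro, simp]:
  "0 \<in> V" "u \<in> V \<Longrightarrow> c \<odot> u \<in> V" "u \<in> V \<Longrightarrow> v \<in> V \<Longrightarrow> u + v \<in> V" "u \<in> V \<Longrightarrow> v \<in> V \<Longrightarrow> u - v \<in> V"
  "u \<in> V \<Longrightarrow> - u \<in> V"
  using subspace by (auto intro: subspace_0 subspace_scale subspace_add subspace_diff subspace_neg)

lemma sum_in_V: "(\<And>i. i \<in> I \<Longrightarrow> g i \<in> V) \<Longrightarrow> (\<Sum>i\<in>I. g i) \<in> V"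
  by (rule subspace_sum[OF subspace])

lemma zero_left [simp]: "w \<in> V \<Longrightarrow> f 0 w = 0"
  using scale_left[of 0 w 0] by simp

lemma minus_left: "u \<in> V \<Longrightarrow> w \<in> V \<Longrightarrow> f (- u) w = - f u w"
  using scale_left[of u w "-1"] by simp

lemma diff_left: "u \<in> V \<Longrightarrow> v \<in> V \<Longrightarrow> w \<in> V \<Longrightarrow> f (u - v) w = f u w - f v w"
  using add_left[of u "- v" w] minus_left[of v w] by simp

lemma add_right: "u \<in> V \<Longrightarrow> v \<in> V \<Longrightarrow> w \<in> V \<Longrightarrow> f w (u + v) = f w u + f w v"
  using add_left[of u v w] herm[of "u + v" w] herm[of u w] herm[of v w] by simp

lemma diff_right: "u \<in> V \<Longrightarrow> v \<in> V \<Longrightarrow> w \<in> V \<Longrightarrow> f w (u - v) = f w u - f w v"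
  using diff_left[of u v w] herm[of "u - v" w] herm[of u w] herm[of v w] by simp

lemma scale_right: "u \<in> V \<Longrightarrow> w \<in> V \<Longrightarrow> f w (c \<odot> u) = cnj c * f w u"
  using scale_left[of u w c] herm[of "c \<odot> u" w] herm[of u w] by simp

lemma sum_left:
  "(\<And>i. i \<in> I \<Longrightarrow> g i \<in> V) \<Longrightarrow> w \<in> V \<Longrightarrow> f (\<Sum>i\<in>I. g i) w = (\<Sum>i\<in>I. f (g i) w)"
  by (induction I rule: infinite_finite_induct) (auto simp: add_left sum_in_V)

lemma sum_right:
  "(\<And>i. i \<in> I \<Longrightarrow> g i \<in> V) \<Longrightarrow> w \<in> V \<Longrightarrow> f w (\<Sum>i\<in>I. g i) = (\<Sum>i\<in>I. f w (g i))"
  using herm[of "\<Sum>i\<in>I. g i" w] herm[of "g i" w for i]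
  by (simp add: sum_left sum_in_V)

lemma self_real: "u \<in> V \<Longrightarrow> f u u = complex_of_real (Q u)"
  using herm[of u u] by (metis Reals_cnj_iff complex_is_Real_iff of_real_Re)

lemma Q_scale: "u \<in> V \<Longrightarrow> Q (c \<odot> u) = (cmod c)\<^sup>2 * Q u"
proof -
  assume u: "u \<in> V"
  have "f (c \<odot> u) (c \<odot> u) = (c * cnj c) * f u u" using u by (simp add: scale_left scale_right)
  also have "\<dots> = complex_of_real ((cmod c)\<^sup>2 * Q u)"
    by (subst self_real[OF u]) (simp only: complex_norm_square[symmetric] of_real_mult)
  finally show "Q (c \<odot> u) = (cmod c)\<^sup>2 * Q u" by simp
qed

lemma Q_add: "u \<in> V \<Longrightarrow> v \<in> V \<Longrightarrow> Q (u + v) = Q u + Q v + 2 * Re (f u v)"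
  using herm[of u v] by (simp add: add_left add_right)

lemma Q_diff: "u \<in> V \<Longrightarrow> v \<in> V \<Longrightarrow> Q (u - v) = Q u + Q v - 2 * Re (f u v)"
  using herm[of u v] by (simp add: diff_left diff_right)

lemma parallelogram: "u \<in> V \<Longrightarrow> v \<in> V \<Longrightarrow> Q (u + v) + Q (u - v) = 2 * Q u + 2 * Q v"
  by (simp add: Q_add Q_diff)

lemma Cauchy_Schwarz:
  assumes u: "u \<in> V" and v: "v \<in> V"
  shows "(cmod (f u v))\<^sup>2 \<le> Q u * Q v"
proof -
  let ?z = "f u v"
  have ineq: "0 \<le> Q u - 2 * t * (cmod ?z)\<^sup>2 + t\<^sup>2 * (cmod ?z)\<^sup>2 * Q v" for t :: real
  proof -
    let ?c = "complex_of_real t * ?z"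
    have "0 \<le> Q (u - ?c \<odot> v)" using u v by (intro nonneg) auto
    also have "\<dots> = Q u + Q (?c \<odot> v) - 2 * Re (f u (?c \<odot> v))"
      using u v by (intro Q_diff) auto
    also have "\<dots> = Q u + (cmod ?c)\<^sup>2 * Q v - 2 * Re (cnj ?c * ?z)"
      by (simp only: Q_scale[OF v] scale_right[OF v u])
    also have "Re (cnj ?c * ?z) = t * (cmod ?z)\<^sup>2"
      by (simp add: cmod_def power2_eq_square algebra_simps)
    also have "(cmod ?c)\<^sup>2 = t\<^sup>2 * (cmod ?z)\<^sup>2" by (simp add: norm_mult power_mult_distrib)
    finally show ?thesis by (simp add: algebra_simps)
  qed
  show ?thesis
  proof (cases "Q v = 0")
    case True
    have "?z = 0"
    proof (rule ccontr)
      assume nz: "?z \<noteq> 0"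
      \<comment> \<open>If \<open>Q v = 0\<close>, then the right-hand side of \<open>ineq\<close> is affine in \<open>t\<close>, and a large \<open>t\<close> makes it negative.\<close>
      have "0 \<le> Q u - 2 * ((Q u + 1) / (cmod ?z)\<^sup>2) * (cmod ?z)\<^sup>2"
        using ineq[of "(Q u + 1) / (cmod ?z)\<^sup>2"] True by simp
      also have "\<dots> = - Q u - 2" using nz by simp
      finally show False using nonneg[OF u] by simp
    qed
    thus ?thesis using nonneg[OF u] nonneg[OF v] by simp
  next
    case False
    hence pos: "0 < Q v" using nonneg[OF v] by simp
    \<comment> \<open>The minimum over \<open>t\<close> is attained at \<open>1 / Q v\<close>.\<close>
    have "0 \<le> Q u - (cmod ?z)\<^sup>2 / Q v"
      using ineq[of "1 / Q v"] pos by (simp add: power2_eq_square field_simps)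
    thus ?thesis using pos by (simp add: field_simps)
  qed
qed

lemma tendsto_left:
  assumes x: "\<And>n. x n \<in> V" and u: "u \<in> V" and v: "v \<in> V" and lim: "(\<lambda>n. Q (x n - u)) \<longlonglongrightarrow> 0"
  shows "(\<lambda>n. f (x n) v) \<longlonglongrightarrow> f u v"
proof -
  have "(\<lambda>n. sqrt (Q (x n - u) * Q v)) \<longlonglongrightarrow> sqrt (0 * Q v)" by (intro tendsto_intros lim)
  hence lim': "(\<lambda>n. sqrt (Q (x n - u) * Q v)) \<longlonglongrightarrow> 0" by simp
  have "norm (f (x n) v - f u v) \<le> sqrt (Q (x n - u) * Q v)" for n
    using Cauchy_Schwarz[of "x n - u" v] x u v by (simp add: diff_left real_le_rsqrt)
  hence "(\<lambda>n. f (x n) v - f u v) \<longlonglongrightarrow> 0" by (intro Lim_null_comparison[OF _ lim']) simp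
  thus ?thesis by (simp add: LIM_zero_iff)
qed

lemma tendsto_Q:
  assumes x: "\<And>n. x n \<in> V" and u: "u \<in> V" and lim: "(\<lambda>n. Q (x n - u)) \<longlonglongrightarrow> 0"
  shows "(\<lambda>n. Q (x n)) \<longlonglongrightarrow> Q u"
proof -
  have "Q (x n) = Q (x n - u) - Q u + 2 * Re (f (x n) u)" for n
    using x u Q_diff[of "x n" u] by simp
  moreover have "(\<lambda>n. Q (x n - u) - Q u + 2 * Re (f (x n) u)) \<longlonglongrightarrow> 0 - Q u + 2 * Re (f u u)"
    by (intro tendsto_intros lim tendsto_left x u)
  ultimately show ?thesis by simp
qed

lemma Q_orthogonal_sum:
  assumes w: "\<And>i. i \<in> I \<Longrightarrow> w i \<in> V" and orth: "\<And>i j. i \<in> I \<Longrightarrow> j \<in> I \<Longrightarrow> i \<noteq> j \<Longrightarrow> f (w i) (w j) = 0"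
    and I: "finite I"
  shows "Q (\<Sum>i\<in>I. c i \<odot> w i) = (\<Sum>i\<in>I. (cmod (c i))\<^sup>2 * Q (w i))"
proof -
  have "f (\<Sum>i\<in>I. c i \<odot> w i) (\<Sum>i\<in>I. c i \<odot> w i) = (\<Sum>i\<in>I. \<Sum>j\<in>I. f (c i \<odot> w i) (c j \<odot> w j))"
    using w by (simp add: sum_left sum_right sum_in_V) (rule sum.swap)
  also have "\<dots> = (\<Sum>i\<in>I. f (c i \<odot> w i) (c i \<odot> w i))"
  proof (rule sum.cong[OF HOL.refl])
    fix i assume i: "i \<in> I"
    have "(\<Sum>j\<in>I. f (c i \<odot> w i) (c j \<odot> w j)) = (\<Sum>j\<in>I. if j = i then f (c i \<odot> w i) (c i \<odot> w i) else 0)"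
      using i w orth by (intro sum.cong) (auto simp: scale_left scale_right)
    thus "(\<Sum>j\<in>I. f (c i \<odot> w i) (c j \<odot> w j)) = f (c i \<odot> w i) (c i \<odot> w i)" using i I by simp
  qed
  finally have "Q (\<Sum>i\<in>I. c i \<odot> w i) = (\<Sum>i\<in>I. Q (c i \<odot> w i))" by simp
  also have "\<dots> = (\<Sum>i\<in>I. (cmod (c i))\<^sup>2 * Q (w i))" using w by (simp add: Q_scale)
  finally show ?thesis .
qed

lemma orthogonal_independent:
  assumes w: "\<And>i. i \<in> I \<Longrightarrow> w i \<in> V" and orth: "\<And>i j. i \<in> I \<Longrightarrow> j \<in> I \<Longrightarrow> i \<noteq> j \<Longrightarrow> f (w i) (w j) = 0"
    and pos: "\<And>i. i \<in> I \<Longrightarrow> 0 < Q (w i)" and I: "finite I"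
  shows "inj_on w I" "independent (w ` I)"
proof -
  show inj: "inj_on w I"
  proof (rule inj_onI)
    fix i j assume ij: "i \<in> I" "j \<in> I" "w i = w j"
    thus "i = j" using orth[of i j] pos[of i] by (cases "i = j") auto
  qed
  show "independent (w ` I)"
  proof
    assume "dependent (w ` I)"
    then obtain c where c: "\<exists>v\<in>w ` I. c v \<noteq> 0" "(\<Sum>v\<in>w ` I. c v \<odot> v) = 0"
      using I by (auto simp: dependent_finite)
    have "0 = Q (\<Sum>i\<in>I. c (w i) \<odot> w i)" using c(2) inj by (simp add: sum.reindex)
    also have "\<dots> = (\<Sum>i\<in>I. (cmod (c (w i)))\<^sup>2 * Q (w i))" using w orth I by (rule Q_orthogonal_sum)
    finally have "\<forall>i\<in>I. (cmod (c (w i)))\<^sup>2 * Q (w i) = 0"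
      using I pos by (subst (asm) eq_commute, subst (asm) sum_nonneg_eq_0_iff) (auto simp: less_imp_le)
    thus False using c(1) pos by force
  qed
qed

end

text \<open>
  The energy form \<open>a\<close> and the mass form \<open>h\<close>. Completeness and compactness are stated with sequences of
  elements of \<open>V\<close>, so that neither the Hilbert space completion for \<open>h\<close> nor an operator on it has to be
  constructed; they say that \<open>V\<close> is a Hilbert space for \<open>a\<close> which is compactly embedded into the
  completion for \<open>h\<close>.
\<close>

locale discrete_forms = vector_space scale + a: hermitian_form scale V a + h: hermitian_form scale V h
  for scale :: "complex \<Rightarrow> 'v::ab_group_add \<Rightarrow> 'v" (infixr \<open>\<odot>\<close> 75) and V a h +
  fixes C :: real
  assumes coercive: "u \<in> V \<Longrightarrow> Re (h u u) \<le> C * Re (a u u)"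
    and definite: "u \<in> V \<Longrightarrow> Re (h u u) = 0 \<Longrightarrow> u = 0"
    and complete: "(\<And>n. x n \<in> V) \<Longrightarrow>
      (\<And>\<epsilon>. \<epsilon> > 0 \<Longrightarrow> \<exists>N. \<forall>m\<ge>N. \<forall>n\<ge>N. Re (a (x m - x n) (x m - x n)) < \<epsilon>) \<Longrightarrow>
      \<exists>u\<in>V. (\<lambda>n. Re (a (x n - u) (x n - u))) \<longlonglongrightarrow> 0"
    and compact: "(\<And>n. x n \<in> V) \<Longrightarrow> (\<And>n. Re (a (x n) (x n)) \<le> M) \<Longrightarrow>
      \<exists>r::nat \<Rightarrow> nat. strict_mono r \<and> (\<forall>\<epsilon>>0. \<exists>N. \<forall>m\<ge>N. \<forall>n\<ge>N.
        Re (h (x (r m) - x (r n)) (x (r m) - x (r n))) < \<epsilon>)"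
    and infinite_dim: "finite B \<Longrightarrow> \<not> V \<subseteq> span B"
begin

lemma h_pos: "u \<in> V \<Longrightarrow> u \<noteq> 0 \<Longrightarrow> 0 < h.Q u"
  using definite[of u] h.nonneg[of u] by fastforce

lemma normalize:
  assumes "u \<in> V" "u \<noteq> 0"
  defines "v \<equiv> complex_of_real (1 / sqrt (h.Q u)) \<odot> u"
  shows "h.Q v = 1" "a.Q v = a.Q u / h.Q u"
proof -
  have "(cmod (complex_of_real (1 / sqrt (h.Q u))))\<^sup>2 = 1 / h.Q u"
    using h_pos[OF assms(1,2)] by (simp only: norm_of_real) (simp add: power_divide)
  thus "h.Q v = 1" "a.Q v = a.Q u / h.Q u"
    using h_pos[OF assms(1,2)] assms(1) by (simp_all add: v_def h.Q_scale a.Q_scale)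
qed

text \<open>
  The direct method. A minimising sequence has bounded energy, hence a subsequence that is Cauchy for
  \<open>h\<close>. The parallelogram laws of both forms turn this into the Cauchy property for \<open>a\<close>: the midpoints of
  two late members have almost the mass \<open>1\<close>, so their energy is almost at least the infimum \<open>\<mu>\<close>, and
  little is left for the energy of the difference.
\<close>

lemma Rayleigh_minimizer:
  assumes X: "subspace X" "X \<subseteq> V"
    and closed: "\<And>x u. (\<And>n. x n \<in> X) \<Longrightarrow> u \<in> V \<Longrightarrow> (\<lambda>n. h.Q (x n - u)) \<longlonglongrightarrow> 0 \<Longrightarrow> u \<in> X"
    and nontrivial: "w \<in> X" "w \<noteq> 0"
  obtains u where "u \<in> X" "h.Q u = 1" "\<And>v. v \<in> X \<Longrightarrow> a.Q u * h.Q v \<le> a.Q v"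
proof -
  define S where "S = {a.Q v | v. v \<in> X \<and> h.Q v = 1}"
  define \<mu> where "\<mu> = Inf S"
  have XV: "v \<in> V" if "v \<in> X" for v using X that by blast
  have Xn: "complex_of_real r \<odot> v \<in> X" if "v \<in> X" for r v using X(1) that by (rule subspace_scale)
  have S_ratio: "a.Q v / h.Q v \<in> S" if v: "v \<in> X" "v \<noteq> 0" for v
    unfolding S_def mem_Collect_eq
    using normalize[OF XV[OF v(1)] v(2)] Xn[OF v(1), of "1 / sqrt (h.Q v)"] by metis
  have ne: "S \<noteq> {}" using S_ratio[OF nontrivial] by blast
  have bdd: "bdd_below S" unfolding S_def using a.nonneg XV by (intro bdd_belowI[of _ 0]) auto
  have \<mu>0: "0 \<le> \<mu>" unfolding \<mu>_def using ne by (rule cInf_greatest) (auto simp: S_def a.nonneg XV)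
  \<comment> \<open>By homogeneity, the bound extends from the unit sphere to all of \<open>X\<close>.\<close>
  have Ray: "\<mu> * h.Q v \<le> a.Q v" if v: "v \<in> X" for v
  proof (cases "v = 0")
    case False
    have "\<mu> \<le> a.Q v / h.Q v" unfolding \<mu>_def using S_ratio[OF v False] bdd by (rule cInf_lower)
    thus ?thesis using h_pos[OF XV[OF v] False] by (simp add: field_simps)
  qed simp
  have "\<exists>v. v \<in> X \<and> h.Q v = 1 \<and> a.Q v < \<mu> + 1 / real (Suc n)" for n
  proof -
    have "Inf S < \<mu> + 1 / real (Suc n)" by (simp add: \<mu>_def)
    then obtain s where "s \<in> S" "s < \<mu> + 1 / real (Suc n)" using ne cInf_lessD by metis
    thus ?thesis by (auto simp: S_def)
  qed
  then obtain x where x: "\<And>n. x n \<in> X" "\<And>n. h.Q (x n) = 1" "\<And>n. a.Q (x n) < \<mu> + 1 / real (Suc n)"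
    by metis
  have xM: "a.Q (x n) \<le> \<mu> + 1" for n
  proof -
    have "1 / real (Suc n) \<le> 1" by simp
    thus ?thesis using x(3)[of n] by linarith
  qed
  have xV: "x n \<in> V" for n using x XV by blast
  obtain r :: "nat \<Rightarrow> nat" where r: "strict_mono r"
    and hC: "\<And>\<epsilon>. \<epsilon> > 0 \<Longrightarrow> \<exists>N. \<forall>m\<ge>N. \<forall>n\<ge>N. h.Q (x (r m) - x (r n)) < \<epsilon>"
    using compact[of x, OF xV xM] by blast
  define y where "y n = x (r n)" for n
  have y: "y n \<in> X" "y n \<in> V" "h.Q (y n) = 1" for n using x xV by (auto simp: y_def)
  have yA: "a.Q (y n) < \<mu> + 1 / real (Suc n)" for n
  proof -
    have "1 / real (Suc (r n)) \<le> 1 / real (Suc n)"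
      using seq_suble[OF r, of n] by (simp add: field_simps)
    thus ?thesis using x(3)[of "r n"] by (simp add: y_def)
  qed
  have aC: "a.Q (y m - y n) \<le> 2 / real (Suc m) + 2 / real (Suc n) + \<mu> * h.Q (y m - y n)" for m n
  proof -
    have "\<mu> * h.Q (y m + y n) \<le> a.Q (y m + y n)" using X y by (intro Ray subspace_add)
    moreover have "h.Q (y m + y n) = 4 - h.Q (y m - y n)"
      using h.parallelogram[of "y m" "y n"] y by simp
    moreover have "a.Q (y m + y n) + a.Q (y m - y n) = 2 * a.Q (y m) + 2 * a.Q (y n)"
      using a.parallelogram[of "y m" "y n"] y by simp
    ultimately show ?thesis using yA[of m] yA[of n] by (simp add: algebra_simps)
  qed
  have "\<exists>u\<in>V. (\<lambda>n. a.Q (y n - u)) \<longlonglongrightarrow> 0"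
  proof (rule complete)
    fix \<epsilon> :: real assume \<epsilon>: "\<epsilon> > 0"
    obtain N1 where N1: "\<And>m n. m \<ge> N1 \<Longrightarrow> n \<ge> N1 \<Longrightarrow> h.Q (y m - y n) < \<epsilon> / (2 * (\<mu> + 1))"
      using hC[of "\<epsilon> / (2 * (\<mu> + 1))"] \<epsilon> \<mu>0 by (auto simp: y_def)
    obtain N2 :: nat where N2: "8 / \<epsilon> < real N2" using reals_Archimedean2 by blast
    have "a.Q (y m - y n) < \<epsilon>" if mn: "m \<ge> max N1 N2" "n \<ge> max N1 N2" for m n
    proof -
      have small: "2 / real (Suc k) < \<epsilon> / 4" if "k \<ge> N2" for k
      proof -
        have "8 / \<epsilon> < real (Suc k)" using N2 that by linarith
        thus ?thesis using \<epsilon> by (simp add: field_simps)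
      qed
      have "\<mu> * h.Q (y m - y n) \<le> (\<mu> + 1) * h.Q (y m - y n)"
        using h.nonneg[of "y m - y n"] y by (simp add: mult_right_mono)
      also have "\<dots> < (\<mu> + 1) * (\<epsilon> / (2 * (\<mu> + 1)))"
        using N1[of m n] mn \<mu>0 by (intro mult_strict_left_mono) auto
      also have "\<dots> = \<epsilon> / 2" using \<mu>0 by (simp add: add_pos_nonneg field_simps)
      finally show ?thesis using aC[of m n] small[of m] small[of n] mn by simp
    qed
    thus "\<exists>N. \<forall>m\<ge>N. \<forall>n\<ge>N. a.Q (y m - y n) < \<epsilon>" by blast
  qed (use y in auto)
  then obtain u where u: "u \<in> V" "(\<lambda>n. a.Q (y n - u)) \<longlonglongrightarrow> 0" by blast
  have hlim: "(\<lambda>n. h.Q (y n - u)) \<longlonglongrightarrow> 0"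
  proof (rule Lim_null_comparison)
    show "\<forall>\<^sub>F n in sequentially. norm (h.Q (y n - u)) \<le> C * a.Q (y n - u)"
      using coercive h.nonneg y u by (intro always_eventually) auto
    show "(\<lambda>n. C * a.Q (y n - u)) \<longlonglongrightarrow> 0" using tendsto_mult_left[OF u(2), of C] by simp
  qed
  have "u \<in> X" using closed[of y u] y u hlim by blast
  moreover have hu: "h.Q u = 1"
    using h.tendsto_Q[of y, OF y(2) u(1) hlim] LIMSEQ_unique tendsto_const y(3) by auto
  moreover have "a.Q u \<le> \<mu>"
  proof (rule LIMSEQ_le)
    show "(\<lambda>n. a.Q (y n)) \<longlonglongrightarrow> a.Q u" by (rule a.tendsto_Q[of y, OF y(2) u])
    show "(\<lambda>n. \<mu> + 1 / real (Suc n)) \<longlonglongrightarrow> \<mu>"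
      using LIMSEQ_inverse_real_of_nat_add[of \<mu>] by (simp add: inverse_eq_divide)
  qed (use yA less_imp_le in blast)
  hence "a.Q u * h.Q v \<le> a.Q v" if "v \<in> X" for v
    using Ray[OF that] mult_right_mono[of "a.Q u" \<mu> "h.Q v"] h.nonneg[OF XV[OF that]] by linarith
  ultimately show ?thesis using that by blast
qed

text \<open>
  The \<open>k\<close>-th vector minimises the Rayleigh quotient among all vectors orthogonal to the ones before it;
  this complement is closed and, as \<open>V\<close> has infinite dimension, not \<open>0\<close>.
\<close>

lemma orthonormal_Rayleigh_minimizers:
  "\<exists>e :: nat \<Rightarrow> 'v. (\<forall>k. e k \<in> V) \<and> (\<forall>i j. h (e i) (e j) = (if i = j then 1 else 0)) \<and>
    (\<forall>k. \<forall>v\<in>V. (\<forall>i<k. h v (e i) = 0) \<longrightarrow> a.Q (e k) * h.Q v \<le> a.Q v)"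
proof -
  define P where "P f k u \<longleftrightarrow> u \<in> V \<and> h.Q u = 1 \<and> (\<forall>i<k. h u (f i) = 0) \<and>
    (\<forall>v\<in>V. (\<forall>i<k. h v (f i) = 0) \<longrightarrow> a.Q u * h.Q v \<le> a.Q v)" for f :: "nat \<Rightarrow> 'v" and k u
  have "\<exists>e. \<forall>k. P e k (e k)"
  proof (rule dependent_wf_choice[where R = less_than])
    fix f g :: "nat \<Rightarrow> 'v" and k u assume "\<And>i. (i, k) \<in> less_than \<Longrightarrow> f i = g i"
    thus "P f k u = P g k u" by (simp add: P_def)
  next
    fix k and f :: "nat \<Rightarrow> 'v" assume IH: "\<And>i. (i, k) \<in> less_than \<Longrightarrow> P f i (f i)"
    have f: "f i \<in> V" "h.Q (f i) = 1" if "i < k" for i using IH[of i] that by (auto simp: P_def)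
    have orth: "h (f i) (f j) = (if i = j then 1 else 0)" if ij: "i < k" "j < k" for i j
    proof (cases i j rule: linorder_cases)
      case less
      hence "h (f j) (f i) = 0" using IH[of j] ij by (auto simp: P_def)
      thus ?thesis using less h.herm[OF f(1)[OF ij(2)] f(1)[OF ij(1)]] by simp
    next
      case equal
      thus ?thesis using h.self_real[OF f(1)[OF ij(1)]] f(2)[OF ij(1)] by simp
    next
      case greater
      thus ?thesis using IH[of i] ij by (auto simp: P_def)
    qed
    define X where "X = {v \<in> V. \<forall>i<k. h v (f i) = 0}"
    have X: "subspace X" "X \<subseteq> V"
      unfolding X_def subspace_def using f by (auto simp: h.add_left h.scale_left)
    have closed: "u \<in> X"
      if x: "\<And>n. x n \<in> X" and u: "u \<in> V" and lim: "(\<lambda>n. h.Q (x n - u)) \<longlonglongrightarrow> 0" for x u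
    proof -
      have "h u (f i) = 0" if i: "i < k" for i
      proof -
        have "(\<lambda>n. h (x n) (f i)) \<longlonglongrightarrow> h u (f i)"
          using x by (intro h.tendsto_left u lim f(1)[OF i]) (auto simp: X_def)
        moreover have "h (x n) (f i) = 0" for n using x i by (auto simp: X_def)
        ultimately show ?thesis by (simp add: LIMSEQ_const_iff)
      qed
      with u show ?thesis by (simp add: X_def)
    qed
    obtain w where w: "w \<in> V" "w \<notin> span (f ` {..<k})" using infinite_dim[of "f ` {..<k}"] by auto
    \<comment> \<open>A vector outside of the span of the earlier ones, minus its projection, is a nonzero member of \<open>X\<close>.\<close>
    define p where "p = (\<Sum>i<k. h w (f i) \<odot> f i)"
    have pV: "p \<in> V" unfolding p_def using f(1) by (intro h.sum_in_V) auto
    have "h p (f j) = h w (f j)" if j: "j < k" for j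
    proof -
      have "h p (f j) = (\<Sum>i<k. h (h w (f i) \<odot> f i) (f j))"
        unfolding p_def using f(1) j by (intro h.sum_left) auto
      also have "\<dots> = (\<Sum>i<k. if i = j then h w (f j) else 0)"
        using f(1) j by (intro sum.cong) (auto simp: h.scale_left orth)
      also have "\<dots> = h w (f j)" using j by simp
      finally show ?thesis .
    qed
    hence wp: "w - p \<in> X" using w pV f(1) by (auto simp: X_def h.diff_left)
    have "p \<in> span (f ` {..<k})"
      unfolding p_def by (intro span_sum span_scale span_base) auto
    hence ne: "w - p \<noteq> 0" using w(2) by auto
    obtain u where u: "u \<in> X" "h.Q u = 1" "\<And>v. v \<in> X \<Longrightarrow> a.Q u * h.Q v \<le> a.Q v"
    proof (rule Rayleigh_minimizer[OF X _ wp ne])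
      show "u \<in> X" if "\<And>n. x n \<in> X" "u \<in> V" "(\<lambda>n. h.Q (x n - u)) \<longlonglongrightarrow> 0" for x u
        using that by (rule closed)
    qed (rule that)
    hence "P f k u" by (auto simp: P_def X_def)
    thus "\<exists>u. P f k u" ..
  qed simp
  then obtain e where e: "\<And>k. P e k (e k)" by blast
  have V: "e k \<in> V" for k using e[of k] by (simp add: P_def)
  have orth: "h (e i) (e j) = (if i = j then 1 else 0)" for i j
  proof (cases i j rule: linorder_cases)
    case less
    hence "h (e j) (e i) = 0" using e[of j] by (simp add: P_def)
    thus ?thesis using less h.herm[OF V V, of j i] by simp
  next
    case equal
    thus ?thesis using h.self_real[OF V, of i] e[of i] by (simp add: P_def)
  next
    case greater
    thus ?thesis using e[of i] by (simp add: P_def)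
  qed
  show ?thesis using V orth e by (intro exI[of _ e]) (auto simp: P_def)
qed

end

locale Rayleigh_basis = discrete_forms scale V a h C
  for scale :: "complex \<Rightarrow> 'v::ab_group_add \<Rightarrow> 'v" (infixr \<open>\<odot>\<close> 75) and V a h C +
  fixes e :: "nat \<Rightarrow> 'v"
  assumes e_in_V: "e k \<in> V"
    and orthonormal: "h (e i) (e j) = (if i = j then 1 else 0)"
    and minimal: "v \<in> V \<Longrightarrow> (\<And>i. i < k \<Longrightarrow> h v (e i) = 0) \<Longrightarrow> Re (a (e k) (e k)) * Re (h v v) \<le> Re (a v v)"

lemma (in discrete_forms) Rayleigh_basis_exists:
  obtains e :: "nat \<Rightarrow> 'v" where "Rayleigh_basis scale V a h C e"
proof -
  from orthonormal_Rayleigh_minimizers obtain e :: "nat \<Rightarrow> 'v" where "(\<forall>k. e k \<in> V) \<and>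
    (\<forall>i j. h (e i) (e j) = (if i = j then 1 else 0)) \<and>
    (\<forall>k. \<forall>v\<in>V. (\<forall>i<k. h v (e i) = 0) \<longrightarrow> a.Q (e k) * h.Q v \<le> a.Q v)" ..
  hence "Rayleigh_basis scale V a h C e" by unfold_locales auto
  thus ?thesis by (rule that)
qed

context Rayleigh_basis
begin

definition lam :: "nat \<Rightarrow> real" where "lam k = Re (a (e k) (e k))"

lemma incseq_lam: "incseq lam"
proof (rule incseq_SucI)
  fix k
  have "lam k * h.Q (e (Suc k)) \<le> lam (Suc k)"
    unfolding lam_def by (rule minimal) (simp_all add: e_in_V orthonormal)
  thus "lam k \<le> lam (Suc k)" by (simp add: orthonormal)
qed

definition proj :: "nat set \<Rightarrow> 'v \<Rightarrow> 'v" where "proj I v = (\<Sum>i\<in>I. h v (e i) \<odot> e i)"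

lemma proj_in_V: "proj I v \<in> V"
  unfolding proj_def by (intro h.sum_in_V) (simp add: e_in_V)

lemma h_proj:
  assumes "finite I"
  shows "h (proj I v) (e j) = (if j \<in> I then h v (e j) else 0)"
proof -
  have "h (proj I v) (e j) = (\<Sum>i\<in>I. h (h v (e i) \<odot> e i) (e j))"
    unfolding proj_def by (intro h.sum_left) (auto simp: e_in_V)
  also have "\<dots> = (\<Sum>i\<in>I. if i = j then h v (e j) else 0)"
    by (intro sum.cong) (auto simp: h.scale_left orthonormal e_in_V)
  also have "\<dots> = (if j \<in> I then h v (e j) else 0)" using assms by simp
  finally show ?thesis .
qed

text \<open>
  On the orthogonal complement of the earlier vectors the form \<open>a - lam k h\<close> is nonnegative and vanishes
  at \<open>e k\<close>; by the Cauchy--Schwarz inequality, \<open>e k\<close> then lies in its radical. The earlier vectors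
  themselves are eigenvectors by induction, hence orthogonal to \<open>e k\<close> for both forms.
\<close>

lemma eigenvector: "v \<in> V \<Longrightarrow> a (e k) v = complex_of_real (lam k) * h (e k) v"
proof (induction k arbitrary: v rule: less_induct)
  case (less k)
  define X where "X = {v \<in> V. \<forall>i<k. h v (e i) = 0}"
  define q where "q u v = a u v - complex_of_real (lam k) * h u v" for u v
  interpret q: hermitian_form scale X q
  proof
    show "subspace X"
      unfolding X_def subspace_def by (auto simp: h.add_left h.scale_left e_in_V)
    show "0 \<le> Re (q u u)" if "u \<in> X" for u
      using that minimal[of u k] by (auto simp: q_def X_def lam_def)
    show "q w u = cnj (q u w)" if "u \<in> X" "w \<in> X" for u w
      using that a.herm[of u w] h.herm[of u w] by (simp add: q_def X_def)
  qed (auto simp: X_def q_def a.add_left h.add_left a.scale_left h.scale_left algebra_simps)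
  have ek: "e k \<in> X" by (auto simp: X_def e_in_V orthonormal)
  have X0: "a (e k) w = complex_of_real (lam k) * h (e k) w" if "w \<in> X" for w
  proof -
    have "Re (q (e k) (e k)) = 0" by (simp add: q_def lam_def orthonormal)
    hence "(cmod (q (e k) w))\<^sup>2 \<le> 0" using q.Cauchy_Schwarz[OF ek that] by simp
    thus ?thesis by (simp add: q_def)
  qed
  let ?p = "proj {..<k} v"
  have "v - ?p \<in> X" using less.prems
    by (auto simp: X_def proj_in_V h.diff_left e_in_V h_proj)
  hence 1: "a (e k) (v - ?p) = complex_of_real (lam k) * h (e k) (v - ?p)" by (rule X0)
  have "a (e k) (e i) = 0" if "i < k" for i
    using less.IH[OF that e_in_V[of k]] that a.herm[OF e_in_V e_in_V, of i k] by (simp add: orthonormal)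
  hence "a (e k) ?p = 0"
    unfolding proj_def by (simp add: a.sum_right a.scale_right e_in_V)
  moreover have "h (e k) ?p = 0"
    using h_proj[of "{..<k}" v k] h.herm[of "proj {..<k} v" "e k"] proj_in_V e_in_V by simp
  ultimately show ?case
    using 1 less.prems by (simp add: a.diff_right h.diff_right proj_in_V e_in_V)
qed

text \<open>
  Infinitely many orthonormal vectors of bounded energy would contradict compactness, as they have
  mutual squared distance \<open>2\<close>.
\<close>

lemma finite_lam_le: "finite {k. lam k \<le> M}"
proof (rule ccontr)
  assume inf: "infinite {k. lam k \<le> M}"
  have M: "a.Q (e n) \<le> M" for n
  proof -
    obtain m where "m \<ge> n" "lam m \<le> M" using inf by (auto simp: infinite_nat_iff_unbounded_le)
    thus ?thesis using incseqD[OF incseq_lam, of n m] by (simp add: lam_def)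
  qed
  obtain r :: "nat \<Rightarrow> nat" where r: "strict_mono r"
    and C: "\<And>\<epsilon>. \<epsilon> > 0 \<Longrightarrow> \<exists>N. \<forall>m\<ge>N. \<forall>n\<ge>N. h.Q (e (r m) - e (r n)) < \<epsilon>"
    using compact[of e M, OF e_in_V M] by blast
  obtain N where "h.Q (e (r (Suc N)) - e (r N)) < 1" using C[of 1] by (metis le_Suc_eq order.refl zero_less_one)
  moreover have "r (Suc N) \<noteq> r N" using r by (simp add: strict_mono_eq)
  ultimately show False by (simp add: h.Q_diff e_in_V orthonormal)
qed

text \<open>
  The part of an eigenvector that is orthogonal to all \<open>e k\<close> with eigenvalue \<open>\<mu>\<close> is orthogonal to every
  \<open>e k\<close>. By minimality its Rayleigh quotient is at least \<open>lam k\<close> for all \<open>k\<close>, which is impossible for a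
  nonzero vector because the \<open>lam k\<close> are unbounded.
\<close>

lemma eigenspace_eq_span:
  "{u \<in> V. \<forall>v\<in>V. a u v = complex_of_real \<mu> * h u v} = span (e ` {k. lam k = \<mu>})"
proof -
  let ?K = "{k. lam k = \<mu>}"
  let ?E = "{u \<in> V. \<forall>v\<in>V. a u v = complex_of_real \<mu> * h u v}"
  have fin: "finite ?K" by (rule finite_subset[OF _ finite_lam_le[of \<mu>]]) auto
  have E: "subspace ?E"
    unfolding subspace_def by (auto simp: a.add_left h.add_left a.scale_left h.scale_left algebra_simps)
  have "span (e ` ?K) \<subseteq> ?E"
    by (rule span_minimal[OF _ E]) (auto simp: e_in_V eigenvector)
  moreover have "u \<in> span (e ` ?K)" if u: "u \<in> ?E" for u
  proof -
    have uV: "u \<in> V" and ue: "\<And>v. v \<in> V \<Longrightarrow> a u v = complex_of_real \<mu> * h u v" using u by auto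
    define w where "w = u - proj ?K u"
    have wV: "w \<in> V" using uV proj_in_V by (simp add: w_def)
    have we: "h w (e k) = 0" for k
    proof (cases "lam k = \<mu>")
      case True
      thus ?thesis using uV fin by (simp add: w_def h.diff_left proj_in_V e_in_V h_proj)
    next
      case False
      have "complex_of_real \<mu> * h u (e k) = complex_of_real (lam k) * h u (e k)"
        using ue[OF e_in_V[of k]] eigenvector[OF uV, of k] a.herm[OF e_in_V uV, of k] h.herm[OF e_in_V uV, of k] by auto
      hence "h u (e k) = 0" using False by simp
      thus ?thesis using uV fin False by (simp add: w_def h.diff_left proj_in_V e_in_V h_proj)
    qed
    have "w = 0"
    proof (rule ccontr)
      assume "w \<noteq> 0"
      hence pos: "0 < h.Q w" using wV by (rule h_pos[rotated])
      have "lam k \<le> a.Q w / h.Q w" for k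
        using minimal[of w k] wV we pos by (simp add: lam_def field_simps)
      hence "{k. lam k \<le> a.Q w / h.Q w} = UNIV" by blast
      thus False using finite_lam_le[of "a.Q w / h.Q w"] by simp
    qed
    hence "u = proj ?K u" by (simp add: w_def)
    also have "\<dots> \<in> span (e ` ?K)" unfolding proj_def by (intro span_sum span_scale span_base) auto
    finally show ?thesis .
  qed
  ultimately show ?thesis by blast
qed

lemma inj_e: "inj e"
proof (rule injI)
  fix i j assume "e i = e j"
  thus "i = j" using orthonormal[of i i] orthonormal[of i j] by (metis zero_neq_one)
qed

lemma independent_e: "finite I \<Longrightarrow> independent (e ` I)"
  by (rule h.orthogonal_independent(2)) (simp_all add: e_in_V orthonormal)

text \<open>
  A subspace of dimension \<open>k + 1\<close> contains a nonzero vector that is orthogonal to the first \<open>k\<close>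
  minimisers and thus competes for \<open>lam k\<close>.
\<close>

lemma lam_le_if_subspace:
  assumes w: "\<And>i. i \<le> k \<Longrightarrow> w i \<in> V"
    and nontrivial: "\<And>c. (\<exists>i\<le>k. c i \<noteq> 0) \<Longrightarrow> (\<Sum>i\<le>k. c i \<odot> w i) \<noteq> 0"
    and bound: "\<And>c. a.Q (\<Sum>i\<le>k. c i \<odot> w i) \<le> L * h.Q (\<Sum>i\<le>k. c i \<odot> w i)"
  shows "lam k \<le> L"
proof -
  obtain c where c: "\<exists>i\<le>k. c i \<noteq> 0" "\<And>j. j < k \<Longrightarrow> (\<Sum>i\<le>k. c i * h (w i) (e j)) = 0"
    using homogeneous_system_nontrivial_solution[of "{..k}" k "\<lambda>j i. h (w i) (e j)"] by auto
  let ?v = "\<Sum>i\<le>k. c i \<odot> w i"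
  have v: "?v \<in> V" using w by (intro h.sum_in_V) auto
  have "h ?v (e j) = 0" if "j < k" for j
  proof -
    have "h ?v (e j) = (\<Sum>i\<le>k. h (c i \<odot> w i) (e j))"
      using w e_in_V by (intro h.sum_left) auto
    also have "\<dots> = (\<Sum>i\<le>k. c i * h (w i) (e j))" using w e_in_V by (simp add: h.scale_left)
    finally show ?thesis using c(2)[OF that] by simp
  qed
  hence "lam k * h.Q ?v \<le> a.Q ?v" unfolding lam_def using minimal[OF v] by blast
  also have "\<dots> \<le> L * h.Q ?v" by (rule bound)
  finally show ?thesis using h_pos[OF v nontrivial[OF c(1)]] by simp
qed

text \<open>
  On the span of the first \<open>k + 1\<close> minimisers the energy is at most \<open>lam k\<close> times the mass, and this
  span meets the joint kernel of \<open>k\<close> functionals.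
\<close>

lemma lam_ge_if_functionals:
  fixes \<phi> :: "nat \<Rightarrow> 'v \<Rightarrow> complex"
  assumes linear: "\<And>j c. j < k \<Longrightarrow> \<phi> j (\<Sum>i\<le>k. c i \<odot> e i) = (\<Sum>i\<le>k. c i * \<phi> j (e i))"
    and bound: "\<And>v. v \<in> V \<Longrightarrow> (\<And>j. j < k \<Longrightarrow> \<phi> j v = 0) \<Longrightarrow> L * h.Q v \<le> a.Q v"
  shows "L \<le> lam k"
proof -
  obtain c where c: "\<exists>i\<le>k. c i \<noteq> 0" "\<And>j. j < k \<Longrightarrow> (\<Sum>i\<le>k. c i * \<phi> j (e i)) = 0"
    using homogeneous_system_nontrivial_solution[of "{..k}" k "\<lambda>j i. \<phi> j (e i)"] by auto
  let ?v = "\<Sum>i\<le>k. c i \<odot> e i"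
  have v: "?v \<in> V" using e_in_V by (intro h.sum_in_V) auto
  have hv: "h.Q ?v = (\<Sum>i\<le>k. (cmod (c i))\<^sup>2)"
    by (subst h.Q_orthogonal_sum) (simp_all add: e_in_V orthonormal)
  have "a.Q ?v = (\<Sum>i\<le>k. (cmod (c i))\<^sup>2 * a.Q (e i))"
    by (rule a.Q_orthogonal_sum) (simp_all add: e_in_V eigenvector orthonormal)
  hence "a.Q ?v = (\<Sum>i\<le>k. lam i * (cmod (c i))\<^sup>2)" by (simp add: lam_def mult.commute)
  also have "\<dots> \<le> (\<Sum>i\<le>k. lam k * (cmod (c i))\<^sup>2)"
    using incseqD[OF incseq_lam] by (intro sum_mono mult_right_mono) auto
  also have "\<dots> = lam k * h.Q ?v" by (simp add: hv sum_distrib_left)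
  finally have "L * h.Q ?v \<le> lam k * h.Q ?v"
    using bound[OF v] c(2) linear by force
  moreover have "0 < h.Q ?v"
  proof -
    obtain i where i: "i \<le> k" "c i \<noteq> 0" using c(1) by blast
    hence "0 < (cmod (c i))\<^sup>2" by simp
    also have "\<dots> \<le> (\<Sum>i\<le>k. (cmod (c i))\<^sup>2)" using i by (intro member_le_sum) auto
    finally show ?thesis by (simp add: hv)
  qed
  ultimately show ?thesis by simp
qed

end

section \<open>Weak derivatives on an interval\<close>

abbreviation Leb :: "real \<Rightarrow> real measure" where "Leb l \<equiv> lebesgue_on {0..l}"

abbreviation sq_int :: "real \<Rightarrow> (real \<Rightarrow> complex) \<Rightarrow> real" where
  "sq_int l f \<equiv> (LINT x|Leb l. (cmod (f x))\<^sup>2)"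

lemma finite_measure_Leb: "finite_measure (Leb l)"
  by (intro finite_measure_lebesgue_on) (metis cbox_interval lmeasurable_cbox)

lemma measurable_Leb_cont: "continuous_on {0..l} f \<Longrightarrow> f \<in> borel_measurable (Leb l)"
  by (rule continuous_imp_measurable_on_sets_lebesgue) auto

lemma indicator_Leb_measurable [measurable]:
  "A \<in> sets borel \<Longrightarrow> (indicator A :: real \<Rightarrow> real) \<in> borel_measurable (Leb l)"
  by (intro measurable_restrict_space1 borel_measurable_indicator) auto

lemma integrable_Leb_bounded:
  fixes f :: "real \<Rightarrow> 'a::{banach,second_countable_topology}"
  assumes "f \<in> borel_measurable (Leb l)" "\<And>x. x \<in> {0..l} \<Longrightarrow> norm (f x) \<le> K"
  shows "integrable (Leb l) f"
proof -
  interpret finite_measure "Leb l" by (rule finite_measure_Leb)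
  show ?thesis using assms by (intro integrable_const_bound[where B = K] AE_I2) auto
qed

lemma integrable_Leb_cont:
  fixes f :: "real \<Rightarrow> 'a::{banach,second_countable_topology}"
  assumes "continuous_on {0..l} f"
  shows "integrable (Leb l) f"
proof -
  have "compact (f ` {0..l})" using assms by (intro compact_continuous_image) auto
  then obtain K where "\<And>x. x \<in> {0..l} \<Longrightarrow> norm (f x) \<le> K"
    using compact_imp_bounded bounded_iff by (metis image_eqI)
  thus ?thesis using measurable_Leb_cont[OF assms] by (intro integrable_Leb_bounded)
qed

lemma integral_Leb_Ioc:
  assumes "0 \<le> a" "a \<le> b" "b \<le> l"
  shows "(LINT x|Leb l. indicator {a<..b} x) = b - a"
proof -
  have "{a<..b} \<inter> {0..l} = {a<..b}" using assms by auto
  hence "(LINT x|Leb l. indicator {a<..b} x) = measure (Leb l) {a<..b}" by simp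
  also have "\<dots> = measure lebesgue {a<..b}" using assms by (intro measure_restrict_space) auto
  finally show ?thesis using assms by simp
qed

lemma integral_Leb_const: "0 \<le> l \<Longrightarrow> (LINT x|Leb l. c) = c * (l::real)"
  by (simp add: measure_restrict_space lebesgue_integral_const)

lemma L2_on_cont:
  assumes "continuous_on {0..l} f"
  shows "L2_on l f"
  unfolding L2_on_def
  by (intro conjI measurable_Leb_cont integrable_Leb_cont continuous_intros assms)

lemma L2_on_measurable: "L2_on l f \<Longrightarrow> f \<in> borel_measurable (Leb l)"
  by (simp add: L2_on_def)

lemma L2_on_integrable_sq: "L2_on l f \<Longrightarrow> integrable (Leb l) (\<lambda>x. (cmod (f x))\<^sup>2)"
  by (simp add: L2_on_def)

lemma borel_measurable_cnj [measurable]: "cnj \<in> borel_measurable borel"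
  by (intro borel_measurable_continuous_onI continuous_intros)

lemma L2_on_integrable_mult:
  assumes "L2_on l f" "L2_on l g"
  shows "integrable (Leb l) (\<lambda>x. f x * cnj (g x))"
proof (rule Bochner_Integration.integrable_bound)
  show "integrable (Leb l) (\<lambda>x. (cmod (f x))\<^sup>2 + (cmod (g x))\<^sup>2)"
    using assms by (intro Bochner_Integration.integrable_add L2_on_integrable_sq)
  have "norm (f x * cnj (g x)) \<le> norm ((cmod (f x))\<^sup>2 + (cmod (g x))\<^sup>2)" for x
  proof -
    have "0 \<le> cmod (f x) * cmod (g x)" by simp
    thus ?thesis using sum_squares_bound[of "cmod (f x)" "cmod (g x)"]
      by (simp only: norm_mult complex_mod_cnj real_norm_def)
  qed
  thus "AE x in Leb l. norm (f x * cnj (g x)) \<le> norm ((cmod (f x))\<^sup>2 + (cmod (g x))\<^sup>2)" by simp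
qed (use assms[THEN L2_on_measurable] in measurable)

lemma L2_on_integrable: "L2_on l f \<Longrightarrow> integrable (Leb l) f"
  using L2_on_integrable_mult[of l f "\<lambda>_. 1"] L2_on_cont[of l "\<lambda>_. 1"] by simp

lemma L2_on_add:
  assumes "L2_on l f" "L2_on l g"
  shows "L2_on l (\<lambda>x. f x + g x)"
  unfolding L2_on_def
proof
  show meas: "(\<lambda>x. f x + g x) \<in> borel_measurable (Leb l)" using assms[THEN L2_on_measurable] by measurable
  show "integrable (Leb l) (\<lambda>x. (cmod (f x + g x))\<^sup>2)"
  proof (rule Bochner_Integration.integrable_bound)
    show "integrable (Leb l) (\<lambda>x. 2 * (cmod (f x))\<^sup>2 + 2 * (cmod (g x))\<^sup>2)"
      using assms by (intro Bochner_Integration.integrable_add integrable_mult_right L2_on_integrable_sq)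
    have "(cmod (f x + g x))\<^sup>2 \<le> 2 * (cmod (f x))\<^sup>2 + 2 * (cmod (g x))\<^sup>2" for x
    proof -
      have "(cmod (f x + g x))\<^sup>2 \<le> (cmod (f x) + cmod (g x))\<^sup>2" by (intro power_mono norm_triangle_ineq) simp
      also have "\<dots> \<le> 2 * (cmod (f x))\<^sup>2 + 2 * (cmod (g x))\<^sup>2"
        using sum_squares_bound[of "cmod (f x)" "cmod (g x)"] by (simp add: power2_sum)
      finally show ?thesis .
    qed
    thus "AE x in Leb l. norm ((cmod (f x + g x))\<^sup>2) \<le> norm (2 * (cmod (f x))\<^sup>2 + 2 * (cmod (g x))\<^sup>2)"
      by simp
  qed (use meas in measurable)
qed

lemma L2_on_scale: "L2_on l f \<Longrightarrow> L2_on l (\<lambda>x. c * f x)"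
  unfolding L2_on_def by (auto simp: norm_mult power_mult_distrib)

lemma L2_on_diff: "L2_on l f \<Longrightarrow> L2_on l g \<Longrightarrow> L2_on l (\<lambda>x. f x - g x)"
  using L2_on_add[of l f "\<lambda>x. - 1 * g x"] L2_on_scale[of l g "-1"] by simp

text \<open>
  The Cauchy--Schwarz inequality, read off from the nonnegativity of the variance: \<open>m\<close> is the mean of
  \<open>h\<close> on the interval.
\<close>

lemma integral_square_le:
  fixes h :: "real \<Rightarrow> real"
  assumes ab: "0 \<le> a" "a \<le> b" "b \<le> l" and meas: "h \<in> borel_measurable (Leb l)"
    and sq: "integrable (Leb l) (\<lambda>x. (h x)\<^sup>2)"
  shows "(LINT x|Leb l. indicator {a<..b} x * h x)\<^sup>2 \<le> (b - a) * (LINT x|Leb l. indicator {a<..b} x * (h x)\<^sup>2)"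
proof -
  define A where "A = (LINT x|Leb l. indicator {a<..b} x * h x)"
  define S where "S = (LINT x|Leb l. indicator {a<..b} x * (h x)\<^sup>2)"
  have int1: "integrable (Leb l) (\<lambda>x. indicator {a<..b} x :: real)"
    by (rule integrable_Leb_bounded[where K = 1]) (auto split: split_indicator)
  have intS: "integrable (Leb l) (\<lambda>x. indicator {a<..b} x * (h x)\<^sup>2)"
    using sq by (rule Bochner_Integration.integrable_bound)
      (use meas in measurable, auto split: split_indicator)
  have intA: "integrable (Leb l) (\<lambda>x. indicator {a<..b} x * h x)"
  proof (rule Bochner_Integration.integrable_bound)
    show "integrable (Leb l) (\<lambda>x. 1 + (h x)\<^sup>2)" using sq by simp
    have "\<bar>h x\<bar> \<le> 1 + (h x)\<^sup>2" for x
      using sum_squares_bound[of 1 "\<bar>h x\<bar>"] by simp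
    thus "AE x in Leb l. norm (indicator {a<..b} x * h x) \<le> norm (1 + (h x)\<^sup>2)"
      by (intro AE_I2) (auto simp: indicator_def)
  qed (use meas in measurable)
  have key: "0 \<le> S - 2 * m * A + m\<^sup>2 * (b - a)" for m
  proof -
    have "0 \<le> (LINT x|Leb l. indicator {a<..b} x * (h x - m)\<^sup>2)" by simp
    also have "(\<lambda>x. indicator {a<..b} x * (h x - m)\<^sup>2) = (\<lambda>x. indicator {a<..b} x * (h x)\<^sup>2
        - 2 * m * (indicator {a<..b} x * h x) + m\<^sup>2 * indicator {a<..b} x)"
      by (auto simp: fun_eq_iff power2_diff algebra_simps)
    also have "(LINT x|Leb l. \<dots> x) = S - 2 * m * A + m\<^sup>2 * (b - a)"
      using int1 intS intA integral_Leb_Ioc[OF ab] by (simp add: S_def A_def)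
    finally show ?thesis .
  qed
  show ?thesis
  proof (cases "a = b")
    case False
    hence "2 * (A / (b - a)) * A = 2 * (A\<^sup>2 / (b - a))" "(A / (b - a))\<^sup>2 * (b - a) = A\<^sup>2 / (b - a)"
      by (simp_all add: power2_eq_square)
    hence "0 \<le> S - A\<^sup>2 / (b - a)" using key[of "A / (b - a)"] by linarith
    thus ?thesis using False ab by (simp add: A_def S_def field_simps)
  qed simp
qed

lemma test_function_bounded:
  assumes "test_function l \<phi> \<phi>'"
  obtains K where "K \<ge> 0" "\<And>x. x \<in> {0..l} \<Longrightarrow> \<bar>\<phi> x\<bar> \<le> K" "\<And>x. x \<in> {0..l} \<Longrightarrow> \<bar>\<phi>' x\<bar> \<le> K"
    "continuous_on {0..l} \<phi>" "continuous_on {0..l} \<phi>'"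
proof -
  have c: "continuous_on {0..l} \<phi>" "continuous_on {0..l} \<phi>'"
    using assms continuous_on_subset[of UNIV \<phi>' "{0..l}"]
    by (auto simp: test_function_def intro!: continuous_at_imp_continuous_on DERIV_isCont)
  have b: "\<exists>K. \<forall>x\<in>{0..l}. \<bar>f x\<bar> \<le> K" if "continuous_on {0..l} f" for f :: "real \<Rightarrow> real"
    using compact_imp_bounded[OF compact_continuous_image[OF that compact_Icc]] by (auto simp: bounded_iff)
  obtain K1 K2 where "\<forall>x\<in>{0..l}. \<bar>\<phi> x\<bar> \<le> K1" "\<forall>x\<in>{0..l}. \<bar>\<phi>' x\<bar> \<le> K2" using b c by metis
  thus ?thesis using c by (intro that[of "max 0 (max K1 K2)"]) (auto simp: le_max_iff_disj)
qed

lemma integrable_bounded_mult: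
  fixes f :: "real \<Rightarrow> complex"
  assumes "integrable (Leb l) f" "continuous_on {0..l} \<phi>" "\<And>x. x \<in> {0..l} \<Longrightarrow> \<bar>\<phi> x\<bar> \<le> K"
  shows "integrable (Leb l) (\<lambda>x. complex_of_real (\<phi> x) * f x)"
proof (rule Bochner_Integration.integrable_bound)
  show "integrable (Leb l) (\<lambda>x. K * norm (f x))" using assms(1) by simp
  have "\<phi> \<in> borel_measurable (Leb l)" by (rule measurable_Leb_cont) fact
  thus "(\<lambda>x. complex_of_real (\<phi> x) * f x) \<in> borel_measurable (Leb l)"
    using borel_measurable_integrable[OF assms(1)] by measurable
  show "AE x in Leb l. norm (complex_of_real (\<phi> x) * f x) \<le> norm (K * norm (f x))"
  proof (intro AE_I2)
    fix x assume "x \<in> space (Leb l)"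
    hence "\<bar>\<phi> x\<bar> * norm (f x) \<le> K * norm (f x)" using assms(3) by (intro mult_right_mono) auto
    thus "norm (complex_of_real (\<phi> x) * f x) \<le> norm (K * norm (f x))" by (simp add: norm_mult)
  qed
qed

lemma integrable_test_mult:
  assumes "test_function l \<phi> \<phi>'" "integrable (Leb l) f"
  shows "integrable (Leb l) (\<lambda>x. complex_of_real (\<phi> x) * f x)"
    "integrable (Leb l) (\<lambda>x. complex_of_real (\<phi>' x) * f x)"
  using test_function_bounded[OF assms(1)] integrable_bounded_mult[OF assms(2)] by metis+

lemma is_weak_deriv_add:
  assumes "is_weak_deriv l f f'" "is_weak_deriv l g g'" "integrable (Leb l) f" "integrable (Leb l) f'"
    "integrable (Leb l) g" "integrable (Leb l) g'"
  shows "is_weak_deriv l (\<lambda>x. f x + g x) (\<lambda>x. f' x + g' x)"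
  using assms(1,2) integrable_test_mult[OF _ assms(3)] integrable_test_mult[OF _ assms(4)]
    integrable_test_mult[OF _ assms(5)] integrable_test_mult[OF _ assms(6)]
  by (simp add: is_weak_deriv_def distrib_left)

lemma is_weak_deriv_scale:
  assumes "is_weak_deriv l f f'"
  shows "is_weak_deriv l (\<lambda>x. c * f x) (\<lambda>x. c * f' x)"
proof -
  have "(LINT x|Leb l. complex_of_real (r x) * (c * g x)) = c * (LINT x|Leb l. complex_of_real (r x) * g x)"
    for r g by (subst integral_mult_right_zero[symmetric]) (simp add: mult.left_commute)
  thus ?thesis using assms by (simp add: is_weak_deriv_def)
qed

text \<open>
  A quadratic spline that climbs from \<open>0\<close> at \<open>0\<close> to \<open>1\<close> at \<open>1\<close>. Its derivative is the hat function of
  integral \<open>1\<close> on the unit interval; a piecewise linear ramp would not be continuously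
  differentiable and hence would not give test functions.
\<close>

definition ramp :: "real \<Rightarrow> real" where
  "ramp t = 2 * ((max 0 t)\<^sup>2 - 2 * (max 0 (t - 1/2))\<^sup>2 + (max 0 (t - 1))\<^sup>2)"

definition ramp' :: "real \<Rightarrow> real" where
  "ramp' t = 4 * (max 0 t - 2 * max 0 (t - 1/2) + max 0 (t - 1))"

lemma DERIV_pos_part_sq: "((\<lambda>t. (max 0 t)\<^sup>2) has_real_derivative 2 * max 0 (t::real)) (at t)"
proof (cases t "0 :: real" rule: linorder_cases)
  case less
  have "((\<lambda>t. 0) has_real_derivative 2 * max 0 t) (at t)" using less by (auto intro!: derivative_eq_intros)
  thus ?thesis
    by (rule has_field_derivative_transform_within_open[where S = "{..<0}"]) (use less in auto)
next
  case equal
  have "((\<lambda>h. (max 0 h)\<^sup>2 / h) \<longlongrightarrow> 0) (at (0::real))"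
  proof (rule Lim_null_comparison)
    show "\<forall>\<^sub>F h in at 0. norm ((max 0 h)\<^sup>2 / h) \<le> \<bar>h\<bar>"
      by (intro always_eventually) (auto simp: max_def power2_eq_square)
    show "((\<lambda>h. \<bar>h\<bar>) \<longlongrightarrow> 0) (at (0::real))" by (rule tendsto_eq_intros | simp)+
  qed
  thus ?thesis unfolding DERIV_def using equal by simp
next
  case greater
  have "((\<lambda>t. t\<^sup>2) has_real_derivative 2 * max 0 t) (at t)" using greater by (auto intro!: derivative_eq_intros)
  thus ?thesis
    by (rule has_field_derivative_transform_within_open[where S = "{0<..}"]) (use greater in auto)
qed

lemma DERIV_ramp: "(ramp has_real_derivative ramp' t) (at t)"
proof -
  have sh: "((\<lambda>t. (max 0 (t - c))\<^sup>2) has_real_derivative 2 * max 0 (t - c)) (at t)" for c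
  proof -
    have "((\<lambda>t. t - c) has_real_derivative 1) (at t)" by (auto intro!: derivative_eq_intros)
    from DERIV_chain2[where f = "\<lambda>t. (max 0 t)\<^sup>2" and g = "\<lambda>t. t - c" and x = t and s = UNIV,
      OF DERIV_pos_part_sq this] show ?thesis by simp
  qed
  show ?thesis unfolding ramp_def[abs_def] ramp'_def
    by (rule derivative_eq_intros sh DERIV_pos_part_sq HOL.refl | simp)+
qed

lemma ramp_eq: "t \<le> 0 \<Longrightarrow> ramp t = 0" "1 \<le> t \<Longrightarrow> ramp t = 1" "t \<le> 0 \<or> 1 \<le> t \<Longrightarrow> ramp' t = 0"
  by (auto simp: ramp_def ramp'_def max_def power2_eq_square field_simps)

lemma ramp'_nonneg: "0 \<le> ramp' t"
  by (auto simp: ramp'_def max_def)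

lemma ramp_mono: "s \<le> t \<Longrightarrow> ramp s \<le> ramp t"
  by (rule DERIV_nonneg_imp_nondecreasing, assumption) (use DERIV_ramp ramp'_nonneg in blast)

lemma ramp_bounds: "0 \<le> ramp t" "ramp t \<le> 1"
  using ramp_mono[of "min 0 t" t] ramp_mono[of t "max 1 t"] ramp_eq by auto

lemma continuous_ramp': "continuous_on A (\<lambda>t. ramp' (f t))" if "continuous_on A f"
  unfolding ramp'_def by (intro continuous_intros that)

definition ramp_at :: "real \<Rightarrow> real \<Rightarrow> real \<Rightarrow> real" where
  "ramp_at x \<epsilon> t = ramp ((t - x) / \<epsilon>)"

definition ramp_at' :: "real \<Rightarrow> real \<Rightarrow> real \<Rightarrow> real" where
  "ramp_at' x \<epsilon> t = ramp' ((t - x) / \<epsilon>) / \<epsilon>"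

lemma DERIV_ramp_at:
  assumes "\<epsilon> > 0"
  shows "(ramp_at x \<epsilon> has_real_derivative ramp_at' x \<epsilon> t) (at t)"
proof -
  have "((\<lambda>t. (t - x) / \<epsilon>) has_real_derivative 1 / \<epsilon>) (at t)"
    using assms by (auto intro!: derivative_eq_intros)
  from DERIV_chain2[where f = ramp and g = "\<lambda>t. (t - x) / \<epsilon>" and x = t and s = UNIV, OF DERIV_ramp this]
  show ?thesis by (simp add: ramp_at_def[abs_def] ramp_at'_def)
qed

lemma continuous_ramp_at': "continuous_on A (ramp_at' x \<epsilon>)"
proof (cases "\<epsilon> = 0")
  case True
  thus ?thesis by (simp add: ramp_at'_def[abs_def])
next
  case False
  thus ?thesis unfolding ramp_at'_def[abs_def] by (intro continuous_intros continuous_ramp') auto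
qed

text \<open>
  As \<open>\<epsilon>\<close> tends to \<open>0\<close>, these test functions approximate the indicator function of \<open>{x<..y}\<close>.
\<close>

lemma test_function_ramps:
  assumes "0 < x" "x \<le> y" "\<epsilon> > 0" "y + \<epsilon> < l"
  shows "test_function l (\<lambda>t. ramp_at x \<epsilon> t - ramp_at y \<epsilon> t) (\<lambda>t. ramp_at' x \<epsilon> t - ramp_at' y \<epsilon> t)"
  unfolding test_function_def
proof (intro conjI allI)
  show "((\<lambda>t. ramp_at x \<epsilon> t - ramp_at y \<epsilon> t) has_real_derivative ramp_at' x \<epsilon> t - ramp_at' y \<epsilon> t) (at t)" for t
    using assms by (intro derivative_intros DERIV_ramp_at)
  show "continuous_on UNIV (\<lambda>t. ramp_at' x \<epsilon> t - ramp_at' y \<epsilon> t)"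
    by (intro continuous_intros continuous_ramp_at')
  have "ramp_at x \<epsilon> t - ramp_at y \<epsilon> t = 0" if t: "t \<notin> {x..y + \<epsilon>}" for t
  proof (cases "t < x")
    case True
    thus ?thesis using assms by (simp add: ramp_at_def ramp_eq divide_nonpos_pos)
  next
    case False
    thus ?thesis using t assms by (simp add: ramp_at_def ramp_eq)
  qed
  thus "\<exists>a b. 0 < a \<and> b < l \<and> (\<forall>t. t \<notin> {a..b} \<longrightarrow> ramp_at x \<epsilon> t - ramp_at y \<epsilon> t = 0)"
    using assms by blast
qed

lemma ramp_at_tendsto:
  "(\<lambda>n. ramp_at x (inverse (real (Suc n))) t) \<longlonglongrightarrow> indicator {x<..} t"
proof (cases "t \<le> x")
  case True
  hence "(t - x) / inverse (real (Suc n)) \<le> 0" for n by (intro divide_nonpos_pos) auto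
  hence "ramp_at x (inverse (real (Suc n))) t = 0" for n by (simp only: ramp_at_def ramp_eq(1))
  thus ?thesis using True by simp
next
  case False
  then obtain N :: nat where N: "1 / (t - x) < real N" using reals_Archimedean2 by blast
  have "ramp_at x (inverse (real (Suc n))) t = 1" if "n \<ge> N" for n
  proof -
    have "1 / (t - x) < real (Suc n)" using N that by simp
    hence "1 \<le> (t - x) * real (Suc n)" using False by (simp add: field_simps)
    thus ?thesis by (simp add: ramp_at_def ramp_eq divide_inverse)
  qed
  hence "\<forall>\<^sub>F n in sequentially. ramp_at x (inverse (real (Suc n))) t = 1"
    by (auto simp: eventually_sequentially)
  thus ?thesis using False by (simp add: tendsto_eventually)
qed

lemma integral_ramp_at':
  assumes "0 < \<epsilon>" "0 \<le> x" "x + \<epsilon> \<le> l"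
  shows "(LINT t|Leb l. ramp_at' x \<epsilon> t) = 1"
proof -
  have "(LINT t|Leb l. ramp_at' x \<epsilon> t) = integral {0..l} (ramp_at' x \<epsilon>)"
    by (intro lebesgue_integral_eq_integral integrable_Leb_cont continuous_ramp_at') auto
  also have "(ramp_at' x \<epsilon> has_integral (ramp_at x \<epsilon> l - ramp_at x \<epsilon> 0)) {0..l}"
    using assms by (intro fundamental_theorem_of_calculus)
      (auto intro!: has_field_derivative_at_within DERIV_ramp_at simp: has_real_derivative_iff_has_vector_derivative[symmetric])
  hence "integral {0..l} (ramp_at' x \<epsilon>) = ramp_at x \<epsilon> l - ramp_at x \<epsilon> 0" by (rule integral_unique)
  also have "\<dots> = 1" using assms by (simp add: ramp_at_def ramp_eq)
  finally show ?thesis .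
qed

text \<open>
  The derivatives of the ramps are nonnegative with integral \<open>1\<close> and live on \<open>{x..x + \<epsilon>}\<close>, so they
  are an approximate identity at \<open>x\<close>.
\<close>

lemma ramp_at'_concentrates:
  fixes f :: "real \<Rightarrow> complex"
  assumes cont: "continuous_on {0..l} f" and x: "0 \<le> x" "x < l"
  shows "(\<lambda>n. LINT t|Leb l. complex_of_real (ramp_at' x (inverse (real (Suc n))) t) * f t) \<longlonglongrightarrow> f x"
proof (rule LIMSEQ_I)
  fix r :: real assume r: "0 < r"
  obtain d where d: "d > 0" "\<And>t. t \<in> {0..l} \<Longrightarrow> dist t x < d \<Longrightarrow> dist (f t) (f x) < r / 2"
    using cont x r unfolding continuous_on_iff by (metis atLeastAtMost_iff half_gt_zero less_imp_le)
  obtain N :: nat where N: "1 / min d (l - x) < real N" using reals_Archimedean2 by blast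
  have "norm ((LINT t|Leb l. complex_of_real (ramp_at' x (inverse (real (Suc n))) t) * f t) - f x) < r" if "n \<ge> N" for n
  proof -
    define \<epsilon> where "\<epsilon> = inverse (real (Suc n))"
    have m: "0 < min d (l - x)" using d x by simp
    have "1 / min d (l - x) < real (Suc n)" using N that by simp
    hence "\<epsilon> < min d (l - x)"
      using m less_imp_inverse_less[of "1 / min d (l - x)" "real (Suc n)"] by (simp only: \<epsilon>_def) simp
    hence \<epsilon>: "0 < \<epsilon>" "\<epsilon> < d" "x + \<epsilon> < l" by (auto simp: \<epsilon>_def)
    have int1: "integrable (Leb l) (\<lambda>t. complex_of_real (ramp_at' x \<epsilon> t) * g t)" if "continuous_on {0..l} g" for g
      by (intro integrable_Leb_cont continuous_intros continuous_ramp_at' that)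
    have "(LINT t|Leb l. complex_of_real (ramp_at' x \<epsilon> t) * f x) = f x"
      using integral_ramp_at'[OF \<epsilon>(1) x(1), of l] \<epsilon> by simp
    hence "(LINT t|Leb l. complex_of_real (ramp_at' x \<epsilon> t) * f t) - f x =
      (LINT t|Leb l. complex_of_real (ramp_at' x \<epsilon> t) * f t) - (LINT t|Leb l. complex_of_real (ramp_at' x \<epsilon> t) * f x)"
      by simp
    also have "\<dots> = (LINT t|Leb l. complex_of_real (ramp_at' x \<epsilon> t) * f t - complex_of_real (ramp_at' x \<epsilon> t) * f x)"
      by (intro Bochner_Integration.integral_diff[symmetric] int1 cont continuous_intros)
    also have "norm \<dots> \<le> (LINT t|Leb l. ramp_at' x \<epsilon> t * (r / 2))"
    proof (rule Bochner_Integration.integral_norm_bound_integral)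
      show "integrable (Leb l) (\<lambda>t. complex_of_real (ramp_at' x \<epsilon> t) * f t - complex_of_real (ramp_at' x \<epsilon> t) * f x)"
        by (intro Bochner_Integration.integrable_diff int1 cont continuous_intros)
      show "integrable (Leb l) (\<lambda>t. ramp_at' x \<epsilon> t * (r / 2))"
        by (intro integrable_Leb_cont continuous_intros continuous_ramp_at')
      fix t assume t: "t \<in> space (Leb l)"
      have eq: "norm (complex_of_real (ramp_at' x \<epsilon> t) * f t - complex_of_real (ramp_at' x \<epsilon> t) * f x) =
          ramp_at' x \<epsilon> t * norm (f t - f x)"
      proof -
        have "0 \<le> ramp_at' x \<epsilon> t" using ramp'_nonneg \<epsilon>(1) by (simp add: ramp_at'_def)
        thus ?thesis by (simp only: right_diff_distrib[symmetric] norm_mult norm_of_real abs_of_nonneg)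
      qed
      show "norm (complex_of_real (ramp_at' x \<epsilon> t) * f t - complex_of_real (ramp_at' x \<epsilon> t) * f x) \<le> ramp_at' x \<epsilon> t * (r / 2)"
      proof (cases "t \<in> {x..x + \<epsilon>}")
        case True
        hence "dist t x < d" using \<epsilon> by (auto simp: dist_real_def)
        hence "norm (f t - f x) \<le> r / 2" using d(2)[of t] t by (simp add: dist_norm)
        moreover have "0 \<le> ramp_at' x \<epsilon> t" using ramp'_nonneg \<epsilon>(1) by (simp add: ramp_at'_def)
        ultimately show ?thesis unfolding eq by (intro mult_left_mono)
      next
        case False
        hence "(t - x) / \<epsilon> \<le> 0 \<or> 1 \<le> (t - x) / \<epsilon>" using \<epsilon>(1) by (auto simp: field_simps)
        hence "ramp_at' x \<epsilon> t = 0" by (simp add: ramp_at'_def ramp_eq)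
        thus ?thesis by simp
      qed
    qed
    also have "\<dots> = r / 2" using integral_ramp_at'[OF \<epsilon>(1) x(1), of l] \<epsilon> by simp
    also have "\<dots> < r" using r by simp
    finally show ?thesis by (simp add: \<epsilon>_def)
  qed
  thus "\<exists>N. \<forall>n\<ge>N. norm ((LINT t|Leb l. complex_of_real (ramp_at' x (inverse (real (Suc n))) t) * f t) - f x) < r"
    by blast
qed

lemma ramps_tendsto_integral:
  fixes g :: "real \<Rightarrow> complex"
  assumes g: "integrable (Leb l) g" and xy: "x \<le> y"
  shows "(\<lambda>n. LINT t|Leb l. complex_of_real (ramp_at x (inverse (real (Suc n))) t - ramp_at y (inverse (real (Suc n))) t) * g t)
    \<longlonglongrightarrow> (LINT t|Leb l. indicator {x<..y} t *\<^sub>R g t)"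
proof (rule integral_dominated_convergence)
  have meas: "g \<in> borel_measurable (Leb l)" using g by simp
  show "(\<lambda>t. indicator {x<..y} t *\<^sub>R g t) \<in> borel_measurable (Leb l)" using meas by measurable
  show "(\<lambda>t. complex_of_real (ramp_at x (inverse (real (Suc n))) t - ramp_at y (inverse (real (Suc n))) t) * g t)
      \<in> borel_measurable (Leb l)" for n
  proof -
    have "continuous_on {0..l} (ramp_at z (inverse (real (Suc n))))" for z
      by (intro continuous_at_imp_continuous_on ballI DERIV_isCont[OF DERIV_ramp_at]) simp
    hence "ramp_at z (inverse (real (Suc n))) \<in> borel_measurable (Leb l)" for z by (rule measurable_Leb_cont)
    thus ?thesis using meas by measurable
  qed
  show "integrable (Leb l) (\<lambda>t. norm (g t))" using g by simp
  show "AE t in Leb l. (\<lambda>n. complex_of_real (ramp_at x (inverse (real (Suc n))) t - ramp_at y (inverse (real (Suc n))) t) * g t)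
      \<longlonglongrightarrow> indicator {x<..y} t *\<^sub>R g t"
  proof (intro AE_I2)
    fix t
    have "indicator {x<..y} t *\<^sub>R g t = complex_of_real (indicator {x<..} t - indicator {y<..} t) * g t"
      using xy by (auto split: split_indicator)
    thus "(\<lambda>n. complex_of_real (ramp_at x (inverse (real (Suc n))) t - ramp_at y (inverse (real (Suc n))) t) * g t)
      \<longlonglongrightarrow> indicator {x<..y} t *\<^sub>R g t"
      by (simp only:) (intro tendsto_intros ramp_at_tendsto)
  qed
  show "AE t in Leb l. norm (complex_of_real (ramp_at x (inverse (real (Suc n))) t - ramp_at y (inverse (real (Suc n))) t) * g t) \<le> norm (g t)" for n
  proof (intro AE_I2)
    fix t
    have "\<bar>ramp_at x (inverse (real (Suc n))) t - ramp_at y (inverse (real (Suc n))) t\<bar> \<le> 1"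
      unfolding ramp_at_def using ramp_bounds[of "(t - x) / inverse (real (Suc n))"] ramp_bounds[of "(t - y) / inverse (real (Suc n))"]
      by linarith
    hence "\<bar>ramp_at x (inverse (real (Suc n))) t - ramp_at y (inverse (real (Suc n))) t\<bar> * norm (g t) \<le> 1 * norm (g t)"
      by (intro mult_right_mono) auto
    thus "norm (complex_of_real (ramp_at x (inverse (real (Suc n))) t - ramp_at y (inverse (real (Suc n))) t) * g t) \<le> norm (g t)"
      by (simp only: norm_mult norm_of_real mult_1)
  qed
qed

text \<open>
  The definition of the weak derivative is tested with differences of two ramps: the integral against
  \<open>f\<close> tends to \<open>f x - f y\<close>, and the integral against \<open>g\<close> to that of \<open>g\<close> over \<open>{x<..y}\<close>. The points are
  interior, since test functions vanish near the ends of the interval.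
\<close>

lemma weak_deriv_increment:
  assumes cont: "continuous_on {0..l} f" and g: "integrable (Leb l) g" and wd: "is_weak_deriv l f g"
    and xy: "0 < x" "x \<le> y" "y < l"
  shows "f y - f x = (LINT t|Leb l. indicator {x<..y} t *\<^sub>R g t)"
proof -
  let ?e = "\<lambda>n. inverse (real (Suc n))"
  obtain N :: nat where N: "1 / (l - y) < real N" using reals_Archimedean2 by blast
  have small: "y + ?e n < l" if "n \<ge> N" for n
  proof -
    have "1 / (l - y) < real (Suc n)" using N that by simp
    thus ?thesis using xy by (simp add: field_simps)
  qed
  have eq: "(LINT t|Leb l. complex_of_real (ramp_at' x (?e n) t) * f t) - (LINT t|Leb l. complex_of_real (ramp_at' y (?e n) t) * f t)
      = - (LINT t|Leb l. complex_of_real (ramp_at x (?e n) t - ramp_at y (?e n) t) * g t)" if "n \<ge> N" for n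
  proof -
    have int: "integrable (Leb l) (\<lambda>t. complex_of_real (ramp_at' z (?e n) t) * f t)" for z
      by (intro integrable_Leb_cont continuous_intros continuous_ramp_at' cont)
    have "(LINT t|Leb l. complex_of_real (ramp_at' x (?e n) t - ramp_at' y (?e n) t) * f t)
        = - (LINT t|Leb l. complex_of_real (ramp_at x (?e n) t - ramp_at y (?e n) t) * g t)"
      using wd[unfolded is_weak_deriv_def, rule_format, OF test_function_ramps[OF xy(1,2) _ small[OF that]]]
      by simp
    thus ?thesis using Bochner_Integration.integral_diff[OF int[of x] int[of y]]
      by (simp add: left_diff_distrib)
  qed
  have "(\<lambda>n. (LINT t|Leb l. complex_of_real (ramp_at' x (?e n) t) * f t) - (LINT t|Leb l. complex_of_real (ramp_at' y (?e n) t) * f t))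
      \<longlonglongrightarrow> f x - f y"
    using xy by (intro tendsto_diff ramp_at'_concentrates cont) auto
  hence "(\<lambda>n. - (LINT t|Leb l. complex_of_real (ramp_at x (?e n) t - ramp_at y (?e n) t) * g t)) \<longlonglongrightarrow> f x - f y"
    by (rule Lim_transform_eventually) (use eq in \<open>auto simp: eventually_sequentially\<close>)
  moreover have "(\<lambda>n. - (LINT t|Leb l. complex_of_real (ramp_at x (?e n) t - ramp_at y (?e n) t) * g t))
      \<longlonglongrightarrow> - (LINT t|Leb l. indicator {x<..y} t *\<^sub>R g t)"
    using g xy(2) by (intro tendsto_minus ramps_tendsto_integral)
  ultimately have "f x - f y = - (LINT t|Leb l. indicator {x<..y} t *\<^sub>R g t)" by (rule LIMSEQ_unique)
  thus ?thesis by (simp add: algebra_simps)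
qed

lemma AE_Leb_neq: "AE t in Leb l. t \<noteq> c"
proof -
  have "AE t in lebesgue. t \<noteq> c" using AE_lborel_singleton by (rule AE_completion)
  thus ?thesis by (subst AE_restrict_space_iff) auto
qed

lemma integrable_indicator_scaleR:
  fixes g :: "real \<Rightarrow> 'a::{banach,second_countable_topology}"
  assumes "integrable (Leb l) g" "A \<in> sets borel"
  shows "integrable (Leb l) (\<lambda>t. indicator A t *\<^sub>R g t)"
proof (rule Bochner_Integration.integrable_bound[OF assms(1)])
  show "(\<lambda>t. indicator A t *\<^sub>R g t) \<in> borel_measurable (Leb l)"
    using assms(2) borel_measurable_integrable[OF assms(1)] by measurable
qed (auto split: split_indicator)

text \<open>
  Lebesgue's differentiation theorem: almost everywhere, \<open>d\<close> is the limit of its means over intervals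
  to the right of the point.
\<close>

lemma AE_zero_if_interval_integrals_zero:
  fixes d :: "real \<Rightarrow> complex"
  assumes d: "integrable (Leb l) d"
    and zero: "\<And>x y. 0 < x \<Longrightarrow> x \<le> y \<Longrightarrow> y < l \<Longrightarrow> (LINT t|Leb l. indicator {x<..y} t *\<^sub>R d t) = 0"
  shows "AE t in Leb l. d t = 0"
proof -
  define d0 where "d0 t = (if t \<in> {0..l} then d t else 0)" for t
  have "d integrable_on {0..l}" using d by (intro integrable_on_lebesgue_on) auto
  hence "d0 integrable_on UNIV" unfolding d0_def by (simp only: integrable_restrict_UNIV)
  hence "d0 integrable_on cbox a b" for a b by (rule integrable_on_subcbox) simp
  then obtain N where N: "negligible N" "\<And>x e. x \<notin> N \<Longrightarrow> 0 < e \<Longrightarrow> \<exists>\<delta>>0. \<forall>h. 0 < h \<and> h < \<delta> \<longrightarrow>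
      norm (integral (cbox x (x + h *\<^sub>R One)) d0 /\<^sub>R h ^ DIM(real) - d0 x) < e"
    by (rule integrable_ccontinuous_explicit) blast
  have zero': "integral {x..y} d0 = 0" if xy: "0 < x" "x \<le> y" "y < l" for x y
  proof -
    have "(LINT t|Leb l. indicator {x<..y} t *\<^sub>R d t) = integral {0..l} (\<lambda>t. indicator {x<..y} t *\<^sub>R d t)"
      by (intro lebesgue_integral_eq_integral integrable_indicator_scaleR d) auto
    also have "\<dots> = integral {0..l} (\<lambda>t. if t \<in> {x..y} then d0 t else 0)"
      by (rule integral_spike[of "{x}"]) (auto simp: d0_def split: split_indicator)
    also have "\<dots> = integral ({x..y} \<inter> {0..l}) d0" by (rule integral_restrict_Int)
    also have "{x..y} \<inter> {0..l} = {x..y}" using xy by auto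
    finally show ?thesis using zero[OF xy] by simp
  qed
  have d_zero: "d x = 0" if x: "x \<notin> N" "0 < x" "x < l" for x
  proof (rule ccontr)
    assume nz: "d x \<noteq> 0"
    obtain \<delta> where \<delta>: "\<delta> > 0" "\<And>h. 0 < h \<Longrightarrow> h < \<delta> \<Longrightarrow>
        norm (integral (cbox x (x + h *\<^sub>R One)) d0 /\<^sub>R h ^ DIM(real) - d0 x) < norm (d x)"
      using N(2)[OF x(1), of "norm (d x)"] nz by auto
    define h where "h = min (\<delta> / 2) ((l - x) / 2)"
    have "0 < h" "h < \<delta>" "x + h < l" using \<delta>(1) x by (auto simp: h_def min_def field_simps)
    thus False using \<delta>(2)[of h] zero'[of x "x + h"] x by (simp add: d0_def)
  qed
  have "AE t in Leb l. t \<notin> N"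
    using AE_not_in[of N lebesgue] N(1) by (subst AE_restrict_space_iff) (auto simp: negligible_iff_null_sets)
  thus ?thesis
    using AE_Leb_neq[where l = l and c = 0] AE_Leb_neq[where l = l and c = l] AE_space[of "Leb l"]
    by eventually_elim (use d_zero in auto)
qed

lemma weak_deriv_unique:
  assumes l: "0 < l" and cont: "continuous_on {0..l} f" and g: "L2_on l g" "L2_on l g'"
    and wd: "is_weak_deriv l f g" "is_weak_deriv l f g'"
  shows "AE t in Leb l. g t = g' t"
proof -
  note int = g[THEN L2_on_integrable]
  have "AE t in Leb l. g t - g' t = 0"
  proof (rule AE_zero_if_interval_integrals_zero)
    fix x y assume xy: "0 < x" "x \<le> y" "y < l"
    show "(LINT t|Leb l. indicator {x<..y} t *\<^sub>R (g t - g' t)) = 0"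
      using weak_deriv_increment[OF cont int(1) wd(1) xy] weak_deriv_increment[OF cont int(2) wd(2) xy]
        integrable_indicator_scaleR[OF int(1), of "{x<..y}"] integrable_indicator_scaleR[OF int(2), of "{x<..y}"]
      by (simp add: scaleR_diff_right)
  qed (use int in simp)
  thus ?thesis by eventually_elim simp
qed

lemma L2_on_integrable_indicator_sq:
  assumes "L2_on l g"
  shows "integrable (Leb l) (\<lambda>t. indicator {a<..b} t * (cmod (g t))\<^sup>2)"
  using integrable_indicator_scaleR[OF L2_on_integrable_sq[OF assms], of "{a<..b}"] by simp

text \<open>
  The estimate first holds for points of the open interval; it extends to its ends by continuity, when
  both points are moved a little towards the midpoint \<open>m\<close>.
\<close>

lemma weak_deriv_increment_sq_le:
  assumes cont: "continuous_on {0..l} f" and g: "L2_on l g" and wd: "is_weak_deriv l f g"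
    and ab: "0 \<le> a" "b \<le> l" and x: "x \<in> {a..b}" and y: "y \<in> {a..b}"
  shows "(cmod (f y - f x))\<^sup>2 \<le> (b - a) * (LINT t|Leb l. indicator {a<..b} t * (cmod (g t))\<^sup>2)"
proof (cases "a = b")
  case True
  thus ?thesis using x y by simp
next
  case False
  hence lt: "a < b" using x by auto
  let ?E = "LINT t|Leb l. indicator {a<..b} t * (cmod (g t))\<^sup>2"
  have gm: "(\<lambda>t. cmod (g t)) \<in> borel_measurable (Leb l)" using L2_on_measurable[OF g] by measurable
  have interior_le: "(cmod (f y - f x))\<^sup>2 \<le> (b - a) * ?E"
    if xy: "a < x" "x \<le> y" "y < b" for x y
  proof -
    have "cmod (f y - f x) = cmod (LINT t|Leb l. indicator {x<..y} t *\<^sub>R g t)"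
      using xy ab by (subst weak_deriv_increment[OF cont L2_on_integrable[OF g] wd]) auto
    also have "\<dots> \<le> (LINT t|Leb l. norm (indicator {x<..y} t *\<^sub>R g t))" by (rule integral_norm_bound)
    also have "\<dots> = (LINT t|Leb l. indicator {x<..y} t * cmod (g t))"
      by (rule Bochner_Integration.integral_cong) auto
    finally have "(cmod (f y - f x))\<^sup>2 \<le> (LINT t|Leb l. indicator {x<..y} t * cmod (g t))\<^sup>2"
      by (intro power_mono) auto
    also have "\<dots> \<le> (y - x) * (LINT t|Leb l. indicator {x<..y} t * (cmod (g t))\<^sup>2)"
      using xy ab L2_on_integrable_sq[OF g] by (intro integral_square_le gm) auto
    also have "\<dots> \<le> (b - a) * ?E"
    proof (rule mult_mono)
      show "(LINT t|Leb l. indicator {x<..y} t * (cmod (g t))\<^sup>2) \<le> ?E"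
        by (intro integral_mono L2_on_integrable_indicator_sq g) (use xy in \<open>auto split: split_indicator\<close>)
    qed (use xy in auto)
    finally show ?thesis .
  qed
  have interior: "(cmod (f y - f x))\<^sup>2 \<le> (b - a) * ?E" if "x \<in> {a<..<b}" "y \<in> {a<..<b}" for x y
    using interior_le[of x y] interior_le[of y x] that by (cases "x \<le> y") (auto simp: norm_minus_commute)
  define m where "m = (a + b) / 2"
  define s where "s z n = z + (m - z) * inverse (real (Suc n))" for z n
  have s_in: "s z n \<in> {a<..<b}" if z: "z \<in> {a..b}" for z n
  proof -
    define i where "i = inverse (real (Suc n))"
    have i: "0 < i" "i \<le> 1" by (simp_all add: i_def inverse_le_1_iff)
    have eq: "s z n = (1 - i) * z + i * m" by (simp add: s_def i_def algebra_simps)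
    have m: "a < m" "m < b" using lt by (simp_all add: m_def)
    have "(1 - i) * a + i * a < (1 - i) * z + i * m" "(1 - i) * z + i * m < (1 - i) * b + i * b"
      using i m z by (intro add_le_less_mono mult_left_mono mult_strict_left_mono; simp)+
    thus ?thesis by (simp add: eq algebra_simps)
  qed
  have s_lim: "(\<lambda>n. f (s z n)) \<longlonglongrightarrow> f z" if z: "z \<in> {a..b}" for z
  proof -
    have "(\<lambda>n. s z n) \<longlonglongrightarrow> z + (m - z) * 0"
      unfolding s_def by (intro tendsto_intros LIMSEQ_inverse_real_of_nat)
    moreover have "continuous_on {a..b} f" using cont by (rule continuous_on_subset) (use ab in auto)
    moreover have "s z n \<in> {a..b}" for n using s_in[OF z, of n] by auto
    ultimately show ?thesis using z unfolding continuous_on_sequentially comp_def by auto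
  qed
  show ?thesis
  proof (rule LIMSEQ_le_const2)
    show "(\<lambda>n. (cmod (f (s y n) - f (s x n)))\<^sup>2) \<longlonglongrightarrow> (cmod (f y - f x))\<^sup>2"
      by (intro tendsto_intros s_lim x y)
    show "\<exists>N. \<forall>n\<ge>N. (cmod (f (s y n) - f (s x n)))\<^sup>2 \<le> (b - a) * ?E"
      using interior s_in[OF x] s_in[OF y] by blast
  qed
qed

lemma cmod_sq_le: "(cmod u)\<^sup>2 \<le> 2 * (cmod v)\<^sup>2 + 2 * (cmod (u - v))\<^sup>2"
proof -
  have "cmod u \<le> cmod v + cmod (u - v)" using norm_triangle_ineq[of v "u - v"] by simp
  hence "(cmod u)\<^sup>2 \<le> (cmod v + cmod (u - v))\<^sup>2" by (intro power_mono) auto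
  also have "\<dots> \<le> 2 * (cmod v)\<^sup>2 + 2 * (cmod (u - v))\<^sup>2"
    using sum_squares_bound[of "cmod v" "cmod (u - v)"] by (simp add: power2_sum)
  finally show ?thesis .
qed

text \<open>
  The \<open>J\<close> pieces are treated separately: on a piece of length \<open>\<delta> = l / J\<close>, the function differs from
  its value at the left end by at most the root of \<open>\<delta>\<close> times the energy of that piece. Only because
  these local energies add up to the total energy does the factor \<open>\<delta>\<^sup>2\<close> appear, instead of \<open>l \<delta>\<close>.
\<close>

lemma grid_L2_bound:
  assumes l: "0 < l" and cont: "continuous_on {0..l} f" and g: "L2_on l g" and wd: "is_weak_deriv l f g"
    and J: "1 \<le> J" and B: "\<And>j. j < J \<Longrightarrow> (cmod (f (real j * (l / real J))))\<^sup>2 \<le> B"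
  shows "sq_int l f \<le> 2 * l * B + 2 * (l / real J)\<^sup>2 * sq_int l g"
proof -
  define \<delta> where "\<delta> = l / real J"
  define P where "P j = {real j * \<delta><..real (Suc j) * \<delta>}" for j
  define E where "E j = (LINT t|Leb l. indicator (P j) t * (cmod (g t))\<^sup>2)" for j
  have \<delta>: "0 < \<delta>" "real J * \<delta> = l" using l J by (simp_all add: \<delta>_def)
  have end_le: "real (Suc j) * \<delta> \<le> l" if "j < J" for j
    unfolding \<delta>(2)[symmetric] using that \<delta>(1) by (intro mult_right_mono) auto
  have len: "real (Suc j) * \<delta> - real j * \<delta> = \<delta>" for j by (simp add: algebra_simps)
  have pt: "(cmod (f t))\<^sup>2 \<le> 2 * B + 2 * (\<delta> * E j)" if j: "j < J" and t: "t \<in> P j" for j t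
  proof -
    have "(cmod (f t - f (real j * \<delta>)))\<^sup>2 \<le> (real (Suc j) * \<delta> - real j * \<delta>) * E j"
      unfolding E_def P_def using t \<delta>(1) end_le[OF j]
      by (intro weak_deriv_increment_sq_le[OF cont g wd]) (auto simp: P_def)
    thus ?thesis using cmod_sq_le[of "f t" "f (real j * \<delta>)"] B[OF j, folded \<delta>_def] unfolding len by linarith
  qed
  \<comment> \<open>The half-open pieces are disjoint but miss the point \<open>0\<close>, a null set.\<close>
  have cover: "\<exists>j<J. t \<in> P j" if t: "0 < t" "t \<le> l" for t
  proof -
    define i where "i = nat (\<lceil>t / \<delta>\<rceil> - 1)"
    have c: "real_of_int \<lceil>t / \<delta>\<rceil> = real (Suc i)"
      using t \<delta>(1) by (simp add: i_def)
    have "real i < t / \<delta>" "t / \<delta> \<le> real (Suc i)" using c ceiling_correct[of "t / \<delta>"] by auto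
    hence ti: "t \<in> P i" using \<delta>(1) by (simp add: P_def field_simps)
    hence "real i * \<delta> < real J * \<delta>" using t \<delta> by (auto simp: P_def)
    hence "i < J" using \<delta>(1) by simp
    with ti show ?thesis by blast
  qed
  have bnd: "(cmod (f t))\<^sup>2 \<le> (\<Sum>j<J. indicator (P j) t * (2 * B + 2 * (\<delta> * E j)))" if t: "0 < t" "t \<le> l" for t
  proof -
    obtain j where j: "j < J" "t \<in> P j" using cover[OF t] by blast
    have nn: "0 \<le> indicator (P i) t * (2 * B + 2 * (\<delta> * E i))" if "i < J" for i
    proof (cases "t \<in> P i")
      case True
      thus ?thesis using order.trans[OF zero_le_power2 pt[OF that True]] by simp
    qed simp
    have "(cmod (f t))\<^sup>2 \<le> indicator (P j) t * (2 * B + 2 * (\<delta> * E j))" using pt j by simp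
    also have "\<dots> \<le> (\<Sum>j<J. indicator (P j) t * (2 * B + 2 * (\<delta> * E j)))"
      using j nn by (intro member_le_sum) auto
    finally show ?thesis .
  qed
  have intP: "integrable (Leb l) (\<lambda>t. indicator (P j) t :: real)" for j
    unfolding P_def by (rule integrable_Leb_bounded[where K = 1]) (auto split: split_indicator)
  have "sq_int l f \<le> (LINT t|Leb l. (\<Sum>j<J. indicator (P j) t * (2 * B + 2 * (\<delta> * E j))))"
  proof (rule integral_mono_AE)
    show "integrable (Leb l) (\<lambda>t. (cmod (f t))\<^sup>2)" by (intro integrable_Leb_cont continuous_intros cont)
    show "integrable (Leb l) (\<lambda>t. \<Sum>j<J. indicator (P j) t * (2 * B + 2 * (\<delta> * E j)))"
      by (intro Bochner_Integration.integrable_sum integrable_mult_left intP)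
    show "AE t in Leb l. (cmod (f t))\<^sup>2 \<le> (\<Sum>j<J. indicator (P j) t * (2 * B + 2 * (\<delta> * E j)))"
      using AE_Leb_neq[where l = l and c = 0] AE_space[of "Leb l"] by eventually_elim (intro bnd, auto)
  qed
  also have "\<dots> = (\<Sum>j<J. (LINT t|Leb l. indicator (P j) t) * (2 * B + 2 * (\<delta> * E j)))"
    by (subst Bochner_Integration.integral_sum) (intro integrable_mult_left intP, simp only: integral_mult_left_zero)
  also have "\<dots> = (\<Sum>j<J. \<delta> * (2 * B + 2 * (\<delta> * E j)))"
  proof (rule sum.cong[OF HOL.refl])
    fix j assume "j \<in> {..<J}"
    hence "(LINT t|Leb l. indicator (P j) t) = real (Suc j) * \<delta> - real j * \<delta>"
      unfolding P_def using \<delta>(1) end_le[of j] by (intro integral_Leb_Ioc) auto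
    thus "(LINT t|Leb l. indicator (P j) t) * (2 * B + 2 * (\<delta> * E j)) = \<delta> * (2 * B + 2 * (\<delta> * E j))"
      by (simp only: len)
  qed
  also have "\<dots> = 2 * l * B + 2 * \<delta>\<^sup>2 * (\<Sum>j<J. E j)"
    unfolding \<delta>(2)[symmetric] by (simp add: sum.distrib sum_distrib_left algebra_simps power2_eq_square)
  also have "(\<Sum>j<J. E j) \<le> sq_int l g"
  proof -
    have "(\<Sum>j<J. E j) = (LINT t|Leb l. (\<Sum>j<J. indicator (P j) t * (cmod (g t))\<^sup>2))"
      unfolding E_def P_def
      by (intro Bochner_Integration.integral_sum[symmetric] L2_on_integrable_indicator_sq g)
    also have "\<dots> \<le> sq_int l g"
    proof (rule integral_mono)
      show "integrable (Leb l) (\<lambda>t. \<Sum>j<J. indicator (P j) t * (cmod (g t))\<^sup>2)"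
        unfolding P_def by (intro Bochner_Integration.integrable_sum L2_on_integrable_indicator_sq g)
      show "integrable (Leb l) (\<lambda>t. (cmod (g t))\<^sup>2)" by (rule L2_on_integrable_sq[OF g])
      fix t
      have disj: "P i \<inter> P j = {}" if "i < j" for i j
      proof -
        have "real (Suc i) * \<delta> \<le> real j * \<delta>" using that \<delta>(1) by (intro mult_right_mono) auto
        thus ?thesis by (auto simp: P_def)
      qed
      have "disjoint_family_on P {..<J}"
        unfolding disjoint_family_on_def using disj by (metis Int_commute linorder_neq_iff)
      hence "(\<Sum>j<J. indicator (P j) t :: real) = indicator (\<Union>j<J. P j) t"
        by (simp add: indicator_UN_disjoint)
      also have "\<dots> \<le> 1" by (simp split: split_indicator)
      finally have "(\<Sum>j<J. indicator (P j) t) * (cmod (g t))\<^sup>2 \<le> 1 * (cmod (g t))\<^sup>2"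
        by (intro mult_right_mono) auto
      thus "(\<Sum>j<J. indicator (P j) t * (cmod (g t))\<^sup>2) \<le> (cmod (g t))\<^sup>2" by (simp only: sum_distrib_right mult_1)
    qed
    finally show ?thesis .
  qed
  finally show ?thesis using \<delta>(1) by (simp add: \<delta>_def mult_left_mono)
qed

lemma L1_sq_le_L2:
  assumes l: "0 \<le> l" and h: "L2_on l h"
  shows "(LINT t|Leb l. cmod (h t))\<^sup>2 \<le> l * sq_int l h"
proof -
  have meas: "(\<lambda>t. cmod (h t)) \<in> borel_measurable (Leb l)" using L2_on_measurable[OF h] by measurable
  have cong: "(LINT t|Leb l. indicator {0<..l} t * k t) = (LINT t|Leb l. k t)"
    if "k \<in> borel_measurable (Leb l)" for k :: "real \<Rightarrow> real"
  proof (rule integral_cong_AE)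
    show "AE t in Leb l. indicator {0<..l} t * k t = k t"
      using AE_Leb_neq[where l = l and c = 0] AE_space[of "Leb l"] by eventually_elim auto
  qed (use that in measurable)
  show ?thesis
    using integral_square_le[OF order.refl l order.refl meas L2_on_integrable_sq[OF h]] cong[OF meas]
      cong[OF borel_measurable_integrable[OF L2_on_integrable_sq[OF h]]] by simp
qed

text \<open>
  On a bounded interval, a Cauchy sequence of \<open>L\<^sup>2\<close> is one of \<open>L\<^sup>1\<close> and thus has a subsequence that
  converges almost everywhere; Fatou's lemma shows that its limit is the limit in \<open>L\<^sup>2\<close>.
\<close>

lemma L2_complete:
  fixes g :: "nat \<Rightarrow> real \<Rightarrow> complex"
  assumes l: "0 \<le> l" and g: "\<And>n. L2_on l (g n)"
    and Cauchy: "\<And>\<epsilon>. \<epsilon> > 0 \<Longrightarrow> \<exists>N. \<forall>m\<ge>N. \<forall>n\<ge>N. sq_int l (\<lambda>t. g m t - g n t) < \<epsilon>"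
  obtains g0 where "L2_on l g0" "(\<lambda>n. sq_int l (\<lambda>t. g n t - g0 t)) \<longlonglongrightarrow> 0"
proof -
  obtain r :: "nat \<Rightarrow> nat" where r: "strict_mono r" and AEC: "AE t in Leb l. Cauchy (\<lambda>i. g (r i) t)"
  proof (rule cauchy_L1_AE_cauchy_subseq[of "Leb l" g])
    show "integrable (Leb l) (g n)" for n by (rule L2_on_integrable[OF g])
    fix e :: real assume e: "0 < e"
    obtain N where N: "\<And>m n. m \<ge> N \<Longrightarrow> n \<ge> N \<Longrightarrow> sq_int l (\<lambda>t. g m t - g n t) < e\<^sup>2 / (l + 1)"
      using Cauchy[of "e\<^sup>2 / (l + 1)"] e l by auto
    have "(LINT t|Leb l. norm (g i t - g j t)) < e" if ij: "i \<ge> N" "j \<ge> N" for i j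
    proof -
      have "(LINT t|Leb l. norm (g i t - g j t))\<^sup>2 \<le> l * sq_int l (\<lambda>t. g i t - g j t)"
        by (rule L1_sq_le_L2[OF l L2_on_diff[OF g g]])
      also have "\<dots> \<le> (l + 1) * sq_int l (\<lambda>t. g i t - g j t)" by (intro mult_right_mono) auto
      also have "\<dots> < (l + 1) * (e\<^sup>2 / (l + 1))" using N[OF ij] l by (intro mult_strict_left_mono) auto
      also have "\<dots> = e\<^sup>2" using l by simp
      finally show ?thesis using e by (meson less_imp_le power_less_imp_less_base)
    qed
    thus "\<exists>N. \<forall>i\<ge>N. \<forall>j\<ge>N. (LINT t|Leb l. norm (g i t - g j t)) < e" by blast
  qed (rule that)
  define g0 where "g0 t = lim (\<lambda>i. g (r i) t)" for t
  have meas: "g n \<in> borel_measurable (Leb l)" for n by (rule L2_on_measurable[OF g])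
  have meas0: "g0 \<in> borel_measurable (Leb l)"
    unfolding g0_def using meas by measurable
  have lim: "AE t in Leb l. (\<lambda>i. g (r i) t) \<longlonglongrightarrow> g0 t"
    using AEC by eventually_elim (simp add: g0_def Cauchy_convergent_iff convergent_LIMSEQ_iff)
  have Fatou: "integrable (Leb l) (\<lambda>t. (cmod (g n t - g0 t))\<^sup>2) \<and> sq_int l (\<lambda>t. g n t - g0 t) \<le> \<epsilon>"
    if bnd: "\<And>m. m \<ge> N \<Longrightarrow> sq_int l (\<lambda>t. g n t - g m t) \<le> \<epsilon>" for \<epsilon> N n
  proof -
    have \<epsilon>0: "0 \<le> \<epsilon>" using order.trans[OF integral_nonneg_AE bnd[of N]] by simp
    have "(\<integral>\<^sup>+t. ennreal ((cmod (g n t - g0 t))\<^sup>2) \<partial>Leb l)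
        = (\<integral>\<^sup>+t. liminf (\<lambda>i. ennreal ((cmod (g n t - g (r i) t))\<^sup>2)) \<partial>Leb l)"
    proof (rule nn_integral_cong_AE)
      show "AE t in Leb l. ennreal ((cmod (g n t - g0 t))\<^sup>2) = liminf (\<lambda>i. ennreal ((cmod (g n t - g (r i) t))\<^sup>2))"
        using lim
      proof eventually_elim
        case (elim t)
        hence "(\<lambda>i. ennreal ((cmod (g n t - g (r i) t))\<^sup>2)) \<longlonglongrightarrow> ennreal ((cmod (g n t - g0 t))\<^sup>2)"
          by (intro tendsto_intros tendsto_ennrealI)
        thus ?case by (intro lim_imp_Liminf[symmetric]) simp
      qed
    qed
    also have "\<dots> \<le> liminf (\<lambda>i. \<integral>\<^sup>+t. ennreal ((cmod (g n t - g (r i) t))\<^sup>2) \<partial>Leb l)"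
      using meas by (intro nn_integral_liminf) measurable
    also have "\<dots> \<le> liminf (\<lambda>i. ennreal \<epsilon>)"
    proof (rule Liminf_mono)
      have "(\<integral>\<^sup>+t. ennreal ((cmod (g n t - g (r i) t))\<^sup>2) \<partial>Leb l) \<le> ennreal \<epsilon>" if "i \<ge> N" for i
      proof -
        have "(\<integral>\<^sup>+t. ennreal ((cmod (g n t - g (r i) t))\<^sup>2) \<partial>Leb l)
            = ennreal (sq_int l (\<lambda>t. g n t - g (r i) t))"
          by (intro nn_integral_eq_integral L2_on_integrable_sq L2_on_diff g) auto
        also have "\<dots> \<le> ennreal \<epsilon>"
          using bnd[of "r i"] that seq_suble[OF r, of i] by (intro ennreal_leI) auto
        finally show ?thesis .
      qed
      thus "\<forall>\<^sub>F i in sequentially. (\<integral>\<^sup>+t. ennreal ((cmod (g n t - g (r i) t))\<^sup>2) \<partial>Leb l) \<le> ennreal \<epsilon>"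
        by (auto simp: eventually_sequentially)
    qed
    also have "\<dots> = ennreal \<epsilon>" by (simp add: Liminf_const)
    finally have nn: "(\<integral>\<^sup>+t. ennreal ((cmod (g n t - g0 t))\<^sup>2) \<partial>Leb l) \<le> ennreal \<epsilon>" .
    have m: "(\<lambda>t. (cmod (g n t - g0 t))\<^sup>2) \<in> borel_measurable (Leb l)" using meas meas0 by measurable
    have int: "integrable (Leb l) (\<lambda>t. (cmod (g n t - g0 t))\<^sup>2)"
    proof (rule integrableI_bounded[OF m])
      show "(\<integral>\<^sup>+t. ennreal (norm ((cmod (g n t - g0 t))\<^sup>2)) \<partial>Leb l) < \<infinity>"
        using nn by (simp add: le_less_trans)
    qed
    have "ennreal (sq_int l (\<lambda>t. g n t - g0 t)) \<le> ennreal \<epsilon>"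
      using nn nn_integral_eq_integral[OF int] by simp
    with int \<epsilon>0 show ?thesis by simp
  qed
  show ?thesis
  proof (rule that)
    obtain N where "\<And>m n. m \<ge> N \<Longrightarrow> n \<ge> N \<Longrightarrow> sq_int l (\<lambda>t. g m t - g n t) < 1"
      using Cauchy[of 1] by auto
    hence "integrable (Leb l) (\<lambda>t. (cmod (g N t - g0 t))\<^sup>2)" using Fatou[of N N 1] by (simp add: less_imp_le)
    hence "L2_on l (\<lambda>t. g N t - g0 t)" using meas meas0 by (simp add: L2_on_def)
    from L2_on_diff[OF g[of N] this] show "L2_on l g0" by simp
    show "(\<lambda>n. sq_int l (\<lambda>t. g n t - g0 t)) \<longlonglongrightarrow> 0"
    proof (rule LIMSEQ_I)
      fix r :: real assume r: "0 < r"
      obtain N where N: "\<And>m n. m \<ge> N \<Longrightarrow> n \<ge> N \<Longrightarrow> sq_int l (\<lambda>t. g m t - g n t) < r / 2"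
        using Cauchy[of "r / 2"] r by auto
      have "sq_int l (\<lambda>t. g n t - g0 t) \<le> r / 2" if "n \<ge> N" for n
        using Fatou[of N n "r / 2"] N[OF that] by (simp add: less_imp_le)
      moreover have "0 \<le> sq_int l (\<lambda>t. g n t - g0 t)" for n by simp
      ultimately show "\<exists>N. \<forall>n\<ge>N. norm (sq_int l (\<lambda>t. g n t - g0 t) - 0) < r"
        using r by (intro exI[of _ N]) fastforce
    qed
  qed
qed

lemma sq_int_diff_tendsto_0:
  fixes f :: "nat \<Rightarrow> real \<Rightarrow> complex"
  assumes l: "0 \<le> l" and f: "\<And>n. continuous_on {0..l} (f n)" and unif: "uniform_limit {0..l} f f0 sequentially"
  shows "(\<lambda>n. sq_int l (\<lambda>t. f n t - f0 t)) \<longlonglongrightarrow> 0"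
proof (rule LIMSEQ_I)
  fix r :: real assume r: "0 < r"
  define \<delta> where "\<delta> = sqrt (r / (l + 1))"
  have \<delta>: "0 < \<delta>" "\<delta>\<^sup>2 * (l + 1) = r" using r l by (auto simp: \<delta>_def)
  have f0: "continuous_on {0..l} f0" using uniform_limit_theorem[OF _ unif] f by simp
  obtain N where N: "\<And>n s. n \<ge> N \<Longrightarrow> s \<in> {0..l} \<Longrightarrow> dist (f n s) (f0 s) < \<delta>"
    using uniform_limitD[OF unif \<delta>(1)] unfolding eventually_sequentially by blast
  have "sq_int l (\<lambda>t. f n t - f0 t) < r" if n: "n \<ge> N" for n
  proof -
    have "sq_int l (\<lambda>t. f n t - f0 t) \<le> (LINT s|Leb l. \<delta>\<^sup>2)"
    proof (rule integral_mono)
      show "integrable (Leb l) (\<lambda>t. (cmod (f n t - f0 t))\<^sup>2)"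
        by (intro integrable_Leb_cont continuous_intros f f0)
      show "(cmod (f n s - f0 s))\<^sup>2 \<le> \<delta>\<^sup>2" if "s \<in> space (Leb l)" for s
        using N[OF n, of s] that by (intro power_mono) (auto simp: dist_norm less_imp_le)
    qed (rule Lebesgue_Measure.integrable_const_ivl)
    also have "\<dots> = \<delta>\<^sup>2 * l" using l by (rule integral_Leb_const)
    also have "\<dots> < \<delta>\<^sup>2 * (l + 1)" using \<delta>(1) by simp
    finally show ?thesis by (simp only: \<delta>(2))
  qed
  thus "\<exists>N. \<forall>n\<ge>N. norm (sq_int l (\<lambda>t. f n t - f0 t) - 0) < r" by auto
qed

text \<open>
  Both sides of the defining identity are continuous: test functions and their derivatives are
  bounded.
\<close>

lemma is_weak_deriv_limit:
  assumes l: "0 \<le> l" and f: "\<And>n. continuous_on {0..l} (f n)" and g: "\<And>n. L2_on l (g n)" and g0: "L2_on l g0"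
    and wd: "\<And>n. is_weak_deriv l (f n) (g n)"
    and unif: "uniform_limit {0..l} f f0 sequentially"
    and lim: "(\<lambda>n. sq_int l (\<lambda>t. g n t - g0 t)) \<longlonglongrightarrow> 0"
  shows "is_weak_deriv l f0 g0"
  unfolding is_weak_deriv_def
proof (intro allI impI)
  fix \<phi> \<phi>' assume tf: "test_function l \<phi> \<phi>'"
  obtain K where K: "K \<ge> 0" "\<And>x. x \<in> {0..l} \<Longrightarrow> \<bar>\<phi> x\<bar> \<le> K" "\<And>x. x \<in> {0..l} \<Longrightarrow> \<bar>\<phi>' x\<bar> \<le> K"
    and cont: "continuous_on {0..l} \<phi>" "continuous_on {0..l} \<phi>'"
    using test_function_bounded[OF tf] by metis
  have f0: "continuous_on {0..l} f0"
    using uniform_limit_theorem[OF _ unif] f by simp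
  have "(\<lambda>n. LINT x|Leb l. complex_of_real (\<phi>' x) * f n x) \<longlonglongrightarrow> (LINT x|Leb l. complex_of_real (\<phi>' x) * f0 x)"
  proof (rule LIMSEQ_I)
    fix r :: real assume r: "0 < r"
    define s where "s = r / (K * l + 1)"
    have s: "s > 0" using r K l by (simp add: s_def add_nonneg_pos)
    obtain N where N: "\<And>n x. n \<ge> N \<Longrightarrow> x \<in> {0..l} \<Longrightarrow> dist (f n x) (f0 x) < s"
      using uniform_limitD[OF unif s] unfolding eventually_sequentially by blast
    have "norm ((LINT x|Leb l. complex_of_real (\<phi>' x) * f n x) - (LINT x|Leb l. complex_of_real (\<phi>' x) * f0 x)) < r"
      if n: "n \<ge> N" for n
    proof -
      have int: "integrable (Leb l) (\<lambda>x. complex_of_real (\<phi>' x) * k x)" if "continuous_on {0..l} k" for k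
        by (intro integrable_Leb_cont continuous_intros cont that)
      have "(LINT x|Leb l. complex_of_real (\<phi>' x) * f n x) - (LINT x|Leb l. complex_of_real (\<phi>' x) * f0 x)
          = (LINT x|Leb l. complex_of_real (\<phi>' x) * f n x - complex_of_real (\<phi>' x) * f0 x)"
        by (intro Bochner_Integration.integral_diff[symmetric] int f f0)
      also have "norm \<dots> \<le> (LINT x|Leb l. K * s)"
      proof (rule Bochner_Integration.integral_norm_bound_integral)
        fix x assume x: "x \<in> space (Leb l)"
        have "\<bar>\<phi>' x\<bar> * norm (f n x - f0 x) \<le> K * s"
          using x N[OF n, of x] K by (intro mult_mono) (auto simp: dist_norm)
        thus "norm (complex_of_real (\<phi>' x) * f n x - complex_of_real (\<phi>' x) * f0 x) \<le> K * s"
          by (simp only: right_diff_distrib[symmetric] norm_mult norm_of_real)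
      qed (intro Bochner_Integration.integrable_diff int f f0, simp)
      also have "\<dots> = K * l * s" using l by (simp only: integral_Leb_const) simp
      also have "\<dots> < (K * l + 1) * s" using s by (intro mult_strict_right_mono) auto
      also have "\<dots> = r" using K l by (simp add: s_def add_nonneg_pos less_imp_neq[THEN not_sym])
      finally show ?thesis .
    qed
    thus "\<exists>N. \<forall>n\<ge>N. norm ((LINT x|Leb l. complex_of_real (\<phi>' x) * f n x) - (LINT x|Leb l. complex_of_real (\<phi>' x) * f0 x)) < r"
      by blast
  qed
  moreover have "(\<lambda>n. LINT x|Leb l. complex_of_real (\<phi> x) * g n x) \<longlonglongrightarrow> (LINT x|Leb l. complex_of_real (\<phi> x) * g0 x)"
  proof (rule Lim_transform2[OF tendsto_const], rule Lim_null_comparison)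
    have "(\<lambda>n. K * sqrt (l * sq_int l (\<lambda>t. g n t - g0 t))) \<longlonglongrightarrow> K * sqrt (l * 0)"
      by (intro tendsto_intros lim)
    thus "(\<lambda>n. K * sqrt (l * sq_int l (\<lambda>t. g n t - g0 t))) \<longlonglongrightarrow> 0" by simp
    have "norm ((LINT x|Leb l. complex_of_real (\<phi> x) * g0 x) - (LINT x|Leb l. complex_of_real (\<phi> x) * g n x))
        \<le> K * sqrt (l * sq_int l (\<lambda>t. g n t - g0 t))" for n
    proof -
      have int: "integrable (Leb l) (\<lambda>x. complex_of_real (\<phi> x) * k x)" if "L2_on l k" for k
        by (rule integrable_bounded_mult[OF L2_on_integrable[OF that] cont(1) K(2)])
      have d: "L2_on l (\<lambda>t. g n t - g0 t)" by (rule L2_on_diff[OF g g0])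
      have "(LINT x|Leb l. complex_of_real (\<phi> x) * g0 x) - (LINT x|Leb l. complex_of_real (\<phi> x) * g n x)
          = (LINT x|Leb l. complex_of_real (\<phi> x) * g0 x - complex_of_real (\<phi> x) * g n x)"
        by (intro Bochner_Integration.integral_diff[symmetric] int g g0)
      also have "norm \<dots> \<le> (LINT x|Leb l. K * cmod (g n x - g0 x))"
      proof (rule Bochner_Integration.integral_norm_bound_integral)
        show "integrable (Leb l) (\<lambda>x. K * cmod (g n x - g0 x))" using L2_on_integrable[OF d] by simp
        fix x assume x: "x \<in> space (Leb l)"
        have "\<bar>\<phi> x\<bar> * norm (g0 x - g n x) \<le> K * norm (g n x - g0 x)"
          using x K(2)[of x] by (intro mult_mono) (auto simp: norm_minus_commute)
        thus "norm (complex_of_real (\<phi> x) * g0 x - complex_of_real (\<phi> x) * g n x) \<le> K * cmod (g n x - g0 x)"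
          by (simp only: right_diff_distrib[symmetric] norm_mult norm_of_real)
      qed (intro Bochner_Integration.integrable_diff int g g0)
      also have "\<dots> = K * (LINT x|Leb l. cmod (g n x - g0 x))" by simp
      also have "\<dots> \<le> K * sqrt (l * sq_int l (\<lambda>t. g n t - g0 t))"
        using K(1) L1_sq_le_L2[OF l d] by (intro mult_left_mono real_le_rsqrt) auto
      finally show ?thesis .
    qed
    thus "\<forall>\<^sub>F n in sequentially. norm ((LINT x|Leb l. complex_of_real (\<phi> x) * g0 x) - (LINT x|Leb l. complex_of_real (\<phi> x) * g n x))
        \<le> K * sqrt (l * sq_int l (\<lambda>t. g n t - g0 t))" by simp
  qed
  hence "(\<lambda>n. - (LINT x|Leb l. complex_of_real (\<phi> x) * g n x)) \<longlonglongrightarrow> - (LINT x|Leb l. complex_of_real (\<phi> x) * g0 x)"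
    by (rule tendsto_minus)
  moreover have "(LINT x|Leb l. complex_of_real (\<phi>' x) * f n x) = - (LINT x|Leb l. complex_of_real (\<phi> x) * g n x)" for n
    using wd[of n] tf by (simp add: is_weak_deriv_def)
  ultimately show "(LINT x|Leb l. complex_of_real (\<phi>' x) * f0 x) = - (LINT x|Leb l. complex_of_real (\<phi> x) * g0 x)"
    by (simp add: LIMSEQ_unique)
qed

lemma is_weak_deriv_classical:
  assumes l: "0 < l" and f: "\<And>x. (f has_vector_derivative g x) (at x)" and g: "continuous_on UNIV g"
  shows "is_weak_deriv l f g"
  unfolding is_weak_deriv_def
proof (intro allI impI)
  fix \<phi> \<phi>' assume tf: "test_function l \<phi> \<phi>'"
  have cont: "continuous_on {0..l} \<phi>" "continuous_on {0..l} \<phi>'" using test_function_bounded[OF tf] by metis+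
  have fcont: "continuous_on {0..l} f"
    using f by (intro continuous_at_imp_continuous_on ballI has_vector_derivative_continuous)
  have gcont: "continuous_on {0..l} g" using g by (rule continuous_on_subset) simp
  have \<phi>: "(\<phi> has_real_derivative \<phi>' x) (at x)" for x using tf by (simp add: test_function_def)
  have \<phi>0: "\<phi> 0 = 0" "\<phi> l = 0"
  proof -
    obtain a b where "0 < a" "b < l" "\<And>x. x \<notin> {a..b} \<Longrightarrow> \<phi> x = 0" using tf by (auto simp: test_function_def)
    thus "\<phi> 0 = 0" "\<phi> l = 0" by auto
  qed
  let ?h = "\<lambda>x. complex_of_real (\<phi>' x) * f x + complex_of_real (\<phi> x) * g x"
  have "((\<lambda>x. complex_of_real (\<phi> x) * f x) has_vector_derivative complex_of_real (\<phi> x) * g x + complex_of_real (\<phi>' x) * f x) (at x)" for x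
    by (intro has_vector_derivative_mult f has_vector_derivative_of_real) (rule \<phi>)
  hence "(?h has_integral complex_of_real (\<phi> l) * f l - complex_of_real (\<phi> 0) * f 0) {0..l}"
    using l by (intro fundamental_theorem_of_calculus) (auto intro: has_vector_derivative_at_within simp: add.commute)
  hence 0: "integral {0..l} ?h = 0" using \<phi>0 by (simp add: integral_unique)
  have "(LINT x|Leb l. ?h x) = integral {0..l} ?h"
    by (intro lebesgue_integral_eq_integral integrable_Leb_cont continuous_intros cont fcont gcont) auto
  moreover have "(LINT x|Leb l. ?h x) = (LINT x|Leb l. complex_of_real (\<phi>' x) * f x) + (LINT x|Leb l. complex_of_real (\<phi> x) * g x)"
    by (intro Bochner_Integration.integral_add integrable_Leb_cont continuous_intros cont fcont gcont)
  ultimately show "(LINT x|Leb l. complex_of_real (\<phi>' x) * f x) = - (LINT x|Leb l. complex_of_real (\<phi> x) * g x)"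
    using 0 by (simp add: eq_neg_iff_add_eq_0)
qed

section \<open>The energy and mass forms of a metric graph\<close>

lemma sum_fun_apply: "(\<Sum>i\<in>I. g i) p = (\<Sum>i\<in>I. g i p)" for g :: "'i \<Rightarrow> 'p \<Rightarrow> complex"
  by (induction I rule: infinite_finite_induct) auto

abbreviation (input) fscale :: "complex \<Rightarrow> ('p \<Rightarrow> complex) \<Rightarrow> 'p \<Rightarrow> complex" where
  "fscale \<equiv> \<lambda>c u p. c * u p"

lemma sq_int_nonneg [simp]: "0 \<le> sq_int l f"
  by simp

lemma sq_int_AE_cong:
  assumes "L2_on l f" "L2_on l g" "AE x in Leb l. f x = g x"
  shows "sq_int l f = sq_int l g"
proof (rule integral_cong_AE)
  show "AE x in Leb l. (cmod (f x))\<^sup>2 = (cmod (g x))\<^sup>2" using assms(3) by eventually_elim simp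
qed (use assms(1,2)[THEN L2_on_measurable] in measurable)

lemma sq_int_add_le:
  assumes "L2_on l f" "L2_on l g"
  shows "sq_int l (\<lambda>x. f x + g x) \<le> 2 * sq_int l f + 2 * sq_int l g"
proof -
  have "sq_int l (\<lambda>x. f x + g x) \<le> (LINT x|Leb l. 2 * (cmod (f x))\<^sup>2 + 2 * (cmod (g x))\<^sup>2)"
  proof (rule integral_mono)
    show "(cmod (f x + g x))\<^sup>2 \<le> 2 * (cmod (f x))\<^sup>2 + 2 * (cmod (g x))\<^sup>2" for x
      using cmod_sq_le[of "f x + g x" "f x"] by simp
  qed (use L2_on_integrable_sq[OF L2_on_add[OF assms]] assms[THEN L2_on_integrable_sq] in auto)
  thus ?thesis using assms[THEN L2_on_integrable_sq] by simp
qed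

lemma sq_int_scale: "sq_int l (\<lambda>x. c * f x) = (cmod c)\<^sup>2 * sq_int l f"
  by (simp add: norm_mult power_mult_distrib)

lemma L2_self: "(LINT x|Leb l. u x * cnj (u x)) = complex_of_real (sq_int l u)"
proof -
  have "(LINT x|Leb l. u x * cnj (u x)) = (LINT x|Leb l. complex_of_real ((cmod (u x))\<^sup>2))"
    by (simp only: complex_norm_square[symmetric])
  thus ?thesis by (simp only: integral_complex_of_real)
qed

lemma L2_hermitian_form:
  "hermitian_form fscale {f. L2_on l f} (\<lambda>f g. LINT x|Leb l. f x * cnj (g x))"
proof (unfold_locales, goal_cases)
  case 1
  show ?case unfolding cfun.subspace_def using L2_on_cont[of l "\<lambda>_. 0"]
    by (auto simp: zero_fun_def plus_fun_def intro: L2_on_add L2_on_scale)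
next
  case (2 u v w)
  thus ?case using L2_on_integrable_mult[of l u w] L2_on_integrable_mult[of l v w]
    by (simp add: plus_fun_def distrib_right)
next
  case (4 u w)
  have "(LINT x|Leb l. w x * cnj (u x)) = (LINT x|Leb l. cnj (u x * cnj (w x)))"
    by (simp add: mult.commute)
  thus ?case by (simp only: Bochner_Integration.integral_cnj)
next
  case (5 u)
  show ?case by (simp only: L2_self) simp
qed (auto simp: mult.assoc)

lemma sq_int_tendsto:
  assumes "\<And>n. L2_on l (x n)" "L2_on l u" "(\<lambda>n. sq_int l (\<lambda>t. x n t - u t)) \<longlonglongrightarrow> 0"
  shows "(\<lambda>n. sq_int l (x n)) \<longlonglongrightarrow> sq_int l u"
proof -
  interpret L2: hermitian_form fscale "{f. L2_on l f}" "\<lambda>f g. LINT x|Leb l. f x * cnj (g x)"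
    by (rule L2_hermitian_form)
  have "(\<lambda>n. L2.Q (x n - u)) \<longlonglongrightarrow> 0" using assms(3) by (simp only: L2_self Re_complex_of_real minus_apply)
  hence "(\<lambda>n. L2.Q (x n)) \<longlonglongrightarrow> L2.Q u" using assms(1,2) by (intro L2.tendsto_Q) auto
  thus ?thesis by (simp only: L2_self Re_complex_of_real)
qed

text \<open>
  The members of the direct sum of the spaces \<open>L\<^sup>2\<close> of the edges. The mass form is the inner product of
  the families of restrictions of two functions to the edges, and the energy form is that of the
  families of their weak derivatives, so the two forms share all of their algebra.
\<close>

definition L2_family :: "'e set \<Rightarrow> ('e \<Rightarrow> real) \<Rightarrow> ('e \<Rightarrow> real \<Rightarrow> complex) \<Rightarrow> bool" where
  "L2_family E l F \<longleftrightarrow> (\<forall>e\<in>E. L2_on (l e) (F e)) \<and> (\<lambda>e. sq_int (l e) (F e)) summable_on E"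

definition family_inner ::
  "'e set \<Rightarrow> ('e \<Rightarrow> real) \<Rightarrow> ('e \<Rightarrow> real \<Rightarrow> complex) \<Rightarrow> ('e \<Rightarrow> real \<Rightarrow> complex) \<Rightarrow> complex" where
  "family_inner E l F H = (\<Sum>\<^sub>\<infinity>e\<in>E. LINT x|Leb (l e). F e x * cnj (H e x))"

lemma L2_familyD: "L2_family E l F \<Longrightarrow> e \<in> E \<Longrightarrow> L2_on (l e) (F e)"
  "L2_family E l F \<Longrightarrow> (\<lambda>e. sq_int (l e) (F e)) summable_on E"
  by (auto simp: L2_family_def)

lemma L2_familyI:
  assumes "\<And>e. e \<in> E \<Longrightarrow> L2_on (l e) (F e)" "s summable_on E"
    "\<And>e. e \<in> E \<Longrightarrow> sq_int (l e) (F e) \<le> s e"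
  shows "L2_family E l F"
  unfolding L2_family_def using assms by (auto intro: summable_on_comparison_test[OF assms(2)])

lemma L2_family_add:
  assumes "L2_family E l F" "L2_family E l H"
  shows "L2_family E l (\<lambda>e x. F e x + H e x)"
proof (rule L2_familyI)
  show "(\<lambda>e. 2 * sq_int (l e) (F e) + 2 * sq_int (l e) (H e)) summable_on E"
    using assms by (intro summable_on_add summable_on_cmult_right L2_familyD)
qed (use assms in \<open>auto intro: L2_on_add sq_int_add_le L2_familyD\<close>)

lemma L2_family_scale: "L2_family E l F \<Longrightarrow> L2_family E l (\<lambda>e x. c * F e x)"
  by (rule L2_familyI[where s = "\<lambda>e. (cmod c)\<^sup>2 * sq_int (l e) (F e)"])
    (auto simp only: sq_int_scale intro!: L2_on_scale summable_on_cmult_right L2_familyD)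

lemma L2_family_diff:
  "L2_family E l F \<Longrightarrow> L2_family E l H \<Longrightarrow> L2_family E l (\<lambda>e x. F e x - H e x)"
  using L2_family_add[of E l F "\<lambda>e x. - 1 * H e x"] L2_family_scale[of E l H "-1"] by simp

lemma family_inner_summable:
  assumes "L2_family E l F" "L2_family E l H"
  shows "(\<lambda>e. LINT x|Leb (l e). F e x * cnj (H e x)) summable_on E"
proof (rule abs_summable_summable, rule Infinite_Sum.abs_summable_on_comparison_test')
  show "(\<lambda>e. sq_int (l e) (F e) + sq_int (l e) (H e)) summable_on E"
    using assms by (intro summable_on_add L2_familyD)
  fix e assume e: "e \<in> E"
  note L2 = L2_familyD(1)[OF assms(1) e] L2_familyD(1)[OF assms(2) e]
  have "norm (LINT x|Leb (l e). F e x * cnj (H e x)) \<le> (LINT x|Leb (l e). (cmod (F e x))\<^sup>2 + (cmod (H e x))\<^sup>2)"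
  proof (rule Bochner_Integration.integral_norm_bound_integral)
    fix x
    have "0 \<le> cmod (F e x) * cmod (H e x)" by simp
    thus "norm (F e x * cnj (H e x)) \<le> (cmod (F e x))\<^sup>2 + (cmod (H e x))\<^sup>2"
      using sum_squares_bound[of "cmod (F e x)" "cmod (H e x)"]
      by (simp only: norm_mult complex_mod_cnj)
  qed (use L2 L2_on_integrable_mult L2_on_integrable_sq in auto)
  also have "\<dots> = sq_int (l e) (F e) + sq_int (l e) (H e)" using L2[THEN L2_on_integrable_sq] by simp
  finally show "norm (LINT x|Leb (l e). F e x * cnj (H e x)) \<le> sq_int (l e) (F e) + sq_int (l e) (H e)" .
qed

lemma family_inner_add_left:
  assumes "L2_family E l F" "L2_family E l G" "L2_family E l H"
  shows "family_inner E l (\<lambda>e x. F e x + G e x) H = family_inner E l F H + family_inner E l G H"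
proof -
  have "family_inner E l (\<lambda>e x. F e x + G e x) H =
    (\<Sum>\<^sub>\<infinity>e\<in>E. (LINT x|Leb (l e). F e x * cnj (H e x)) + (LINT x|Leb (l e). G e x * cnj (H e x)))"
    unfolding family_inner_def
  proof (rule infsum_cong)
    fix e assume "e \<in> E"
    thus "(LINT x|Leb (l e). (F e x + G e x) * cnj (H e x)) =
      (LINT x|Leb (l e). F e x * cnj (H e x)) + (LINT x|Leb (l e). G e x * cnj (H e x))"
      using assms by (simp add: distrib_right L2_on_integrable_mult L2_familyD)
  qed
  thus ?thesis unfolding family_inner_def using assms by (simp add: infsum_add family_inner_summable)
qed

lemma family_inner_scale_left:
  "family_inner E l (\<lambda>e x. c * F e x) H = c * family_inner E l F H"
  unfolding family_inner_def by (simp add: mult.assoc infsum_cmult_right')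

lemma family_inner_commute: "family_inner E l H F = cnj (family_inner E l F H)"
proof -
  have "(LINT x|Leb (l e). H e x * cnj (F e x)) = cnj (LINT x|Leb (l e). F e x * cnj (H e x))" for e
    by (subst Bochner_Integration.integral_cnj[symmetric]) (simp add: mult.commute)
  thus ?thesis by (simp add: family_inner_def)
qed

lemma family_inner_self:
  assumes "L2_family E l F"
  shows "Re (family_inner E l F F) = (\<Sum>\<^sub>\<infinity>e\<in>E. sq_int (l e) (F e))"
  using infsum_Re[OF family_inner_summable[OF assms assms]] by (simp add: family_inner_def L2_self)

text \<open>
  Weak derivatives are chosen arbitrarily within their class; sums and multiples of the chosen ones
  agree with the choice for the sum or multiple up to null sets only.
\<close>

lemma family_inner_AE_cong:
  assumes "\<And>e. e \<in> E \<Longrightarrow> AE x in Leb (l e). F e x = F' e x"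
    and "L2_family E l F" "L2_family E l F'" "L2_family E l H"
  shows "family_inner E l F H = family_inner E l F' H"
  unfolding family_inner_def
proof (rule infsum_cong, rule integral_cong_AE)
  fix e assume e: "e \<in> E"
  note L2_familyD(1)[THEN L2_on_measurable, OF assms(2) e, measurable]
    L2_familyD(1)[THEN L2_on_measurable, OF assms(3) e, measurable]
    L2_familyD(1)[THEN L2_on_measurable, OF assms(4) e, measurable]
  show "(\<lambda>x. F e x * cnj (H e x)) \<in> borel_measurable (Leb (l e))"
    "(\<lambda>x. F' e x * cnj (H e x)) \<in> borel_measurable (Leb (l e))" by measurable
  show "AE x in Leb (l e). F e x * cnj (H e x) = F' e x * cnj (H e x)"
    using assms(1)[OF e] by eventually_elim simp
qed

text \<open>
  Convergence on every single edge and the Cauchy property in the direct sum give convergence in the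
  direct sum: the bounds for finite sets of edges pass to the limit.
\<close>

lemma L2_family_limit:
  assumes D: "\<And>n. L2_family E l (D n)" and G: "\<And>e. e \<in> E \<Longrightarrow> L2_on (l e) (G e)"
    and lim: "\<And>e. e \<in> E \<Longrightarrow> (\<lambda>n. sq_int (l e) (\<lambda>x. D n e x - G e x)) \<longlonglongrightarrow> 0"
    and Cauchy: "\<And>\<epsilon>. \<epsilon> > 0 \<Longrightarrow> \<exists>N. \<forall>m\<ge>N. \<forall>n\<ge>N. (\<Sum>\<^sub>\<infinity>e\<in>E. sq_int (l e) (\<lambda>x. D m e x - D n e x)) < \<epsilon>"
  shows "L2_family E l G" "(\<lambda>n. \<Sum>\<^sub>\<infinity>e\<in>E. sq_int (l e) (\<lambda>x. D n e x - G e x)) \<longlonglongrightarrow> 0"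
proof -
  have fin: "(\<Sum>e\<in>F. sq_int (l e) (\<lambda>x. D n e x - G e x)) \<le> \<epsilon>"
    if N: "\<forall>m\<ge>N. \<forall>n\<ge>N. (\<Sum>\<^sub>\<infinity>e\<in>E. sq_int (l e) (\<lambda>x. D m e x - D n e x)) < \<epsilon>"
      and n: "n \<ge> N" and F: "finite F" "F \<subseteq> E" for N \<epsilon> n F
  proof (rule LIMSEQ_le_const2)
    show "(\<lambda>m. \<Sum>e\<in>F. sq_int (l e) (\<lambda>x. D n e x - D m e x)) \<longlonglongrightarrow> (\<Sum>e\<in>F. sq_int (l e) (\<lambda>x. D n e x - G e x))"
    proof (intro tendsto_sum sq_int_tendsto)
      fix e assume "e \<in> F"
      hence e: "e \<in> E" using F by auto
      show "L2_on (l e) (\<lambda>x. D n e x - D m e x)" "L2_on (l e) (\<lambda>x. D n e x - G e x)" for m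
        using D e G by (auto intro: L2_on_diff L2_familyD)
      have "sq_int (l e) (\<lambda>t. (D n e t - D m e t) - (D n e t - G e t)) = sq_int (l e) (\<lambda>x. D m e x - G e x)" for m
        by (simp add: norm_minus_commute)
      thus "(\<lambda>m. sq_int (l e) (\<lambda>t. (D n e t - D m e t) - (D n e t - G e t))) \<longlonglongrightarrow> 0" using lim[OF e] by simp
    qed
    have "(\<Sum>e\<in>F. sq_int (l e) (\<lambda>x. D n e x - D m e x)) \<le> \<epsilon>" if "m \<ge> N" for m
    proof -
      have "(\<Sum>e\<in>F. sq_int (l e) (\<lambda>x. D n e x - D m e x)) \<le> (\<Sum>\<^sub>\<infinity>e\<in>E. sq_int (l e) (\<lambda>x. D n e x - D m e x))"
        using F L2_familyD(2)[OF L2_family_diff[OF D D]] by (intro finite_sum_le_infsum) auto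
      also have "\<dots> < \<epsilon>" using N that n by blast
      finally show ?thesis by simp
    qed
    thus "\<exists>N. \<forall>m\<ge>N. (\<Sum>e\<in>F. sq_int (l e) (\<lambda>x. D n e x - D m e x)) \<le> \<epsilon>" by blast
  qed
  have summ: "(\<lambda>e. sq_int (l e) (\<lambda>x. D n e x - G e x)) summable_on E"
    if N: "\<forall>m\<ge>N. \<forall>n\<ge>N. (\<Sum>\<^sub>\<infinity>e\<in>E. sq_int (l e) (\<lambda>x. D m e x - D n e x)) < \<epsilon>" and n: "n \<ge> N" for N \<epsilon> n
  proof (rule nonneg_bdd_above_summable_on)
    show "bdd_above (sum (\<lambda>e. sq_int (l e) (\<lambda>x. D n e x - G e x)) ` {F. F \<subseteq> E \<and> finite F})"
      using fin[OF N n] by (intro bdd_aboveI2[where M = \<epsilon>]) auto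
  qed simp
  obtain N where N: "\<forall>m\<ge>N. \<forall>n\<ge>N. (\<Sum>\<^sub>\<infinity>e\<in>E. sq_int (l e) (\<lambda>x. D m e x - D n e x)) < 1" using Cauchy[of 1] by auto
  have "L2_family E l (\<lambda>e x. D N e x - G e x)"
    unfolding L2_family_def using summ[OF N order.refl] D G by (auto intro: L2_on_diff L2_familyD)
  from L2_family_diff[OF D[of N] this] show fam: "L2_family E l G" by simp
  show "(\<lambda>n. \<Sum>\<^sub>\<infinity>e\<in>E. sq_int (l e) (\<lambda>x. D n e x - G e x)) \<longlonglongrightarrow> 0"
  proof (rule LIMSEQ_I)
    fix r :: real assume r: "0 < r"
    obtain N where N: "\<forall>m\<ge>N. \<forall>n\<ge>N. (\<Sum>\<^sub>\<infinity>e\<in>E. sq_int (l e) (\<lambda>x. D m e x - D n e x)) < r / 2"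
      using Cauchy[of "r / 2"] r by auto
    have "norm ((\<Sum>\<^sub>\<infinity>e\<in>E. sq_int (l e) (\<lambda>x. D n e x - G e x)) - 0) < r" if n: "n \<ge> N" for n
    proof -
      have "(\<Sum>\<^sub>\<infinity>e\<in>E. sq_int (l e) (\<lambda>x. D n e x - G e x)) \<le> r / 2"
        using summ[OF N n] fin[OF N n] by (intro infsum_le_finite_sums) auto
      moreover have "0 \<le> (\<Sum>\<^sub>\<infinity>e\<in>E. sq_int (l e) (\<lambda>x. D n e x - G e x))" by (intro infsum_nonneg) simp
      ultimately show ?thesis using r by simp
    qed
    thus "\<exists>N. \<forall>n\<ge>N. norm ((\<Sum>\<^sub>\<infinity>e\<in>E. sq_int (l e) (\<lambda>x. D n e x - G e x)) - 0) < r" by blast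
  qed
qed

definition edge_deriv :: "('e, 'p) graph \<Rightarrow> ('p \<Rightarrow> complex) \<Rightarrow> 'e \<Rightarrow> real \<Rightarrow> complex" where
  "edge_deriv G u e = weak_deriv (len G e) (on_edge G e u)"

lemma weak_deriv_props: "H1_on l f \<Longrightarrow> L2_on l (weak_deriv l f) \<and> is_weak_deriv l f (weak_deriv l f)"
  unfolding H1_on_def weak_deriv_def
  using someI_ex[where P = "\<lambda>g. L2_on l g \<and> is_weak_deriv l f g"] by blast

lemma on_edge_arith:
  "on_edge G e (u + v) = (\<lambda>x. on_edge G e u x + on_edge G e v x)"
  "on_edge G e (u - v) = (\<lambda>x. on_edge G e u x - on_edge G e v x)"
  "on_edge G e (fscale c u) = (\<lambda>x. c * on_edge G e u x)"
  by (auto simp: on_edge_def)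

lemma energy_form_eq: "energy_form G u v = family_inner (edges G) (len G) (edge_deriv G u) (edge_deriv G v)"
  by (simp add: energy_form_def family_inner_def edge_deriv_def)

lemma graph_inner_eq:
  "graph_inner G u v = family_inner (edges G) (len G) (\<lambda>e. on_edge G e u) (\<lambda>e. on_edge G e v)"
  by (simp add: graph_inner_def family_inner_def)

locale metric_graph_space =
  fixes G :: "('e, 'p) graph"
  assumes metric_graph: "metric_graph G"
begin

lemma len_pos: "e \<in> edges G \<Longrightarrow> 0 < len G e"
  using metric_graph by (simp add: metric_graph_def)

sublocale PM: Metric_space "points G" "path_dist G"
  using metric_graph by (simp add: metric_graph_def)

text \<open>
  The parametrisation of an edge is \<open>1\<close>-Lipschitz for the shortest-path metric.
\<close>

lemma continuous_on_edge:
  assumes "continuous_map (graph_topology G) euclidean u" and e: "e \<in> edges G"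
  shows "continuous_on {0..len G e} (on_edge G e u)"
proof -
  have "continuous_map (top_of_set {0..len G e}) PM.mtopology (param G e)"
    unfolding PM.continuous_map_to_metric
  proof (intro ballI allI impI)
    fix x and \<epsilon> :: real assume x: "x \<in> topspace (top_of_set {0..len G e})" and \<epsilon>: "0 < \<epsilon>"
    have "openin (top_of_set {0..len G e}) ({0..len G e} \<inter> ball x \<epsilon>)" by (intro openin_open_Int) simp
    moreover have "param G e y \<in> PM.mball (param G e x) \<epsilon>" if "y \<in> {0..len G e} \<inter> ball x \<epsilon>" for y
    proof -
      have "path_dist G (param G e x) (param G e y) \<le> \<bar>x - y\<bar>"
        using that x e by (intro path_dist_le walk_edge) auto
      also have "\<dots> < \<epsilon>" using that by (simp add: dist_real_def)
      finally show ?thesis using that x e by (simp add: param_in_points)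
    qed
    ultimately show "\<exists>U. openin (top_of_set {0..len G e}) U \<and> x \<in> U \<and>
        (\<forall>y\<in>U. param G e y \<in> PM.mball (param G e x) \<epsilon>)"
      using x \<epsilon> by (intro exI[of _ "{0..len G e} \<inter> ball x \<epsilon>"]) auto
  qed
  hence "continuous_map (top_of_set {0..len G e}) euclidean (u \<circ> param G e)"
    using assms(1) unfolding graph_topology_def by (rule continuous_map_compose)
  thus ?thesis by (simp add: on_edge_def comp_def)
qed

lemma H1_edge:
  assumes "u \<in> graph_H1 G" "e \<in> edges G"
  shows "continuous_on {0..len G e} (on_edge G e u)" "L2_on (len G e) (on_edge G e u)"
    "L2_on (len G e) (edge_deriv G u e)" "is_weak_deriv (len G e) (on_edge G e u) (edge_deriv G u e)"
proof -
  show "continuous_on {0..len G e} (on_edge G e u)"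
    using assms by (intro continuous_on_edge) (auto simp: graph_H1_def)
  have "H1_on (len G e) (on_edge G e u)" using assms by (auto simp: graph_H1_def)
  thus "L2_on (len G e) (on_edge G e u)" "L2_on (len G e) (edge_deriv G u e)"
    "is_weak_deriv (len G e) (on_edge G e u) (edge_deriv G u e)"
    using weak_deriv_props[of "len G e" "on_edge G e u"] by (auto simp: H1_on_def edge_deriv_def)
qed

lemma H1_families:
  assumes "u \<in> graph_H1 G"
  shows "L2_family (edges G) (len G) (\<lambda>e. on_edge G e u)" "L2_family (edges G) (len G) (edge_deriv G u)"
proof -
  have s: "(\<lambda>e. H1_norm_sq (len G e) (on_edge G e u)) summable_on edges G"
    using assms by (simp add: graph_H1_def)
  show "L2_family (edges G) (len G) (\<lambda>e. on_edge G e u)" "L2_family (edges G) (len G) (edge_deriv G u)"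
    using H1_edge[OF assms] by (intro L2_familyI[OF _ s]; simp add: H1_norm_sq_def edge_deriv_def)+
qed

lemma edge_deriv_unique:
  assumes u: "u \<in> graph_H1 G" and e: "e \<in> edges G" and g: "L2_on (len G e) g" "is_weak_deriv (len G e) (on_edge G e u) g"
  shows "AE x in Leb (len G e). edge_deriv G u e x = g x"
  using H1_edge[OF u e] g by (intro weak_deriv_unique[OF len_pos[OF e]])

text \<open>
  Any square-integrable family of weak derivatives may serve as a witness, as it agrees almost
  everywhere with the chosen one.
\<close>

lemma graph_H1I:
  assumes zero: "\<And>p. p \<notin> points G \<Longrightarrow> u p = 0"
    and cont: "continuous_map (graph_topology G) euclidean u"
    and fam: "L2_family (edges G) (len G) (\<lambda>e. on_edge G e u)" "L2_family (edges G) (len G) g"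
    and wd: "\<And>e. e \<in> edges G \<Longrightarrow> is_weak_deriv (len G e) (on_edge G e u) (g e)"
  shows "u \<in> graph_H1 G"
proof -
  have H1: "H1_on (len G e) (on_edge G e u)" if "e \<in> edges G" for e
    using that fam[THEN L2_familyD(1)] wd by (auto simp: H1_on_def)
  have "H1_norm_sq (len G e) (on_edge G e u) = sq_int (len G e) (on_edge G e u) + sq_int (len G e) (g e)"
    if e: "e \<in> edges G" for e
  proof -
    note wd' = weak_deriv_props[OF H1[OF e]]
    have "AE x in Leb (len G e). weak_deriv (len G e) (on_edge G e u) x = g e x"
      using wd' fam[THEN L2_familyD(1), OF e] wd[OF e]
      by (intro weak_deriv_unique[OF len_pos[OF e] continuous_on_edge[OF cont e]]) auto
    hence "sq_int (len G e) (weak_deriv (len G e) (on_edge G e u)) = sq_int (len G e) (g e)"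
      using wd' L2_familyD(1)[OF fam(2) e] by (intro sq_int_AE_cong) auto
    thus ?thesis by (simp add: H1_norm_sq_def)
  qed
  hence "(\<lambda>e. H1_norm_sq (len G e) (on_edge G e u)) summable_on edges G \<longleftrightarrow>
    (\<lambda>e. sq_int (len G e) (on_edge G e u) + sq_int (len G e) (g e)) summable_on edges G"
    by (rule summable_on_cong)
  moreover have "(\<lambda>e. sq_int (len G e) (on_edge G e u) + sq_int (len G e) (g e)) summable_on edges G"
    using fam by (intro summable_on_add L2_familyD)
  ultimately show ?thesis using zero cont H1 by (simp add: graph_H1_def)
qed

lemma H1_add:
  assumes u: "u \<in> graph_H1 G" and v: "v \<in> graph_H1 G"
  shows "u + v \<in> graph_H1 G"
    "\<And>e. e \<in> edges G \<Longrightarrow> AE x in Leb (len G e). edge_deriv G (u + v) e x = edge_deriv G u e x + edge_deriv G v e x"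
proof -
  have "continuous_map (graph_topology G) euclidean (\<lambda>p. u p + v p)"
    using u v by (intro continuous_map_add) (auto simp: graph_H1_def)
  hence c: "continuous_map (graph_topology G) euclidean (u + v)" by (simp add: plus_fun_def)
  have f1: "L2_family (edges G) (len G) (\<lambda>e. on_edge G e (u + v))"
    unfolding on_edge_arith by (intro L2_family_add H1_families u v)
  have f2: "L2_family (edges G) (len G) (\<lambda>e x. edge_deriv G u e x + edge_deriv G v e x)"
    by (intro L2_family_add H1_families u v)
  have w: "is_weak_deriv (len G e) (on_edge G e (u + v)) (\<lambda>x. edge_deriv G u e x + edge_deriv G v e x)"
    if e: "e \<in> edges G" for e
    unfolding on_edge_arith using H1_edge[OF u e] H1_edge[OF v e] by (intro is_weak_deriv_add L2_on_integrable)
  have z: "(u + v) p = 0" if "p \<notin> points G" for p using u v that by (auto simp: graph_H1_def)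
  show uv: "u + v \<in> graph_H1 G" using z c f1 f2 w by (rule graph_H1I)
  show "AE x in Leb (len G e). edge_deriv G (u + v) e x = edge_deriv G u e x + edge_deriv G v e x"
    if e: "e \<in> edges G" for e by (rule edge_deriv_unique[OF uv e L2_familyD(1)[OF f2 e] w[OF e]])
qed

lemma H1_scale:
  assumes u: "u \<in> graph_H1 G"
  shows "fscale c u \<in> graph_H1 G"
    "\<And>e. e \<in> edges G \<Longrightarrow> AE x in Leb (len G e). edge_deriv G (fscale c u) e x = c * edge_deriv G u e x"
proof -
  have "continuous_map (graph_topology G) euclidean (\<lambda>p. c * u p)"
    using continuous_map_compose[of "graph_topology G" euclidean u euclidean "\<lambda>z. c * z"] u
    by (auto simp: graph_H1_def comp_def intro!: continuous_intros)
  hence c: "continuous_map (graph_topology G) euclidean (fscale c u)" by simp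
  have f1: "L2_family (edges G) (len G) (\<lambda>e. on_edge G e (fscale c u))"
    unfolding on_edge_arith by (intro L2_family_scale H1_families u)
  have f2: "L2_family (edges G) (len G) (\<lambda>e x. c * edge_deriv G u e x)"
    by (intro L2_family_scale H1_families u)
  have w: "is_weak_deriv (len G e) (on_edge G e (fscale c u)) (\<lambda>x. c * edge_deriv G u e x)"
    if e: "e \<in> edges G" for e
    unfolding on_edge_arith using H1_edge[OF u e] by (intro is_weak_deriv_scale)
  have z: "fscale c u p = 0" if "p \<notin> points G" for p using u that by (auto simp: graph_H1_def)
  show cu: "fscale c u \<in> graph_H1 G" using z c f1 f2 w by (rule graph_H1I)
  show "AE x in Leb (len G e). edge_deriv G (fscale c u) e x = c * edge_deriv G u e x"
    if e: "e \<in> edges G" for e by (rule edge_deriv_unique[OF cu e L2_familyD(1)[OF f2 e] w[OF e]])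
qed

lemma H1_zero: "0 \<in> graph_H1 G"
proof (rule graph_H1I)
  have L2: "L2_on l (\<lambda>x. 0)" for l by (rule L2_on_cont) simp
  show "L2_family (edges G) (len G) (\<lambda>e. on_edge G e 0)" "L2_family (edges G) (len G) (\<lambda>e x. 0)"
    by (simp_all add: L2_family_def on_edge_def L2)
  show "is_weak_deriv (len G e) (on_edge G e 0) (\<lambda>x. 0)" for e
    by (simp add: is_weak_deriv_def on_edge_def)
qed (auto simp: zero_fun_def)

lemma subspace_H1: "cfun.subspace (graph_H1 G)"
  unfolding cfun.subspace_def using H1_zero H1_add(1) H1_scale(1) by blast

lemma H1_diff:
  assumes u: "u \<in> graph_H1 G" and v: "v \<in> graph_H1 G"
  shows "u - v \<in> graph_H1 G"
    "\<And>e. e \<in> edges G \<Longrightarrow> AE x in Leb (len G e). edge_deriv G (u - v) e x = edge_deriv G u e x - edge_deriv G v e x"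
proof -
  have eq: "u - v = u + fscale (-1) v" by (auto simp: fun_eq_iff)
  show "u - v \<in> graph_H1 G" unfolding eq by (intro H1_add H1_scale u v)
  fix e assume e: "e \<in> edges G"
  show "AE x in Leb (len G e). edge_deriv G (u - v) e x = edge_deriv G u e x - edge_deriv G v e x"
    unfolding eq using H1_add(2)[OF u H1_scale(1)[OF v, of "-1"] e] H1_scale(2)[OF v e, of "-1"]
    by eventually_elim simp
qed

sublocale energy: hermitian_form fscale "graph_H1 G" "energy_form G"
proof (unfold_locales, goal_cases)
  case 1
  show ?case by (rule subspace_H1)
next
  case (2 u v w)
  have "family_inner (edges G) (len G) (edge_deriv G (u + v)) (edge_deriv G w) =
      family_inner (edges G) (len G) (\<lambda>e x. edge_deriv G u e x + edge_deriv G v e x) (edge_deriv G w)"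
    using 2 by (intro family_inner_AE_cong H1_add H1_families L2_family_add)
  thus ?case unfolding energy_form_eq using 2 by (simp add: H1_families family_inner_add_left)
next
  case (3 u w c)
  have "family_inner (edges G) (len G) (edge_deriv G (fscale c u)) (edge_deriv G w) =
      family_inner (edges G) (len G) (\<lambda>e x. c * edge_deriv G u e x) (edge_deriv G w)"
    using 3 by (intro family_inner_AE_cong H1_scale H1_families L2_family_scale)
  thus ?case unfolding energy_form_eq by (simp only: family_inner_scale_left)
next
  case (4 u w)
  show ?case unfolding energy_form_eq by (rule family_inner_commute)
next
  case (5 u)
  thus ?case unfolding energy_form_eq by (simp add: family_inner_self H1_families infsum_nonneg)
qed

sublocale mass: hermitian_form fscale "graph_H1 G" "graph_inner G"
proof (unfold_locales, goal_cases)
  case 1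
  show ?case by (rule subspace_H1)
next
  case (2 u v w)
  thus ?case unfolding graph_inner_eq on_edge_arith by (intro family_inner_add_left H1_families)
next
  case (3 u w c)
  show ?case unfolding graph_inner_eq on_edge_arith by (rule family_inner_scale_left)
next
  case (4 u w)
  show ?case unfolding graph_inner_eq by (rule family_inner_commute)
next
  case (5 u)
  thus ?case unfolding graph_inner_eq by (simp add: family_inner_self H1_families infsum_nonneg)
qed

lemma energy_self: "u \<in> graph_H1 G \<Longrightarrow> energy.Q u = (\<Sum>\<^sub>\<infinity>e\<in>edges G. sq_int (len G e) (edge_deriv G u e))"
  unfolding energy_form_eq by (intro family_inner_self H1_families)

lemma mass_self: "u \<in> graph_H1 G \<Longrightarrow> mass.Q u = (\<Sum>\<^sub>\<infinity>e\<in>edges G. sq_int (len G e) (on_edge G e u))"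
  unfolding graph_inner_eq by (intro family_inner_self H1_families)

text \<open>
  The members of the Sobolev space are continuous on the edges and vanish outside of the graph, so a
  function of mass \<open>0\<close> is \<open>0\<close> at every point.
\<close>

lemma mass_definite:
  assumes u: "u \<in> graph_H1 G" and 0: "mass.Q u = 0"
  shows "u = 0"
proof
  fix p
  show "u p = 0 p"
  proof (cases "p \<in> points G")
    case False
    thus ?thesis using u by (simp add: graph_H1_def)
  next
    case True
    then obtain e s where e: "e \<in> edges G" "s \<in> {0..len G e}" "p = param G e s" by (auto simp: points_def)
    have "sq_int (len G e) (on_edge G e u) \<le> mass.Q u"
      using finite_sum_le_infsum[OF L2_familyD(2)[OF H1_families(1)[OF u]], of "{e}"] e(1)
      by (simp add: mass_self[OF u])
    hence "sq_int (len G e) (on_edge G e u) = 0" using 0 sq_int_nonneg[of "len G e" "on_edge G e u"] by linarith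
    hence "integral {0..len G e} (\<lambda>x. (cmod (on_edge G e u x))\<^sup>2) = 0"
      using H1_edge[OF u e(1)] by (subst lebesgue_integral_eq_integral[symmetric]) (auto intro: L2_on_integrable_sq)
    moreover have "continuous_on (cbox 0 (len G e)) (\<lambda>x. (cmod (on_edge G e u x))\<^sup>2)"
      using H1_edge(1)[OF u e(1)] by (simp, intro continuous_intros)
    ultimately have "(cmod (on_edge G e u s))\<^sup>2 = 0"
      using e(2) len_pos[OF e(1)] integral_cbox_eq_0_iff[of 0 "len G e" "\<lambda>x. (cmod (on_edge G e u x))\<^sup>2"] by auto
    thus ?thesis by (simp add: e(3) on_edge_def)
  qed
qed

lemma eigenspace_neumann_laplacian:
  "eigenspace (neumann_laplacian G) \<mu> =
    {u \<in> graph_H1 G. \<forall>v\<in>graph_H1 G. energy_form G u v = complex_of_real \<mu> * graph_inner G u v}"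
proof -
  have "fscale c u \<in> graph_L2 G" if "u \<in> graph_H1 G" for c u
    using L2_family_scale[OF H1_families(1)[OF that], of c] that
    by (auto simp: graph_L2_def graph_H1_def L2_family_def on_edge_def)
  moreover have "graph_inner G (fscale c u) v = c * graph_inner G u v" for c u v
    unfolding graph_inner_eq on_edge_arith by (rule family_inner_scale_left)
  ultimately show ?thesis by (auto simp: eigenspace_def neumann_laplacian_def)
qed

end

locale discrete_metric_graph = metric_graph_space G +
  discrete_forms fscale "graph_H1 G" "energy_form G" "graph_inner G" C for G C
begin

text \<open>
  The successive minima list the eigenvalues with multiplicity, and such a list is unique.
\<close>

lemma eigenvalue_Rayleigh_basis:
  obtains e where "Rayleigh_basis fscale (graph_H1 G) (energy_form G) (graph_inner G) C e"
    "\<forall>k. eigenvalue (neumann_laplacian G) k = Rayleigh_basis.lam (energy_form G) e (k - 1)"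
proof -
  obtain e where e: "Rayleigh_basis fscale (graph_H1 G) (energy_form G) (graph_inner G) C e"
    by (rule Rayleigh_basis_exists)
  interpret R: Rayleigh_basis fscale "graph_H1 G" "energy_form G" "graph_inner G" C e by (rule e)
  have "enumerates_eigenvalues (neumann_laplacian G) R.lam"
    unfolding enumerates_eigenvalues_def
  proof (intro conjI allI R.incseq_lam)
    fix \<mu>
    show fin: "finite {k. R.lam k = \<mu>}" by (rule finite_subset[OF _ R.finite_lam_le[of \<mu>]]) auto
    show "\<exists>B. finite B \<and> \<not> cfun.dependent B \<and> cfun.span B = eigenspace (neumann_laplacian G) \<mu> \<and>
        card B = card {k. R.lam k = \<mu>}"
      using fin R.independent_e[OF fin] R.eigenspace_eq_span[of \<mu>]
      by (intro exI[of _ "e ` {k. R.lam k = \<mu>}"])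
        (auto simp: eigenspace_neumann_laplacian card_image inj_on_subset[OF R.inj_e])
  qed
  from eigenvalue_eq[OF this] show ?thesis by (intro that[OF e]) simp
qed

end

section \<open>Functions of finite energy at the feet of the teeth\<close>

text \<open>
  The mean value theorem. The exponent \<open>\<beta>\<close> is \<open>1 - \<alpha>\<close> or \<open>1 - 2 \<alpha>\<close> below; in both cases
  \<open>z powr (\<beta> - 1)\<close> decreases in \<open>z\<close>.
\<close>

lemma powr_increment:
  fixes x \<beta> :: real
  assumes "1 < x" "\<beta> < 1"
  obtains z where "x powr \<beta> - (x - 1) powr \<beta> = \<beta> * z" "x powr (\<beta> - 1) \<le> z"
proof -
  have "\<exists>\<xi>. x - 1 < \<xi> \<and> \<xi> < x \<and> x powr \<beta> - (x - 1) powr \<beta> = (x - (x - 1)) * (\<beta> * \<xi> powr (\<beta> - 1))"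
    using assms by (intro MVT2) (auto intro!: derivative_eq_intros)
  then obtain \<xi> where \<xi>: "x - 1 < \<xi>" "\<xi> < x" "x powr \<beta> - (x - 1) powr \<beta> = \<beta> * \<xi> powr (\<beta> - 1)" by auto
  have "x powr (\<beta> - 1) \<le> \<xi> powr (\<beta> - 1)"
    using \<xi> assms by (intro powr_mono2') auto
  with \<xi> show ?thesis by (intro that) auto
qed

lemma sum_powr_le:
  assumes "0 < \<alpha>" "\<alpha> < 1"
  shows "(\<Sum>n=1..N. real n powr (-\<alpha>)) \<le> real N powr (1 - \<alpha>) / (1 - \<alpha>)"
proof (induction N)
  case (Suc N)
  show ?case
  proof (cases "N = 0")
    case True
    thus ?thesis using assms by simp
  next
    case False
    obtain z where z: "real (Suc N) powr (1 - \<alpha>) - real N powr (1 - \<alpha>) = (1 - \<alpha>) * z" "real (Suc N) powr (-\<alpha>) \<le> z"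
      using powr_increment[of "real (Suc N)" "1 - \<alpha>"] False assms by auto
    have "(\<Sum>n=1..Suc N. real n powr (-\<alpha>)) = (\<Sum>n=1..N. real n powr (-\<alpha>)) + real (Suc N) powr (-\<alpha>)" by simp
    also have "\<dots> \<le> real N powr (1 - \<alpha>) / (1 - \<alpha>) + z" using Suc.IH z(2) by (rule add_mono)
    also have "\<dots> = real (Suc N) powr (1 - \<alpha>) / (1 - \<alpha>)" using z(1) assms by (simp add: field_simps)
    finally show ?thesis .
  qed
qed simp

lemma sum_powr_tail_le:
  assumes "1 < s" "1 \<le> M"
  shows "(\<Sum>n\<in>{M<..N}. real n powr (-s)) \<le> real M powr (1 - s) / (s - 1)"
proof (cases "M \<le> N")
  case True
  have "(\<Sum>n\<in>{M<..N}. real n powr (-s)) \<le> (real M powr (1 - s) - real N powr (1 - s)) / (s - 1)"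
    using True
  proof (induction N rule: dec_induct)
    case base
    thus ?case by simp
  next
    case (step N)
    obtain z where z: "real (Suc N) powr (1 - s) - real N powr (1 - s) = (1 - s) * z" "real (Suc N) powr (-s) \<le> z"
      using powr_increment[of "real (Suc N)" "1 - s"] step assms by auto
    have "{M<..Suc N} = insert (Suc N) {M<..N}" using step by auto
    hence "(\<Sum>n\<in>{M<..Suc N}. real n powr (-s)) = (\<Sum>n\<in>{M<..N}. real n powr (-s)) + real (Suc N) powr (-s)" by simp
    also have "\<dots> \<le> (real M powr (1 - s) - real N powr (1 - s)) / (s - 1) + z" using step.IH z(2) by (rule add_mono)
    also have "\<dots> = (real M powr (1 - s) - real (Suc N) powr (1 - s)) / (s - 1)"
      using z(1) assms by (simp add: field_simps)
    finally show ?case .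
  qed
  also have "\<dots> \<le> real M powr (1 - s) / (s - 1)" using assms by (intro divide_right_mono) auto
  finally show ?thesis .
qed (use assms in simp)

text \<open>
  The Cauchy--Schwarz inequality for two summands, in a form that adds up lengths and energies along a
  path.
\<close>

lemma sq_add_le_mult:
  fixes p q X Y x y :: real
  assumes "p\<^sup>2 \<le> X * Y" "q\<^sup>2 \<le> x * y" "0 \<le> p" "0 \<le> q" "0 \<le> X" "0 \<le> Y" "0 \<le> x" "0 \<le> y"
  shows "(p + q)\<^sup>2 \<le> (X + x) * (Y + y)"
proof -
  define A B where "A = X * y" and "B = x * Y"
  have AB: "0 \<le> A" "0 \<le> B" using assms by (auto simp: A_def B_def)
  have "(p * q)\<^sup>2 \<le> (X * Y) * (x * y)"
    unfolding power_mult_distrib using assms by (intro mult_mono) auto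
  also have "\<dots> = A * B" by (simp only: A_def B_def mult_ac)
  also have "\<dots> \<le> ((A + B) / 2)\<^sup>2"
    using zero_le_power2[of "A - B"] by (simp add: power2_eq_square field_simps)
  finally have "p * q \<le> (A + B) / 2" by (rule power2_le_imp_le) (use AB in simp)
  thus ?thesis using assms(1,2) by (simp add: power2_sum algebra_simps A_def B_def)
qed

locale comb =
  fixes \<alpha> :: real
  assumes \<alpha>_gt: "1 / 2 < \<alpha>" and \<alpha>_lt: "\<alpha> < 1"
begin

abbreviation "G \<equiv> diagonal_comb \<alpha>"

lemma \<alpha>_pos: "0 < \<alpha>"
  using \<alpha>_gt by simp

sublocale metric_graph_space G
  by unfold_locales (rule metric_graph_diagonal_comb[OF \<alpha>_pos])

definition foot :: "nat \<Rightarrow> real" where "foot n = real n powr (-\<alpha>)"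

definition foot_val :: "(real \<times> real \<Rightarrow> complex) \<Rightarrow> nat \<Rightarrow> complex" where
  "foot_val u n = u (foot n, 0)"

definition index :: "comb_edge \<Rightarrow> nat" where
  "index e = (case e of Tooth n \<Rightarrow> n | Backbone n \<Rightarrow> n)"

lemma index_simps [simp]: "index (Tooth n) = n" "index (Backbone n) = n"
  by (simp_all add: index_def)

lemma edges_iff [simp]: "Tooth n \<in> edges G \<longleftrightarrow> 1 \<le> n" "Backbone n \<in> edges G \<longleftrightarrow> 1 \<le> n"
  by (auto simp: diagonal_comb_def)

lemma index_ge: "e \<in> edges G \<Longrightarrow> 1 \<le> index e"
  by (cases e) auto

lemma len_simps: "len G (Tooth n) = foot n" "len G (Backbone n) = foot n - foot (Suc n)"
  by (simp_all add: diagonal_comb_simps foot_def)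

lemma foot_nonneg [simp]: "0 \<le> foot n"
  by (simp add: foot_def)

lemma foot_mono: "1 \<le> m \<Longrightarrow> m \<le> n \<Longrightarrow> foot n \<le> foot m"
  unfolding foot_def by (rule foot_le[OF \<alpha>_pos])

lemma foot_le_1: "1 \<le> n \<Longrightarrow> foot n \<le> 1"
  using foot_mono[of 1 n] by (simp add: foot_def)

lemma foot_tendsto_0: "foot \<longlonglongrightarrow> 0"
  unfolding foot_def[abs_def] using \<alpha>_pos
  by (intro tendsto_neg_powr filterlim_real_sequentially) auto

lemma len_le_foot: "e \<in> edges G \<Longrightarrow> len G e \<le> foot (index e)"
  by (cases e) (auto simp: len_simps)

lemma on_edge_feet:
  "on_edge G (Tooth n) u 0 = foot_val u n" "on_edge G (Backbone n) u 0 = foot_val u (Suc n)"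
  "on_edge G (Backbone n) u (len G (Backbone n)) = foot_val u n"
  by (simp_all add: on_edge_def foot_val_def len_simps diagonal_comb_simps foot_def)

definition edge_energy :: "(real \<times> real \<Rightarrow> complex) \<Rightarrow> comb_edge \<Rightarrow> real" where
  "edge_energy u e = sq_int (len G e) (edge_deriv G u e)"

definition edge_mass :: "(real \<times> real \<Rightarrow> complex) \<Rightarrow> comb_edge \<Rightarrow> real" where
  "edge_mass u e = sq_int (len G e) (on_edge G e u)"

lemma edge_nonneg [simp]: "0 \<le> edge_energy u e" "0 \<le> edge_mass u e"
  by (simp_all add: edge_energy_def edge_mass_def)

lemma edge_energy_sum:
  assumes "u \<in> graph_H1 G"
  shows "edge_energy u summable_on edges G" "energy.Q u = infsum (edge_energy u) (edges G)"
proof -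
  have "edge_energy u = (\<lambda>e. sq_int (len G e) (edge_deriv G u e))" by (simp add: fun_eq_iff edge_energy_def)
  thus "edge_energy u summable_on edges G" "energy.Q u = infsum (edge_energy u) (edges G)"
    using L2_familyD(2)[OF H1_families(2)[OF assms]] energy_self[OF assms] by simp_all
qed

lemma edge_mass_sum:
  assumes "u \<in> graph_H1 G"
  shows "edge_mass u summable_on edges G" "mass.Q u = infsum (edge_mass u) (edges G)"
proof -
  have "edge_mass u = (\<lambda>e. sq_int (len G e) (on_edge G e u))" by (simp add: fun_eq_iff edge_mass_def)
  thus "edge_mass u summable_on edges G" "mass.Q u = infsum (edge_mass u) (edges G)"
    using L2_familyD(2)[OF H1_families(1)[OF assms]] mass_self[OF assms] by simp_all
qed

lemma sum_edge_energy_le: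
  assumes "u \<in> graph_H1 G" "finite F" "F \<subseteq> edges G"
  shows "(\<Sum>e\<in>F. edge_energy u e) \<le> energy.Q u"
  unfolding edge_energy_sum(2)[OF assms(1)]
  using assms edge_energy_sum(1)[OF assms(1)] by (intro finite_sum_le_infsum) auto

lemma edge_energy_le: "u \<in> graph_H1 G \<Longrightarrow> e \<in> edges G \<Longrightarrow> edge_energy u e \<le> energy.Q u"
  using sum_edge_energy_le[of u "{e}"] by simp

lemma edge_increment:
  assumes u: "u \<in> graph_H1 G" and e: "e \<in> edges G" and st: "s \<in> {0..len G e}" "t \<in> {0..len G e}"
  shows "(cmod (on_edge G e u t - on_edge G e u s))\<^sup>2 \<le> len G e * edge_energy u e"
proof -
  let ?l = "len G e"
  note H = H1_edge[OF u e]
  have "(cmod (on_edge G e u t - on_edge G e u s))\<^sup>2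
      \<le> (?l - 0) * (LINT x|Leb ?l. indicator {0<..?l} x * (cmod (edge_deriv G u e x))\<^sup>2)"
    using st by (intro weak_deriv_increment_sq_le[OF H(1,3,4)]) auto
  also have "\<dots> \<le> (?l - 0) * edge_energy u e"
    unfolding edge_energy_def using len_pos[OF e]
    by (intro mult_left_mono integral_mono L2_on_integrable_indicator_sq L2_on_integrable_sq H)
      (auto split: split_indicator)
  finally show ?thesis by simp
qed

text \<open>
  The path from the \<open>n\<close>-th to the \<open>m\<close>-th foot runs through the backbone edges between them.
\<close>

lemma foot_increment:
  assumes u: "u \<in> graph_H1 G" and nm: "1 \<le> n" "n \<le> m"
  shows "(cmod (foot_val u n - foot_val u m))\<^sup>2 \<le> (foot n - foot m) * (\<Sum>i=n..<m. edge_energy u (Backbone i))"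
  using nm(2)
proof (induction m rule: dec_induct)
  case base
  thus ?case by simp
next
  case (step m)
  have B: "Backbone m \<in> edges G" using step nm by simp
  have "0 < len G (Backbone m)" by (rule len_pos[OF B])
  hence "(cmod (foot_val u m - foot_val u (Suc m)))\<^sup>2 \<le> (foot m - foot (Suc m)) * edge_energy u (Backbone m)"
    using edge_increment[OF u B, of 0 "len G (Backbone m)", unfolded on_edge_feet] by (simp add: len_simps)
  hence B: "(cmod (foot_val u n - foot_val u m) + cmod (foot_val u m - foot_val u (Suc m)))\<^sup>2
    \<le> ((foot n - foot m) + (foot m - foot (Suc m))) * ((\<Sum>i=n..<m. edge_energy u (Backbone i)) + edge_energy u (Backbone m))"
    using step nm foot_mono[of n m] foot_mono[of m "Suc m"] by (intro sq_add_le_mult) (auto intro: sum_nonneg)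
  have "cmod (foot_val u n - foot_val u (Suc m)) \<le> cmod (foot_val u n - foot_val u m) + cmod (foot_val u m - foot_val u (Suc m))"
    using norm_triangle_ineq[of "foot_val u n - foot_val u m" "foot_val u m - foot_val u (Suc m)"] by simp
  hence "(cmod (foot_val u n - foot_val u (Suc m)))\<^sup>2 \<le> (cmod (foot_val u n - foot_val u m) + cmod (foot_val u m - foot_val u (Suc m)))\<^sup>2"
    by (intro power_mono) auto
  from order.trans[OF this B] show ?case using step by simp
qed

lemma foot_increment_energy:
  assumes u: "u \<in> graph_H1 G" and nm: "1 \<le> n" "1 \<le> m"
  shows "(cmod (foot_val u n - foot_val u m))\<^sup>2 \<le> \<bar>foot n - foot m\<bar> * energy.Q u"
proof -
  have *: "(cmod (foot_val u n - foot_val u m))\<^sup>2 \<le> (foot n - foot m) * energy.Q u" if "1 \<le> n" "n \<le> m" for n m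
  proof -
    have "(\<Sum>i=n..<m. edge_energy u (Backbone i)) = (\<Sum>e\<in>Backbone ` {n..<m}. edge_energy u e)"
      by (subst sum.reindex) (auto simp: inj_on_def)
    also have "\<dots> \<le> energy.Q u" using that by (intro sum_edge_energy_le u) auto
    finally show ?thesis
      using foot_increment[OF u that] foot_mono[OF that] mult_left_mono[of _ _ "foot n - foot m"] by fastforce
  qed
  show ?thesis
    using *[of n m] *[of m n] foot_mono[of n m] foot_mono[of m n] nm
    by (cases "n \<le> m") (auto simp: norm_minus_commute)
qed

text \<open>
  By the increment bound the values form a Cauchy sequence. If its limit \<open>c\<close> were not \<open>0\<close>, then, as the
  variation of \<open>u\<close> along a short tooth is small, all late teeth would carry mass at least
  proportional to their length; but these lengths are not summable since \<open>\<alpha> < 1\<close>.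
\<close>

lemma foot_val_tendsto_0:
  assumes u: "u \<in> graph_H1 G"
  shows "foot_val u \<longlonglongrightarrow> 0"
proof -
  have E0: "0 \<le> energy.Q u" by (rule energy.nonneg[OF u])
  have "Cauchy (\<lambda>n. foot_val u n)"
  proof (rule metric_CauchyI)
    fix \<epsilon> :: real assume \<epsilon>: "0 < \<epsilon>"
    have "\<forall>\<^sub>F n in sequentially. foot n < \<epsilon>\<^sup>2 / (energy.Q u + 1)"
      using \<epsilon> E0 by (intro order_tendstoD[OF foot_tendsto_0]) auto
    then obtain N where N: "\<And>n. n \<ge> N \<Longrightarrow> foot n < \<epsilon>\<^sup>2 / (energy.Q u + 1)" by (auto simp: eventually_sequentially)
    have "dist (foot_val u m) (foot_val u n) < \<epsilon>" if mn: "m \<ge> max 1 N" "n \<ge> max 1 N" for m n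
    proof -
      have f: "foot m < \<epsilon>\<^sup>2 / (energy.Q u + 1)" "foot n < \<epsilon>\<^sup>2 / (energy.Q u + 1)" using N mn by auto
      have "\<bar>foot m - foot n\<bar> < \<epsilon>\<^sup>2 / (energy.Q u + 1)"
        using f foot_nonneg[of m] foot_nonneg[of n] unfolding abs_if by (auto simp del: foot_nonneg)
      have "(cmod (foot_val u m - foot_val u n))\<^sup>2 \<le> \<bar>foot m - foot n\<bar> * energy.Q u"
        using mn by (intro foot_increment_energy u) auto
      also have "\<dots> \<le> \<bar>foot m - foot n\<bar> * (energy.Q u + 1)" by (intro mult_left_mono) auto
      also have "\<dots> < \<epsilon>\<^sup>2 / (energy.Q u + 1) * (energy.Q u + 1)"
        using \<open>\<bar>foot m - foot n\<bar> < _\<close> E0 by (intro mult_strict_right_mono) auto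
      also have "\<dots> = \<epsilon>\<^sup>2" using E0 by simp
      finally show ?thesis using \<epsilon> by (simp add: dist_norm power_less_imp_less_base)
    qed
    thus "\<exists>N. \<forall>m\<ge>N. \<forall>n\<ge>N. dist (foot_val u m) (foot_val u n) < \<epsilon>" by blast
  qed
  then obtain c where c: "foot_val u \<longlonglongrightarrow> c" by (auto simp: Cauchy_convergent_iff convergent_def)
  \<comment> \<open>The value at the foot is compared with the values on the tooth and integrated over the tooth.\<close>
  have tooth: "foot n * (cmod (foot_val u n))\<^sup>2 \<le> 2 * edge_mass u (Tooth n) + 2 * (foot n)\<^sup>2 * energy.Q u" if n: "1 \<le> n" for n
  proof -
    have T: "Tooth n \<in> edges G" using n by simp
    note H = H1_edge[OF u T, unfolded len_simps]
    have pt: "(cmod (foot_val u n))\<^sup>2 \<le> 2 * (cmod (on_edge G (Tooth n) u s))\<^sup>2 + 2 * (foot n * energy.Q u)" if s: "s \<in> {0..foot n}" for s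
    proof -
      have "(cmod (on_edge G (Tooth n) u 0 - on_edge G (Tooth n) u s))\<^sup>2 \<le> foot n * edge_energy u (Tooth n)"
        using edge_increment[OF u T, of s 0] s by (simp add: len_simps)
      also have "\<dots> \<le> foot n * energy.Q u" by (intro mult_left_mono edge_energy_le u T) auto
      finally show ?thesis using cmod_sq_le[of "on_edge G (Tooth n) u 0" "on_edge G (Tooth n) u s"]
        by (simp add: on_edge_feet)
    qed
    have const: "(LINT s|Leb (foot n). k) = k * foot n" for k by (rule integral_Leb_const) simp
    have "(LINT s|Leb (foot n). (cmod (foot_val u n))\<^sup>2) \<le>
        (LINT s|Leb (foot n). 2 * (cmod (on_edge G (Tooth n) u s))\<^sup>2 + 2 * (foot n * energy.Q u))"
      using pt L2_on_integrable_sq[OF H(2)] by (intro integral_mono) auto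
    also have "\<dots> = 2 * edge_mass u (Tooth n) + 2 * (foot n * energy.Q u) * foot n"
      by (simp only: Bochner_Integration.integral_add[OF integrable_mult_right[OF L2_on_integrable_sq[OF H(2)]] Lebesgue_Measure.integrable_const_ivl]
        integral_mult_right_zero const edge_mass_def len_simps)
    finally show ?thesis by (simp only: const power2_eq_square) (simp add: algebra_simps)
  qed
  have "c = 0"
  proof (rule ccontr)
    assume c0: "c \<noteq> 0"
    let ?d = "(cmod c)\<^sup>2"
    have d: "0 < ?d" using c0 by simp
    have "(\<lambda>n. (cmod (foot_val u n))\<^sup>2 - 2 * foot n * energy.Q u) \<longlonglongrightarrow> ?d - 2 * 0 * energy.Q u"
      by (intro tendsto_intros c foot_tendsto_0)
    hence "\<forall>\<^sub>F n in sequentially. ?d / 2 < (cmod (foot_val u n))\<^sup>2 - 2 * foot n * energy.Q u"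
      using d by (intro order_tendstoD) auto
    then obtain N where N: "\<And>n. n \<ge> N \<Longrightarrow> ?d / 2 < (cmod (foot_val u n))\<^sup>2 - 2 * foot n * energy.Q u"
      by (auto simp: eventually_sequentially)
    have foot_le: "foot n \<le> 4 / ?d * edge_mass u (Tooth n)" if n: "n \<ge> max 1 N" for n
    proof -
      have "foot n * (?d / 2) \<le> foot n * ((cmod (foot_val u n))\<^sup>2 - 2 * foot n * energy.Q u)"
        using N[of n] n by (intro mult_left_mono) auto
      also have "\<dots> \<le> 2 * edge_mass u (Tooth n)" using tooth[of n] n by (simp add: algebra_simps power2_eq_square)
      finally show ?thesis using d by (simp add: field_simps)
    qed
    have "(edge_mass u \<circ> Tooth) summable_on {1..}"
    proof (subst summable_on_reindex[symmetric])
      show "edge_mass u summable_on Tooth ` {1..}"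
        by (rule summable_on_subset_banach[OF edge_mass_sum(1)[OF u]]) auto
    qed (simp add: inj_on_def)
    hence "(edge_mass u \<circ> Tooth) summable_on {max 1 N..}" by (rule summable_on_subset_banach) auto
    hence "(\<lambda>n. 4 / ?d * edge_mass u (Tooth n)) summable_on {max 1 N..}"
      by (intro summable_on_cmult_right) (simp add: comp_def)
    hence "foot summable_on {max 1 N..}"
      by (rule summable_on_comparison_test) (use foot_le in auto)
    moreover have "foot summable_on {..<max 1 N}" by simp
    ultimately have "foot summable_on ({..<max 1 N} \<union> {max 1 N..})" by (intro summable_on_Un_disjoint) auto
    moreover have "{..<max 1 N} \<union> {max 1 N..} = UNIV" by auto
    ultimately have "summable foot" using summable_on_imp_summable by metis
    hence "summable (\<lambda>n. real n powr (-\<alpha>))" by (simp add: foot_def[abs_def])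
    thus False using \<alpha>_lt by (simp add: summable_real_powr_iff)
  qed
  with c show ?thesis by simp
qed

text \<open>
  The increment bound between the feet \<open>n\<close> and \<open>m\<close>, in the limit of large \<open>m\<close>.
\<close>

lemma foot_val_sq_le:
  assumes u: "u \<in> graph_H1 G" and n: "1 \<le> n"
  shows "(cmod (foot_val u n))\<^sup>2 \<le> foot n * energy.Q u"
proof (rule LIMSEQ_le_const2)
  show "(\<lambda>m. (cmod (foot_val u n - foot_val u m))\<^sup>2) \<longlonglongrightarrow> (cmod (foot_val u n))\<^sup>2"
    using tendsto_power[OF tendsto_norm[OF tendsto_diff[OF tendsto_const foot_val_tendsto_0[OF u], of "foot_val u n"]], of 2] by simp
  have "(cmod (foot_val u n - foot_val u m))\<^sup>2 \<le> foot n * energy.Q u" if m: "m \<ge> n" for m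
  proof -
    have "(cmod (foot_val u n - foot_val u m))\<^sup>2 \<le> \<bar>foot n - foot m\<bar> * energy.Q u"
      using n m by (intro foot_increment_energy u) auto
    also have "\<dots> \<le> foot n * energy.Q u"
      using foot_mono[OF n m] foot_nonneg[of m] energy.nonneg[OF u] by (intro mult_right_mono) linarith+
    finally show ?thesis .
  qed
  thus "\<exists>N. \<forall>m\<ge>N. (cmod (foot_val u n - foot_val u m))\<^sup>2 \<le> foot n * energy.Q u" by blast
qed

text \<open>
  Every point lies on an edge of length at most \<open>1\<close> that starts at a foot.
\<close>

lemma point_sq_le:
  assumes u: "u \<in> graph_H1 G"
  shows "(cmod (u p))\<^sup>2 \<le> 4 * energy.Q u"
proof (cases "p \<in> points G")
  case False
  hence "u p = 0" using u unfolding graph_H1_def by blast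
  thus ?thesis using energy.nonneg[OF u] by simp
next
  case True
  then obtain e s where e: "e \<in> edges G" "s \<in> {0..len G e}" "p = param G e s" by (auto simp: points_def)
  note E0 = energy.nonneg[OF u]
  have "\<exists>n\<ge>1. on_edge G e u 0 = foot_val u n"
    using e(1) by (cases e) (auto simp: on_edge_feet intro: exI[of _ "Suc _"])
  then obtain n where n: "1 \<le> n" "on_edge G e u 0 = foot_val u n" by blast
  have "(cmod (on_edge G e u 0))\<^sup>2 \<le> 1 * energy.Q u"
    unfolding n(2) using foot_val_sq_le[OF u n(1)] mult_right_mono[OF foot_le_1[OF n(1)] E0] by linarith
  moreover have "(cmod (on_edge G e u s - on_edge G e u 0))\<^sup>2 \<le> 1 * energy.Q u"
  proof -
    have "(cmod (on_edge G e u s - on_edge G e u 0))\<^sup>2 \<le> len G e * edge_energy u e"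
      using e(2) len_pos[OF e(1)] by (intro edge_increment[OF u e(1)]) auto
    also have "\<dots> \<le> 1 * energy.Q u"
      using len_le_foot[OF e(1)] foot_le_1[OF index_ge[OF e(1)]] edge_energy_le[OF u e(1)]
      by (intro mult_mono) auto
    finally show ?thesis .
  qed
  ultimately show ?thesis using cmod_sq_le[of "on_edge G e u s" "on_edge G e u 0"] by (simp add: e(3) on_edge_def)
qed

section \<open>Mass against energy\<close>

text \<open>
  The number of pieces into which the edges with index \<open>n \<le> K\<close> are cut; the pieces then have length at
  most \<open>K powr (-\<alpha>)\<close>, and there are of order \<open>K\<close> of them altogether.
\<close>

definition subdiv :: "nat \<Rightarrow> nat \<Rightarrow> nat" where
  "subdiv K n = nat \<lceil>(real K / real n) powr \<alpha>\<rceil>"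

text \<open>
  The number of the interval of length \<open>K powr (-1 - \<alpha>)\<close> that contains the \<open>n\<close>-th foot. For \<open>n > K\<close>
  it is at most \<open>K\<close>.
\<close>

definition cell :: "nat \<Rightarrow> nat \<Rightarrow> nat" where
  "cell K n = nat \<lfloor>foot n * real K powr (1 + \<alpha>)\<rfloor>"

text \<open>
  One foot with index beyond \<open>K\<close> in each cell. For a cell without such a foot the choice is arbitrary
  and merely adds one more point to the grid.
\<close>

definition cell_rep :: "nat \<Rightarrow> nat \<Rightarrow> nat" where
  "cell_rep K i = (SOME n. K < n \<and> cell K n = i)"

definition grid :: "nat \<Rightarrow> (real \<times> real) set" where
  "grid K = (\<Union>e\<in>Tooth ` {1..K} \<union> Backbone ` {1..K}.
      (\<lambda>j. param G e (real j * (len G e / real (subdiv K (index e))))) ` {..<subdiv K (index e)})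
    \<union> (\<lambda>i. (foot (cell_rep K i), 0)) ` {..K}"

lemma finite_grid: "finite (grid K)"
  by (simp add: grid_def)

text \<open>
  The numbers of pieces \<open>(K / n) powr \<alpha>\<close> sum up to at most \<open>K / (1 - \<alpha>)\<close>, up to rounding, which adds
  \<open>1\<close> for each \<open>n \<le> K\<close>.
\<close>

lemma card_grid_le:
  assumes "1 \<le> K"
  shows "real (card (grid K)) \<le> (2 / (1 - \<alpha>) + 4) * real K"
proof -
  let ?E = "Tooth ` {1..K} \<union> Backbone ` {1..K}"
  let ?A = "\<Union>e\<in>?E. (\<lambda>j. param G e (real j * (len G e / real (subdiv K (index e))))) ` {..<subdiv K (index e)}"
  have "card ?A \<le> (\<Sum>e\<in>?E. card ((\<lambda>j. param G e (real j * (len G e / real (subdiv K (index e))))) ` {..<subdiv K (index e)}))"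
    by (rule card_UN_le) simp
  also have "\<dots> \<le> (\<Sum>e\<in>?E. subdiv K (index e))"
    by (intro sum_mono order.trans[OF card_image_le]) auto
  also have "\<dots> = (\<Sum>e\<in>Tooth ` {1..K}. subdiv K (index e)) + (\<Sum>e\<in>Backbone ` {1..K}. subdiv K (index e))"
    by (rule sum.union_disjoint) auto
  also have "\<dots> = 2 * (\<Sum>n=1..K. subdiv K n)"
    by (simp add: sum.reindex inj_on_def)
  finally have A: "card ?A \<le> 2 * (\<Sum>n=1..K. subdiv K n)" .
  have "card (grid K) \<le> card ?A + card ((\<lambda>i. (foot (cell_rep K i), 0::real)) ` {..K})"
    unfolding grid_def by (rule card_Un_le)
  also have "\<dots> \<le> 2 * (\<Sum>n=1..K. subdiv K n) + card {..K}"
    using A card_image_le[of "{..K}" "\<lambda>i. (foot (cell_rep K i), 0::real)"] by simp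
  finally have card: "card (grid K) \<le> 2 * (\<Sum>n=1..K. subdiv K n) + (K + 1)" by simp
  have "real (\<Sum>n=1..K. subdiv K n) \<le> (\<Sum>n=1..K. real K powr \<alpha> * real n powr (-\<alpha>) + 1)"
    unfolding of_nat_sum
  proof (rule sum_mono)
    fix n assume "n \<in> {1..K}"
    have "real (subdiv K n) \<le> (real K / real n) powr \<alpha> + 1" by (simp add: subdiv_def)
    thus "real (subdiv K n) \<le> real K powr \<alpha> * real n powr (-\<alpha>) + 1"
      by (simp add: powr_divide powr_minus_divide)
  qed
  also have "\<dots> = real K powr \<alpha> * (\<Sum>n=1..K. real n powr (-\<alpha>)) + real K"
    by (simp add: sum.distrib sum_distrib_left)
  also have "\<dots> \<le> real K powr \<alpha> * (real K powr (1 - \<alpha>) / (1 - \<alpha>)) + real K"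
    using \<alpha>_pos \<alpha>_lt by (intro add_mono mult_left_mono sum_powr_le) auto
  also have "\<dots> = real K / (1 - \<alpha>) + real K"
    using assms by (simp add: powr_add[symmetric])
  finally have sum: "real (\<Sum>n=1..K. subdiv K n) \<le> real K / (1 - \<alpha>) + real K" .
  have "real (card (grid K)) \<le> real (2 * (\<Sum>n=1..K. subdiv K n) + (K + 1))"
    using card by (simp only: of_nat_le_iff)
  also have "\<dots> = 2 * real (\<Sum>n=1..K. subdiv K n) + (real K + 1)"
    by (simp only: of_nat_add of_nat_mult of_nat_numeral of_nat_1)
  also have "\<dots> \<le> 2 * (real K / (1 - \<alpha>) + real K) + (real K + real K)"
    using assms sum by (intro add_mono mult_left_mono) auto
  finally show ?thesis by (simp add: algebra_simps)
qed

text \<open>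
  The representative of the cell lies within \<open>K powr (-1 - \<alpha>)\<close> of the \<open>n\<close>-th foot.
\<close>

lemma far_foot_val_sq_le:
  assumes u: "u \<in> graph_H1 G" and K: "1 \<le> K" "K < n" and B: "\<And>p. p \<in> grid K \<Longrightarrow> (cmod (u p))\<^sup>2 \<le> B"
  shows "(cmod (foot_val u n))\<^sup>2 \<le> 2 * real K powr (-1 - \<alpha>) * energy.Q u + 2 * B"
proof -
  let ?S = "real K powr (1 + \<alpha>)"
  have S: "0 < ?S" using K by simp
  define r where "r = cell_rep K (cell K n)"
  have r: "K < r" "cell K r = cell K n"
    using someI[of "\<lambda>m. K < m \<and> cell K m = cell K n" n] K(2) by (auto simp: r_def cell_rep_def)
  have "foot n * ?S \<le> foot K * ?S" using foot_mono[of K n] K by (intro mult_right_mono) auto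
  also have "\<dots> = real K" using K by (simp add: foot_def powr_add[symmetric])
  finally have "cell K n \<le> K" by (simp add: cell_def le_nat_iff floor_le_iff nat_le_iff)
  hence "(foot r, 0) \<in> grid K" by (auto simp: grid_def r_def)
  hence fr: "(cmod (foot_val u r))\<^sup>2 \<le> B" using B by (simp add: foot_val_def)
  have "0 \<le> \<lfloor>foot m * ?S\<rfloor>" for m by simp
  hence "\<lfloor>foot r * ?S\<rfloor> = \<lfloor>foot n * ?S\<rfloor>" using r(2) unfolding cell_def by (metis eq_nat_nat_iff)
  hence "\<bar>foot n * ?S - foot r * ?S\<bar> \<le> 1"
    using floor_correct[of "foot n * ?S"] floor_correct[of "foot r * ?S"] by linarith
  hence "\<bar>foot n - foot r\<bar> * ?S \<le> 1" using S by (simp add: left_diff_distrib[symmetric] abs_mult)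
  hence "\<bar>foot n - foot r\<bar> \<le> 1 / ?S" using S by (simp add: field_simps)
  also have "1 / ?S = real K powr (-1 - \<alpha>)" by (simp add: powr_minus_divide[symmetric])
  finally have d: "\<bar>foot n - foot r\<bar> \<le> real K powr (-1 - \<alpha>)" .
  have "(cmod (foot_val u n - foot_val u r))\<^sup>2 \<le> \<bar>foot n - foot r\<bar> * energy.Q u"
    using K r by (intro foot_increment_energy u) auto
  also have "\<dots> \<le> real K powr (-1 - \<alpha>) * energy.Q u" using d energy.nonneg[OF u] by (rule mult_right_mono)
  finally show ?thesis using cmod_sq_le[of "foot_val u n" "foot_val u r"] fr by linarith
qed

lemma edge_mass_le_grid:
  assumes u: "u \<in> graph_H1 G" and e: "e \<in> edges G" and J: "1 \<le> J"
    and B: "\<And>j. j < J \<Longrightarrow> (cmod (on_edge G e u (real j * (len G e / real J))))\<^sup>2 \<le> B"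
  shows "edge_mass u e \<le> 2 * len G e * B + 2 * (len G e / real J)\<^sup>2 * edge_energy u e"
  unfolding edge_mass_def edge_energy_def
  using H1_edge[OF u e] by (intro grid_L2_bound len_pos e J B)

text \<open>
  The part of the mass bound of an edge with index \<open>n\<close> that comes from the values of \<open>u\<close> at grid points
  and feet, for energy \<open>E\<close> and the bound \<open>B\<close> for the squared values on the grid. Up to \<open>K\<close> the grid
  subdivides the edges, up to \<open>K\<^sup>2\<close> it controls the feet, and beyond \<open>K\<^sup>2\<close> the decay of \<open>u\<close> towards the
  missing point of the backbone is enough.
\<close>

definition edge_weight :: "nat \<Rightarrow> real \<Rightarrow> real \<Rightarrow> nat \<Rightarrow> real" where
  "edge_weight K E B n = (if n \<le> K then 2 * B
    else if n \<le> K\<^sup>2 then 2 * foot n * (2 * real K powr (-1 - \<alpha>) * E + 2 * B)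
    else 2 * (foot n)\<^sup>2 * E)"

lemma edge_mass_le:
  assumes u: "u \<in> graph_H1 G" and K: "1 \<le> K" and B: "\<And>p. p \<in> grid K \<Longrightarrow> (cmod (u p))\<^sup>2 \<le> B"
    and B0: "0 \<le> B" and e: "e \<in> edges G"
  shows "edge_mass u e \<le> edge_weight K (energy.Q u) B (index e) + 2 * real K powr (2 - 4 * \<alpha>) * edge_energy u e"
proof -
  let ?l = "len G e" and ?n = "index e" and ?E = "energy.Q u"
  note n = index_ge[OF e] and l = len_pos[OF e] and lf = len_le_foot[OF e]
  have l1: "?l \<le> 1" using lf foot_le_1[OF n] by linarith
  have pw: "(real K powr (-\<alpha>))\<^sup>2 \<le> real K powr (2 - 4 * \<alpha>)"
  proof -
    have "(real K powr (-\<alpha>))\<^sup>2 = real K powr (-2 * \<alpha>)" by (simp add: power2_eq_square powr_add[symmetric])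
    also have "\<dots> \<le> real K powr (2 - 4 * \<alpha>)" using K \<alpha>_lt by (intro powr_mono) auto
    finally show ?thesis .
  qed
  have energy_part: "2 * x\<^sup>2 * edge_energy u e \<le> 2 * real K powr (2 - 4 * \<alpha>) * edge_energy u e"
    if "0 \<le> x" "x \<le> real K powr (-\<alpha>)" for x
    using order.trans[OF power_mono[OF that(2,1), of 2] pw] by (intro mult_right_mono) auto
  show ?thesis
  proof (cases "?n \<le> K")
    case True
    define J where "J = subdiv K ?n"
    have "0 < (real K / real ?n) powr \<alpha>" using n K by simp
    hence "(real K / real ?n) powr \<alpha> \<le> real J" "1 \<le> J"
      unfolding J_def subdiv_def by (auto simp: Suc_le_eq)
    hence J: "real K powr \<alpha> * foot ?n \<le> real J" "1 \<le> J"
      by (simp_all add: powr_divide powr_minus_divide foot_def)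
    have "?l / real J \<le> real K powr (-\<alpha>)"
    proof -
      have "?l \<le> real K powr (-\<alpha>) * (real K powr \<alpha> * foot ?n)"
        using lf K by (simp add: mult.assoc[symmetric] powr_add[symmetric])
      also have "\<dots> \<le> real K powr (-\<alpha>) * real J" using J(1) by (intro mult_left_mono) auto
      finally show ?thesis using J(2) by (simp add: field_simps)
    qed
    moreover have "0 \<le> ?l / real J" using l by simp
    moreover have "edge_mass u e \<le> 2 * ?l * B + 2 * (?l / real J)\<^sup>2 * edge_energy u e"
    proof (rule edge_mass_le_grid[OF u e J(2)])
      fix j assume j: "j < J"
      have "e \<in> Tooth ` {1..K} \<union> Backbone ` {1..K}" using e True by (cases e) auto
      hence "param G e (real j * (?l / real J)) \<in> grid K" using j unfolding grid_def J_def by blast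
      thus "(cmod (on_edge G e u (real j * (?l / real J))))\<^sup>2 \<le> B" unfolding on_edge_def by (rule B)
    qed
    moreover have "2 * ?l * B \<le> 2 * B" using l1 B0 by (simp add: mult_left_le_one_le l less_imp_le)
    ultimately show ?thesis using energy_part[of "?l / real J"] True by (simp add: edge_weight_def)
  next
    case False
    \<comment> \<open>The edge starts at its own foot if it is a tooth, and at the next one if it is a backbone edge.\<close>
    have "\<exists>m. ?n \<le> m \<and> on_edge G e u 0 = foot_val u m"
    proof (cases e)
      case (Tooth k)
      thus ?thesis by (intro exI[of _ k]) (simp add: on_edge_feet)
    next
      case (Backbone k)
      thus ?thesis by (intro exI[of _ "Suc k"]) (simp add: on_edge_feet)
    qed
    then obtain m where m: "?n \<le> m" "on_edge G e u 0 = foot_val u m" by blast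
    define b where "b = (if ?n \<le> K\<^sup>2 then 2 * real K powr (-1 - \<alpha>) * ?E + 2 * B else foot ?n * ?E)"
    have b: "(cmod (on_edge G e u 0))\<^sup>2 \<le> b"
    proof (cases "?n \<le> K\<^sup>2")
      case True
      thus ?thesis using far_foot_val_sq_le[OF u K _ B, of m] m False by (simp add: b_def)
    next
      case big: False
      have "(cmod (foot_val u m))\<^sup>2 \<le> foot m * ?E" using m n by (intro foot_val_sq_le u) auto
      also have "\<dots> \<le> foot ?n * ?E" using foot_mono[OF n m(1)] energy.nonneg[OF u] by (rule mult_right_mono)
      finally show ?thesis using big m by (simp add: b_def)
    qed
    have b0: "0 \<le> b" using b zero_le_power2[of "cmod (on_edge G e u 0)"] by linarith
    have "foot ?n \<le> foot K" using False K by (intro foot_mono) auto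
    hence lK: "?l \<le> real K powr (-\<alpha>)" using lf unfolding foot_def by linarith
    have "edge_mass u e \<le> 2 * ?l * b + 2 * ?l\<^sup>2 * edge_energy u e"
      using edge_mass_le_grid[OF u e, of 1 b] b by simp
    also have "\<dots> \<le> 2 * foot ?n * b + 2 * real K powr (2 - 4 * \<alpha>) * edge_energy u e"
      using lf b0 l lK by (intro add_mono energy_part mult_right_mono) auto
    also have "2 * foot ?n * b = edge_weight K ?E B ?n"
      using False by (simp add: edge_weight_def b_def power2_eq_square)
    finally show ?thesis .
  qed
qed

text \<open>
  With \<open>K\<^sup>2\<close> as the threshold, the tail of the sum of \<open>n powr (-2 \<alpha>)\<close> is of the order
  \<open>K powr (2 - 4 \<alpha>)\<close>; the middle range contributes \<open>K powr (1 - 3 \<alpha>)\<close>, which is smaller because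
  \<open>\<alpha> < 1\<close>.
\<close>

lemma sum_edge_weight_le:
  assumes K: "1 \<le> K" and E: "0 \<le> E" and B: "0 \<le> B" and N: "K\<^sup>2 \<le> N"
  shows "(\<Sum>n=1..N. edge_weight K E B n) \<le> (4 / (1 - \<alpha>) + 2 / (2 * \<alpha> - 1)) * real K powr (2 - 4 * \<alpha>) * E
    + (2 * real K + 4 * real K powr (2 - 2 * \<alpha>) / (1 - \<alpha>)) * B"
proof -
  have K2: "K \<le> K\<^sup>2" using K by (simp add: power2_eq_square)
  have pw: "(real K)\<^sup>2 powr s = real K powr (2 * s)" for s
    using K powr_powr[of "real K" 2 s] by simp
  let ?b = "2 * real K powr (-1 - \<alpha>) * E + 2 * B"
  have b: "0 \<le> ?b" using E B by simp
  have "{1..N} = {1..K} \<union> ({K<..K\<^sup>2} \<union> {K\<^sup>2<..N})" using K2 N K by auto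
  hence "(\<Sum>n=1..N. edge_weight K E B n) = (\<Sum>n\<in>{1..K}. edge_weight K E B n) +
      (\<Sum>n\<in>{K<..K\<^sup>2} \<union> {K\<^sup>2<..N}. edge_weight K E B n)"
    using K2 by (simp only:) (intro sum.union_disjoint, auto)
  also have "(\<Sum>n\<in>{K<..K\<^sup>2} \<union> {K\<^sup>2<..N}. edge_weight K E B n) =
      (\<Sum>n\<in>{K<..K\<^sup>2}. edge_weight K E B n) + (\<Sum>n\<in>{K\<^sup>2<..N}. edge_weight K E B n)"
    by (intro sum.union_disjoint) auto
  also have "(\<Sum>n\<in>{1..K}. edge_weight K E B n) = 2 * real K * B" by (simp add: edge_weight_def)
  also have "(\<Sum>n\<in>{K<..K\<^sup>2}. edge_weight K E B n) = 2 * ?b * (\<Sum>n\<in>{K<..K\<^sup>2}. foot n)"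
    unfolding sum_distrib_left by (intro sum.cong) (auto simp: edge_weight_def)
  also have "(\<Sum>n\<in>{K<..K\<^sup>2}. foot n) \<le> (\<Sum>n=1..K\<^sup>2. foot n)" by (intro sum_mono2) auto
  also have "\<dots> \<le> real (K\<^sup>2) powr (1 - \<alpha>) / (1 - \<alpha>)"
    unfolding foot_def using \<alpha>_pos \<alpha>_lt by (rule sum_powr_le)
  also have "real (K\<^sup>2) powr (1 - \<alpha>) = real K powr (2 - 2 * \<alpha>)" using pw[of "1 - \<alpha>"] by (simp add: algebra_simps)
  also have "(\<Sum>n\<in>{K\<^sup>2<..N}. edge_weight K E B n) = 2 * E * (\<Sum>n\<in>{K\<^sup>2<..N}. real n powr (-(2 * \<alpha>)))"
    unfolding sum_distrib_left
  proof (rule sum.cong[OF HOL.refl])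
    fix n assume "n \<in> {K\<^sup>2<..N}"
    hence "edge_weight K E B n = 2 * (foot n)\<^sup>2 * E" using K2 by (simp add: edge_weight_def)
    also have "(foot n)\<^sup>2 = real n powr (-(2 * \<alpha>))"
      by (simp add: foot_def power2_eq_square powr_add[symmetric])
    finally show "edge_weight K E B n = 2 * E * real n powr (-(2 * \<alpha>))" by (simp only: mult_ac)
  qed
  also have "(\<Sum>n\<in>{K\<^sup>2<..N}. real n powr (-(2 * \<alpha>))) \<le> real (K\<^sup>2) powr (1 - 2 * \<alpha>) / (2 * \<alpha> - 1)"
    using \<alpha>_gt K by (intro sum_powr_tail_le) auto
  also have "real (K\<^sup>2) powr (1 - 2 * \<alpha>) = real K powr (2 - 4 * \<alpha>)" using pw[of "1 - 2 * \<alpha>"] by (simp add: algebra_simps)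
  finally have "(\<Sum>n=1..N. edge_weight K E B n) \<le> 2 * real K * B + (2 * ?b * (real K powr (2 - 2 * \<alpha>) / (1 - \<alpha>)) +
      2 * E * (real K powr (2 - 4 * \<alpha>) / (2 * \<alpha> - 1)))"
    using b E by (simp add: mult_left_mono)
  also have "2 * ?b * (real K powr (2 - 2 * \<alpha>) / (1 - \<alpha>)) =
      4 / (1 - \<alpha>) * E * (real K powr (-1 - \<alpha>) * real K powr (2 - 2 * \<alpha>)) + 4 * real K powr (2 - 2 * \<alpha>) / (1 - \<alpha>) * B"
    by (simp add: algebra_simps add_divide_distrib)
  also have "real K powr (-1 - \<alpha>) * real K powr (2 - 2 * \<alpha>) = real K powr (1 - 3 * \<alpha>)"
    by (simp add: powr_add[symmetric])
  also have "4 / (1 - \<alpha>) * E * real K powr (1 - 3 * \<alpha>) \<le> 4 / (1 - \<alpha>) * E * real K powr (2 - 4 * \<alpha>)"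
    using K \<alpha>_lt E by (intro mult_left_mono powr_mono) auto
  finally show ?thesis by (simp add: algebra_simps)
qed

definition mass_const :: real where
  "mass_const = 8 / (1 - \<alpha>) + 4 / (2 * \<alpha> - 1) + 2"

definition grid_const :: "nat \<Rightarrow> real" where
  "grid_const K = 4 * real K + 8 * real K powr (2 - 2 * \<alpha>) / (1 - \<alpha>)"

text \<open>
  With \<open>B = 0\<close>, this bounds the Rayleigh quotient from below on the functions that vanish on the grid;
  with small \<open>B\<close>, it gives compactness.
\<close>

lemma mass_le_energy_grid:
  assumes u: "u \<in> graph_H1 G" and K: "1 \<le> K" and B: "\<And>p. p \<in> grid K \<Longrightarrow> (cmod (u p))\<^sup>2 \<le> B" and B0: "0 \<le> B"
  shows "mass.Q u \<le> mass_const * real K powr (2 - 4 * \<alpha>) * energy.Q u + grid_const K * B"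
  unfolding edge_mass_sum(2)[OF u]
proof (rule infsum_le_finite_sums[OF edge_mass_sum(1)[OF u]])
  fix F assume F: "finite F" "F \<subseteq> edges G"
  let ?E = "energy.Q u" and ?w = "edge_weight K (energy.Q u) B"
  note E0 = energy.nonneg[OF u]
  have w0: "0 \<le> ?w n" for n using E0 B0 by (simp add: edge_weight_def)
  obtain N0 where N0: "\<And>e. e \<in> F \<Longrightarrow> index e \<le> N0"
    using F(1) by (metis Max_ge finite_imageI imageI)
  define N where "N = max N0 (K\<^sup>2)"
  have sub: "F \<subseteq> Tooth ` {1..N} \<union> Backbone ` {1..N}"
  proof
    fix e assume "e \<in> F"
    hence "e \<in> edges G" "index e \<le> N" using F N0 by (auto simp: N_def le_max_iff_disj)
    thus "e \<in> Tooth ` {1..N} \<union> Backbone ` {1..N}" by (cases e) auto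
  qed
  have "(\<Sum>e\<in>F. ?w (index e)) \<le> (\<Sum>e\<in>Tooth ` {1..N} \<union> Backbone ` {1..N}. ?w (index e))"
    using sub w0 by (intro sum_mono2) auto
  also have "\<dots> = (\<Sum>e\<in>Tooth ` {1..N}. ?w (index e)) + (\<Sum>e\<in>Backbone ` {1..N}. ?w (index e))"
    by (rule sum.union_disjoint) auto
  also have "\<dots> = 2 * (\<Sum>n=1..N. ?w n)" by (simp add: sum.reindex inj_on_def)
  also have "\<dots> \<le> 2 * ((4 / (1 - \<alpha>) + 2 / (2 * \<alpha> - 1)) * real K powr (2 - 4 * \<alpha>) * ?E
    + (2 * real K + 4 * real K powr (2 - 2 * \<alpha>) / (1 - \<alpha>)) * B)"
    by (intro mult_left_mono sum_edge_weight_le K E0 B0) (auto simp: N_def)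
  finally have w: "(\<Sum>e\<in>F. ?w (index e)) \<le> 2 * ((4 / (1 - \<alpha>) + 2 / (2 * \<alpha> - 1)) * real K powr (2 - 4 * \<alpha>) * ?E
    + (2 * real K + 4 * real K powr (2 - 2 * \<alpha>) / (1 - \<alpha>)) * B)" .
  have "(\<Sum>e\<in>F. edge_mass u e) \<le> (\<Sum>e\<in>F. ?w (index e) + 2 * real K powr (2 - 4 * \<alpha>) * edge_energy u e)"
    using F by (intro sum_mono edge_mass_le u K B B0) auto
  also have "\<dots> = (\<Sum>e\<in>F. ?w (index e)) + 2 * real K powr (2 - 4 * \<alpha>) * (\<Sum>e\<in>F. edge_energy u e)"
    by (simp add: sum.distrib sum_distrib_left)
  also have "\<dots> \<le> 2 * ((4 / (1 - \<alpha>) + 2 / (2 * \<alpha> - 1)) * real K powr (2 - 4 * \<alpha>) * ?E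
    + (2 * real K + 4 * real K powr (2 - 2 * \<alpha>) / (1 - \<alpha>)) * B) + 2 * real K powr (2 - 4 * \<alpha>) * ?E"
    by (intro add_mono w mult_left_mono sum_edge_energy_le u F) auto
  also have "\<dots> = mass_const * real K powr (2 - 4 * \<alpha>) * ?E + grid_const K * B"
    unfolding mass_const_def grid_const_def by (simp add: algebra_simps)
  finally show "(\<Sum>e\<in>F. edge_mass u e) \<le> mass_const * real K powr (2 - 4 * \<alpha>) * ?E + grid_const K * B" .
qed

lemma grid_const_nonneg: "0 \<le> grid_const K"
  unfolding grid_const_def using \<alpha>_lt by simp

lemma mass_const_pos: "0 < mass_const"
  unfolding mass_const_def using \<alpha>_lt \<alpha>_gt by (intro add_nonneg_pos add_nonneg_nonneg) auto

definition coercivity_const :: real where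
  "coercivity_const = mass_const + 4 * grid_const 1"

text \<open>
  The squared values of \<open>u\<close> on the grid are themselves bounded by the energy, so one grid suffices for
  a bound without constraints.
\<close>

lemma mass_le_energy:
  assumes u: "u \<in> graph_H1 G"
  shows "mass.Q u \<le> coercivity_const * energy.Q u"
  using mass_le_energy_grid[OF u order.refl, of "4 * energy.Q u"] point_sq_le[OF u] energy.nonneg[OF u]
  by (simp add: coercivity_const_def algebra_simps)

section \<open>Discreteness of the spectrum and the eigenvalue bounds\<close>

text \<open>
  The energy controls the supremum.
\<close>

lemma energy_Cauchy_uniform_limit:
  fixes x :: "nat \<Rightarrow> real \<times> real \<Rightarrow> complex"
  assumes x: "\<And>n. x n \<in> graph_H1 G"
    and Cauchy: "\<And>\<epsilon>. \<epsilon> > 0 \<Longrightarrow> \<exists>N. \<forall>m\<ge>N. \<forall>n\<ge>N. energy.Q (x m - x n) < \<epsilon>"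
  shows "\<exists>u. uniform_limit UNIV x u sequentially"
proof -
  have d: "x m - x n \<in> graph_H1 G" for m n by (rule H1_diff(1)[OF x x])
  have "uniformly_Cauchy_on UNIV x"
    unfolding uniformly_Cauchy_on_def
  proof (intro allI impI)
    fix \<delta> :: real assume \<delta>: "0 < \<delta>"
    obtain N where N: "\<And>m n. m \<ge> N \<Longrightarrow> n \<ge> N \<Longrightarrow> energy.Q (x m - x n) < \<delta>\<^sup>2 / 4" using Cauchy[of "\<delta>\<^sup>2 / 4"] \<delta> by auto
    have "dist (x m p) (x n p) < \<delta>" if "m \<ge> N" "n \<ge> N" for m n p
    proof -
      have "(cmod (x m p - x n p))\<^sup>2 < \<delta>\<^sup>2" using point_sq_le[OF d, of m n p] N[OF that] by simp
      thus ?thesis using \<delta> by (simp add: dist_norm power_less_imp_less_base)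
    qed
    thus "\<exists>M. \<forall>p\<in>UNIV. \<forall>m\<ge>M. \<forall>n\<ge>M. dist (x m p) (x n p) < \<delta>" by blast
  qed
  thus ?thesis using Cauchy_uniformly_convergent unfolding uniformly_convergent_on_def by blast
qed

text \<open>
  The functions converge uniformly and their derivatives converge in \<open>L\<^sup>2\<close> of every edge. The limit has
  finite mass because the energy dominates the mass, so that the sequence is also Cauchy for the mass.
\<close>

lemma H1_complete:
  fixes x :: "nat \<Rightarrow> real \<times> real \<Rightarrow> complex"
  assumes x: "\<And>n. x n \<in> graph_H1 G"
    and Cauchy: "\<And>\<epsilon>. \<epsilon> > 0 \<Longrightarrow> \<exists>N. \<forall>m\<ge>N. \<forall>n\<ge>N. energy.Q (x m - x n) < \<epsilon>"
  shows "\<exists>u\<in>graph_H1 G. (\<lambda>n. energy.Q (x n - u)) \<longlonglongrightarrow> 0"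
proof -
  have d: "x m - x n \<in> graph_H1 G" for m n by (rule H1_diff(1)[OF x x])
  obtain u where lim: "uniform_limit UNIV x u sequentially"
    using energy_Cauchy_uniform_limit[OF x Cauchy] by blast
  have unif: "\<forall>\<^sub>F n in sequentially. \<forall>p. cmod (x n p - u p) < \<delta>" if "0 < \<delta>" for \<delta>
    using uniform_limitD[OF lim that] by (simp add: dist_norm)
  have edge_unif: "uniform_limit {0..len G e} (\<lambda>n. on_edge G e (x n)) (on_edge G e u) sequentially" for e
  proof (rule uniform_limitI)
    fix \<delta> :: real assume "0 < \<delta>"
    from unif[OF this] show "\<forall>\<^sub>F n in sequentially. \<forall>s\<in>{0..len G e}. dist (on_edge G e (x n) s) (on_edge G e u s) < \<delta>"
      by eventually_elim (auto simp: on_edge_def dist_norm simp del: split_paired_All)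
  qed
  have zero: "u p = 0" if p: "p \<notin> points G" for p
  proof -
    have "(\<lambda>n. x n p) \<longlonglongrightarrow> u p" using lim by (rule tendsto_uniform_limitI) simp
    moreover have "x n p = 0" for n using x[of n] p unfolding graph_H1_def by blast
    ultimately show ?thesis by (simp add: LIMSEQ_const_iff)
  qed
  have cont: "continuous_map (graph_topology G) euclidean u"
  proof -
    have "continuous_map (graph_topology G) (Met_TC.mtopology :: complex topology) u"
    proof (rule Met_TC.continuous_map_uniform_limit)
      show "\<forall>\<^sub>F n in sequentially. continuous_map (graph_topology G) (Met_TC.mtopology :: complex topology) (x n)"
        using x by (simp add: graph_H1_def mtopology_is_euclidean)
      show "\<forall>\<^sub>F n in sequentially. \<forall>p\<in>topspace (graph_topology G). u p \<in> UNIV \<and> dist (x n p) (u p) < \<epsilon>" if "0 < \<epsilon>" for \<epsilon>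
        using unif[OF that] by eventually_elim (simp add: dist_norm del: split_paired_All)
    qed simp
    thus ?thesis by (simp add: mtopology_is_euclidean)
  qed
  have ucont: "continuous_on {0..len G e} (on_edge G e u)" if "e \<in> edges G" for e
    by (rule continuous_on_edge[OF cont that])
  have mass_lim: "(\<lambda>n. sq_int (len G e) (\<lambda>s. on_edge G e (x n) s - on_edge G e u s)) \<longlonglongrightarrow> 0" if e: "e \<in> edges G" for e
    by (intro sq_int_diff_tendsto_0 less_imp_le[OF len_pos[OF e]] H1_edge(1)[OF x e] edge_unif)
  have mass_fam: "L2_family (edges G) (len G) (\<lambda>e. on_edge G e u)"
  proof (rule L2_family_limit(1)[where D = "\<lambda>n e. on_edge G e (x n)"])
    show "L2_family (edges G) (len G) (\<lambda>e. on_edge G e (x n))" for n by (rule H1_families(1)[OF x])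
    show "L2_on (len G e) (on_edge G e u)" if "e \<in> edges G" for e by (rule L2_on_cont[OF ucont[OF that]])
    fix \<epsilon> :: real assume \<epsilon>: "0 < \<epsilon>"
    have C: "0 < coercivity_const"
      unfolding coercivity_const_def using mass_const_pos grid_const_nonneg[of 1] by simp
    obtain N where N: "\<And>m n. m \<ge> N \<Longrightarrow> n \<ge> N \<Longrightarrow> energy.Q (x m - x n) < \<epsilon> / coercivity_const"
      using Cauchy[of "\<epsilon> / coercivity_const"] \<epsilon> C by auto
    have "(\<Sum>\<^sub>\<infinity>e\<in>edges G. sq_int (len G e) (\<lambda>s. on_edge G e (x m) s - on_edge G e (x n) s)) < \<epsilon>"
      if "m \<ge> N" "n \<ge> N" for m n
    proof -
      have "(\<Sum>\<^sub>\<infinity>e\<in>edges G. sq_int (len G e) (\<lambda>s. on_edge G e (x m) s - on_edge G e (x n) s)) = mass.Q (x m - x n)"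
        by (simp add: mass_self[OF d] on_edge_arith)
      also have "\<dots> \<le> coercivity_const * energy.Q (x m - x n)" by (rule mass_le_energy[OF d])
      also have "\<dots> < \<epsilon>" using N[OF that] C by (simp add: field_simps)
      finally show ?thesis .
    qed
    thus "\<exists>N. \<forall>m\<ge>N. \<forall>n\<ge>N. (\<Sum>\<^sub>\<infinity>e\<in>edges G. sq_int (len G e) (\<lambda>s. on_edge G e (x m) s - on_edge G e (x n) s)) < \<epsilon>"
      by blast
  qed (rule mass_lim)
  have deriv_diff: "sq_int (len G e) (\<lambda>s. edge_deriv G (x m) e s - edge_deriv G (x n) e s) = edge_energy (x m - x n) e"
    if e: "e \<in> edges G" for e m n
    unfolding edge_energy_def
  proof (rule sq_int_AE_cong)
    show "AE s in Leb (len G e). edge_deriv G (x m) e s - edge_deriv G (x n) e s = edge_deriv G (x m - x n) e s"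
      using H1_diff(2)[OF x[of m] x[of n] e] by eventually_elim simp
  qed (intro L2_on_diff H1_edge x d e)+
  have "\<exists>g. L2_on (len G e) g \<and> (\<lambda>n. sq_int (len G e) (\<lambda>s. edge_deriv G (x n) e s - g s)) \<longlonglongrightarrow> 0"
    if e: "e \<in> edges G" for e
  proof -
    have Ce: "\<exists>N. \<forall>m\<ge>N. \<forall>n\<ge>N. sq_int (len G e) (\<lambda>s. edge_deriv G (x m) e s - edge_deriv G (x n) e s) < \<epsilon>" if "0 < \<epsilon>" for \<epsilon>
      using Cauchy[OF that] edge_energy_le[OF d e] unfolding deriv_diff[OF e] by (meson le_less_trans)
    show ?thesis
      using L2_complete[of "len G e" "\<lambda>n. edge_deriv G (x n) e", OF less_imp_le[OF len_pos[OF e]] H1_edge(3)[OF x e] Ce]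
      by blast
  qed
  hence "\<forall>e\<in>edges G. \<exists>g. L2_on (len G e) g \<and>
      (\<lambda>n. sq_int (len G e) (\<lambda>s. edge_deriv G (x n) e s - g s)) \<longlonglongrightarrow> 0" ..
  from bchoice[OF this] obtain g where "\<forall>e\<in>edges G. L2_on (len G e) (g e) \<and>
      (\<lambda>n. sq_int (len G e) (\<lambda>s. edge_deriv G (x n) e s - g e s)) \<longlonglongrightarrow> 0" ..
  hence g: "L2_on (len G e) (g e)"
    and g_lim: "(\<lambda>n. sq_int (len G e) (\<lambda>s. edge_deriv G (x n) e s - g e s)) \<longlonglongrightarrow> 0"
    if "e \<in> edges G" for e using that by simp_all
  have "\<exists>N. \<forall>m\<ge>N. \<forall>n\<ge>N. (\<Sum>\<^sub>\<infinity>e\<in>edges G. sq_int (len G e) (\<lambda>s. edge_deriv G (x m) e s - edge_deriv G (x n) e s)) < \<epsilon>"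
    if "0 < \<epsilon>" for \<epsilon>
  proof -
    have "(\<Sum>\<^sub>\<infinity>e\<in>edges G. sq_int (len G e) (\<lambda>s. edge_deriv G (x m) e s - edge_deriv G (x n) e s)) = energy.Q (x m - x n)" for m n
      unfolding edge_energy_sum(2)[OF d] by (intro infsum_cong deriv_diff)
    thus ?thesis using Cauchy[OF that] by simp
  qed
  note fam = L2_family_limit[OF H1_families(2)[OF x] g g_lim this]
  have wd: "is_weak_deriv (len G e) (on_edge G e u) (g e)" if e: "e \<in> edges G" for e
    using H1_edge[OF x e] by (intro is_weak_deriv_limit[OF _ _ _ g[OF e] _ edge_unif g_lim[OF e]])
      (auto simp: len_pos[OF e] less_imp_le)
  have u: "u \<in> graph_H1 G" using zero cont mass_fam fam(1) wd by (rule graph_H1I)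
  have "energy.Q (x n - u) = (\<Sum>\<^sub>\<infinity>e\<in>edges G. sq_int (len G e) (\<lambda>s. edge_deriv G (x n) e s - g e s))" for n
  proof -
    have "energy.Q (x n - u) = infsum (edge_energy (x n - u)) (edges G)"
      by (rule edge_energy_sum(2)[OF H1_diff(1)[OF x u]])
    also have "\<dots> = (\<Sum>\<^sub>\<infinity>e\<in>edges G. sq_int (len G e) (\<lambda>s. edge_deriv G (x n) e s - g e s))"
      unfolding edge_energy_def[abs_def]
    proof (rule infsum_cong, rule sq_int_AE_cong)
      fix e assume e: "e \<in> edges G"
      show "AE s in Leb (len G e). edge_deriv G (x n - u) e s = edge_deriv G (x n) e s - g e s"
        using H1_diff(2)[OF x[of n] u e] edge_deriv_unique[OF u e g[OF e] wd[OF e]] by eventually_elim simp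
      show "L2_on (len G e) (edge_deriv G (x n - u) e)" by (intro H1_edge H1_diff x u e)
      show "L2_on (len G e) (\<lambda>s. edge_deriv G (x n) e s - g e s)" by (intro L2_on_diff H1_edge x g e)
    qed
    finally show ?thesis .
  qed
  hence "(\<lambda>n. energy.Q (x n - u)) \<longlonglongrightarrow> 0" using fam(2) by simp
  thus ?thesis using u by (rule bexI)
qed

text \<open>
  A diagonal subsequence converges at all points of all grids. For a given accuracy, \<open>K\<close> is taken so
  large that the energy term in the grid inequality is small; the grid term for this \<open>K\<close> is then small
  for late members of the subsequence.
\<close>

lemma H1_compact:
  fixes x :: "nat \<Rightarrow> real \<times> real \<Rightarrow> complex"
  assumes x: "\<And>n. x n \<in> graph_H1 G" and M: "\<And>n. energy.Q (x n) \<le> M"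
  shows "\<exists>r::nat \<Rightarrow> nat. strict_mono r \<and> (\<forall>\<epsilon>>0. \<exists>N. \<forall>m\<ge>N. \<forall>n\<ge>N. mass.Q (x (r m) - x (r n)) < \<epsilon>)"
proof -
  have M0: "0 \<le> M" using order.trans[OF energy.nonneg[OF x] M[of 0]] .
  let ?S = "\<Union>K. grid K"
  obtain r :: "nat \<Rightarrow> nat" where r: "strict_mono r" and conv: "\<And>p. p \<in> ?S \<Longrightarrow> \<exists>l. (\<lambda>n. x (r n) p) \<longlonglongrightarrow> l"
  proof (rule function_convergent_subsequence[of ?S x "sqrt (4 * M)"])
    show "countable ?S" by (intro countable_UN) (auto intro: countable_finite finite_grid)
    show "norm (x n p) \<le> sqrt (4 * M)" for n p
      using point_sq_le[OF x, of n p] M[of n] by (intro real_le_rsqrt) linarith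
  qed (rule that)
  have "\<exists>N. \<forall>m\<ge>N. \<forall>n\<ge>N. mass.Q (x (r m) - x (r n)) < \<epsilon>" if \<epsilon>: "0 < \<epsilon>" for \<epsilon>
  proof -
    have "(\<lambda>K. mass_const * real K powr (2 - 4 * \<alpha>) * (4 * M)) \<longlonglongrightarrow> mass_const * 0 * (4 * M)"
      using \<alpha>_gt by (intro tendsto_intros tendsto_neg_powr filterlim_real_sequentially) auto
    hence "\<forall>\<^sub>F K in sequentially. mass_const * real K powr (2 - 4 * \<alpha>) * (4 * M) < \<epsilon> / 2"
      using \<epsilon> by (intro order_tendstoD) auto
    then obtain K where K: "1 \<le> K" "mass_const * real K powr (2 - 4 * \<alpha>) * (4 * M) < \<epsilon> / 2"
      using eventually_happens'[OF _ eventually_conj[OF eventually_ge_at_top[of 1]]] by fastforce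
    define B where "B = \<epsilon> / (2 * (grid_const K + 1))"
    have g0: "0 \<le> grid_const K" by (rule grid_const_nonneg)
    have B: "0 < B" using \<epsilon> g0 by (simp add: B_def)
    have "grid_const K * B \<le> (grid_const K + 1) * B" using B by (intro mult_right_mono) auto
    also have "\<dots> = \<epsilon> / 2" using g0 by (simp add: B_def add_pos_nonneg field_simps)
    finally have gB: "grid_const K * B \<le> \<epsilon> / 2" .
    have "\<exists>N. \<forall>m\<ge>N. \<forall>n\<ge>N. (cmod (x (r m) p - x (r n) p))\<^sup>2 \<le> B" if p: "p \<in> grid K" for p
    proof -
      have "Cauchy (\<lambda>n. x (r n) p)" using conv[of p] p by (auto intro: LIMSEQ_imp_Cauchy)
      then obtain N where N: "\<And>m n. m \<ge> N \<Longrightarrow> n \<ge> N \<Longrightarrow> dist (x (r m) p) (x (r n) p) < sqrt B"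
        using B metric_CauchyD[of "\<lambda>n. x (r n) p" "sqrt B"] by (metis real_sqrt_gt_0_iff)
      have "(cmod (x (r m) p - x (r n) p))\<^sup>2 \<le> B" if "m \<ge> N" "n \<ge> N" for m n
        using N[OF that] B power_mono[of "cmod (x (r m) p - x (r n) p)" "sqrt B" 2]
        by (simp add: dist_norm less_imp_le)
      thus ?thesis by blast
    qed
    then obtain N where N: "\<And>p m n. p \<in> grid K \<Longrightarrow> m \<ge> N p \<Longrightarrow> n \<ge> N p \<Longrightarrow> (cmod (x (r m) p - x (r n) p))\<^sup>2 \<le> B"
      by metis
    define N' where "N' = Max (insert 0 (N ` grid K))"
    have N_le: "N p \<le> N'" if "p \<in> grid K" for p unfolding N'_def using that finite_grid by (intro Max_ge) auto
    have Nmax: "(cmod ((x (r m) - x (r n)) p))\<^sup>2 \<le> B" if "p \<in> grid K" "m \<ge> N'" "n \<ge> N'" for p m n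
      using N[OF that(1) order.trans[OF N_le[OF that(1)] that(2)] order.trans[OF N_le[OF that(1)] that(3)]] by simp
    have "mass.Q (x (r m) - x (r n)) < \<epsilon>" if mn: "m \<ge> N'" "n \<ge> N'" for m n
    proof -
      have E: "energy.Q (x (r m) - x (r n)) \<le> 4 * M"
        using energy.parallelogram[OF x x, of "r m" "r n"] energy.nonneg[OF H1_add(1)[OF x x], of "r m" "r n"]
          M[of "r m"] M[of "r n"] by linarith
      have "mass.Q (x (r m) - x (r n)) \<le> mass_const * real K powr (2 - 4 * \<alpha>) * energy.Q (x (r m) - x (r n)) + grid_const K * B"
        using Nmax mn B by (intro mass_le_energy_grid H1_diff x K) auto
      also have "\<dots> \<le> mass_const * real K powr (2 - 4 * \<alpha>) * (4 * M) + grid_const K * B"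
        using E mass_const_pos by (intro add_right_mono mult_left_mono) auto
      also have "\<dots> < \<epsilon>" using K(2) gB by linarith
      finally show ?thesis .
    qed
    thus ?thesis by blast
  qed
  with r show ?thesis by blast
qed

text \<open>
  The height on the \<open>n\<close>-th tooth, which vanishes at its foot, continued by \<open>0\<close>.
\<close>

definition tooth_fun :: "nat \<Rightarrow> real \<times> real \<Rightarrow> complex" where
  "tooth_fun n p = (if p \<in> points G \<and> fst p = foot n then complex_of_real (snd p) else 0)"

lemma foot_inj: "1 \<le> m \<Longrightarrow> 1 \<le> n \<Longrightarrow> foot m = foot n \<Longrightarrow> m = n"
  using foot_less[OF \<alpha>_pos, of m n] foot_less[OF \<alpha>_pos, of n m] unfolding foot_def
  by (cases m n rule: linorder_cases) auto

lemma tooth_fun_on_edge: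
  assumes n: "1 \<le> n" and e: "e \<in> edges G" and s: "s \<in> {0..len G e}"
  shows "on_edge G e (tooth_fun n) s = (if e = Tooth n then complex_of_real s else 0)"
proof -
  have p: "param G e s \<in> points G" using e s by (rule param_in_points)
  show ?thesis
  proof (cases e)
    case (Tooth m)
    have "foot m = foot n \<longleftrightarrow> m = n" using foot_inj[of m n] n e Tooth by auto
    thus ?thesis using p Tooth by (simp add: on_edge_def tooth_fun_def diagonal_comb_simps foot_def)
  next
    case (Backbone m)
    thus ?thesis by (simp add: on_edge_def tooth_fun_def diagonal_comb_simps)
  qed
qed

text \<open>
  Along each step of a walk the function changes at most by the length of the step; hence it is
  continuous for the shortest-path metric.
\<close>

lemma tooth_fun_Lipschitz:
  assumes n: "1 \<le> n" and w: "walk G p r q"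
  shows "cmod (tooth_fun n p - tooth_fun n q) \<le> r"
  using w
proof (induction rule: walk.induct)
  case refl
  show ?case by simp
next
  case (step r e s t)
  have "cmod (tooth_fun n (param G e s) - tooth_fun n (param G e t)) \<le> \<bar>s - t\<bar>"
    using tooth_fun_on_edge[OF n step.hyps(2,3)] tooth_fun_on_edge[OF n step.hyps(2,4)]
    by (simp add: on_edge_def norm_of_real flip: of_real_diff)
  thus ?case using step.IH norm_triangle_ineq[of "tooth_fun n p - tooth_fun n (param G e s)"
      "tooth_fun n (param G e s) - tooth_fun n (param G e t)"] by simp
qed

lemma tooth_fun_continuous:
  assumes n: "1 \<le> n"
  shows "continuous_map (graph_topology G) euclidean (tooth_fun n)"
  unfolding graph_topology_def PM.continuous_map_from_metric
proof (intro conjI ballI allI impI)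
  fix p and U :: "complex set" assume p: "p \<in> points G" and U: "openin euclidean U \<and> tooth_fun n p \<in> U"
  then obtain \<epsilon> where \<epsilon>: "0 < \<epsilon>" "ball (tooth_fun n p) \<epsilon> \<subseteq> U" by (auto simp: open_contains_ball)
  have "tooth_fun n q \<in> U" if q: "q \<in> points G" "path_dist G p q < \<epsilon>" for q
  proof -
    obtain r0 where "walk G p r0 q" using diagonal_comb_connected[OF \<alpha>_pos p q(1)] by blast
    hence "cmod (tooth_fun n p - tooth_fun n q) \<le> path_dist G p q"
      using tooth_fun_Lipschitz[OF n] by (intro path_dist_ge[OF p q(1)])
    thus ?thesis using q \<epsilon> by (auto simp: dist_norm)
  qed
  thus "\<exists>r>0. \<forall>q. q \<in> points G \<and> path_dist G p q < r \<longrightarrow> tooth_fun n q \<in> U" using \<epsilon>(1) by blast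
qed simp

definition tooth_deriv :: "nat \<Rightarrow> comb_edge \<Rightarrow> real \<Rightarrow> complex" where
  "tooth_deriv n e s = (if e = Tooth n then 1 else 0)"

lemma infsum_single_nonzero:
  assumes "a \<in> E" "\<And>e. e \<in> E \<Longrightarrow> e \<noteq> a \<Longrightarrow> g e = (0 :: complex)"
  shows "infsum g E = g a"
proof -
  have "infsum g E = infsum g {a}" by (rule infsum_cong_neutral) (use assms in auto)
  thus ?thesis by simp
qed

lemma summable_on_single: "(\<lambda>e. if e = a then c else 0 :: real) summable_on E"
proof -
  have "(\<lambda>e. if e = a then c else 0) summable_on (E \<inter> {a})" by (rule summable_on_finite) simp
  thus ?thesis by (rule summable_on_cong_neutral[THEN iffD1, rotated -1]) auto
qed

lemma tooth_fun_H1: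
  assumes n: "1 \<le> n"
  shows "tooth_fun n \<in> graph_H1 G"
    "\<And>e. e \<in> edges G \<Longrightarrow> AE s in Leb (len G e). edge_deriv G (tooth_fun n) e s = tooth_deriv n e s"
    "L2_family (edges G) (len G) (tooth_deriv n)"
proof -
  have zero: "tooth_fun n p = 0" if "p \<notin> points G" for p using that by (simp add: tooth_fun_def)
  show f2: "L2_family (edges G) (len G) (tooth_deriv n)"
  proof (rule L2_familyI[OF _ summable_on_single[of "Tooth n" "foot n"]])
    show "L2_on (len G e) (tooth_deriv n e)" for e by (rule L2_on_cont) (simp add: tooth_deriv_def[abs_def])
    show "sq_int (len G e) (tooth_deriv n e) \<le> (if e = Tooth n then foot n else 0)" for e
      using integral_Leb_const[of "foot n" 1] by (simp add: tooth_deriv_def len_simps)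
  qed
  have edge_cont: "continuous_on {0..len G e} (on_edge G e (tooth_fun n))" if "e \<in> edges G" for e
    by (rule continuous_on_edge[OF tooth_fun_continuous[OF n] that])
  have f1: "L2_family (edges G) (len G) (\<lambda>e. on_edge G e (tooth_fun n))"
  proof (rule L2_familyI[OF _ summable_on_single[of "Tooth n" "sq_int (foot n) (on_edge G (Tooth n) (tooth_fun n))"]])
    fix e assume e: "e \<in> edges G"
    show "L2_on (len G e) (on_edge G e (tooth_fun n))" by (rule L2_on_cont[OF edge_cont[OF e]])
    have "sq_int (len G e) (on_edge G e (tooth_fun n)) = 0" if "e \<noteq> Tooth n"
    proof -
      have "sq_int (len G e) (on_edge G e (tooth_fun n)) = (LINT s|Leb (len G e). 0)"
        using tooth_fun_on_edge[OF n e] that by (intro Bochner_Integration.integral_cong) auto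
      thus ?thesis by simp
    qed
    thus "sq_int (len G e) (on_edge G e (tooth_fun n)) \<le>
        (if e = Tooth n then sq_int (foot n) (on_edge G (Tooth n) (tooth_fun n)) else 0)"
      by (auto simp: len_simps)
  qed
  have wd: "is_weak_deriv (len G e) (on_edge G e (tooth_fun n)) (tooth_deriv n e)" if e: "e \<in> edges G" for e
  proof -
    let ?f = "\<lambda>s. if e = Tooth n then complex_of_real s else 0"
    have "((\<lambda>s. complex_of_real s) has_vector_derivative 1) (at s)" for s
      using has_vector_derivative_of_real[OF DERIV_ident] by simp
    hence "is_weak_deriv (len G e) ?f (tooth_deriv n e)"
      by (intro is_weak_deriv_classical len_pos e) (auto simp: tooth_deriv_def[abs_def])
    moreover have "(LINT s|Leb (len G e). complex_of_real (\<phi> s) * on_edge G e (tooth_fun n) s) =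
        (LINT s|Leb (len G e). complex_of_real (\<phi> s) * ?f s)" for \<phi>
      by (rule Bochner_Integration.integral_cong) (simp_all add: tooth_fun_on_edge[OF n e])
    ultimately show ?thesis by (simp only: is_weak_deriv_def)
  qed
  show u: "tooth_fun n \<in> graph_H1 G" using zero tooth_fun_continuous[OF n] f1 f2 wd by (rule graph_H1I)
  show "AE s in Leb (len G e). edge_deriv G (tooth_fun n) e s = tooth_deriv n e s" if e: "e \<in> edges G" for e
    by (rule edge_deriv_unique[OF u e L2_familyD(1)[OF f2 e] wd[OF e]])
qed

lemma energy_tooth_fun:
  assumes "1 \<le> m" "1 \<le> n"
  shows "energy_form G (tooth_fun m) (tooth_fun n) = (if m = n then complex_of_real (foot n) else 0)"
proof -
  note m = tooth_fun_H1[OF assms(1)] and n = tooth_fun_H1[OF assms(2)]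
  have "energy_form G (tooth_fun m) (tooth_fun n) = family_inner (edges G) (len G) (tooth_deriv m) (edge_deriv G (tooth_fun n))"
    unfolding energy_form_eq by (intro family_inner_AE_cong m H1_families n(1))
  also have "\<dots> = cnj (family_inner (edges G) (len G) (edge_deriv G (tooth_fun n)) (tooth_deriv m))"
    by (rule family_inner_commute)
  also have "family_inner (edges G) (len G) (edge_deriv G (tooth_fun n)) (tooth_deriv m) = family_inner (edges G) (len G) (tooth_deriv n) (tooth_deriv m)"
    by (intro family_inner_AE_cong n H1_families m(3))
  also have "\<dots> = (if m = n then complex_of_real (foot n) else 0)"
  proof -
    have "family_inner (edges G) (len G) (tooth_deriv n) (tooth_deriv m) =
      (LINT x|Leb (len G (Tooth n)). tooth_deriv n (Tooth n) x * cnj (tooth_deriv m (Tooth n) x))"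
      unfolding family_inner_def using assms(2) by (intro infsum_single_nonzero) (auto simp: tooth_deriv_def)
    also have "\<dots> = (LINT x|Leb (foot n). complex_of_real (if m = n then 1 else 0))"
      unfolding len_simps by (rule Bochner_Integration.integral_cong) (auto simp: tooth_deriv_def)
    also have "\<dots> = complex_of_real (LINT x|Leb (foot n). (if m = n then 1 else 0))" by (rule integral_complex_of_real)
    also have "(LINT x|Leb (foot n). (if m = n then 1 else 0)) = (if m = n then 1 else 0) * foot n"
      by (rule integral_Leb_const) simp
    finally show ?thesis by simp
  qed
  finally show ?thesis by simp
qed

lemma mass_tooth_fun:
  assumes "1 \<le> m" "1 \<le> n"
  shows "graph_inner G (tooth_fun m) (tooth_fun n) = (if m = n then complex_of_real (foot n ^ 3 / 3) else 0)"
proof -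
  have "graph_inner G (tooth_fun m) (tooth_fun n) =
    (LINT x|Leb (len G (Tooth n)). on_edge G (Tooth n) (tooth_fun m) x * cnj (on_edge G (Tooth n) (tooth_fun n) x))"
    unfolding graph_inner_def
  proof (rule infsum_single_nonzero)
    fix e assume e: "e \<in> edges G" "e \<noteq> Tooth n"
    have "(LINT x|Leb (len G e). on_edge G e (tooth_fun m) x * cnj (on_edge G e (tooth_fun n) x)) = (LINT x|Leb (len G e). 0)"
      using e assms by (intro Bochner_Integration.integral_cong) (simp_all add: tooth_fun_on_edge)
    thus "(LINT x|Leb (len G e). on_edge G e (tooth_fun m) x * cnj (on_edge G e (tooth_fun n) x)) = 0" by simp
  qed (use assms in simp)
  also have "\<dots> = (LINT x|Leb (foot n). complex_of_real (if m = n then x\<^sup>2 else 0))"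
    using assms by (intro Bochner_Integration.integral_cong) (auto simp: len_simps tooth_fun_on_edge power2_eq_square)
  also have "\<dots> = complex_of_real (LINT x|Leb (foot n). (if m = n then x\<^sup>2 else 0))" by (rule integral_complex_of_real)
  also have "(LINT x|Leb (foot n). (if m = n then x\<^sup>2 else 0)) = (if m = n then foot n ^ 3 / 3 else 0)"
  proof -
    have "(LINT x|Leb (foot n). x\<^sup>2) = integral {0..foot n} (\<lambda>x. x\<^sup>2)"
      by (intro lebesgue_integral_eq_integral integrable_Leb_cont continuous_intros) auto
    also have "((\<lambda>x. x\<^sup>2) has_integral (foot n ^ 3 / 3 - 0 ^ 3 / 3)) {0..foot n}"
      by (intro fundamental_theorem_of_calculus)
        (auto intro!: derivative_eq_intros simp: has_real_derivative_iff_has_vector_derivative[symmetric])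
    hence "integral {0..foot n} (\<lambda>x. x\<^sup>2) = foot n ^ 3 / 3" by (simp add: integral_unique)
    finally show ?thesis by simp
  qed
  finally show ?thesis by simp
qed

lemma foot_pos: "1 \<le> n \<Longrightarrow> 0 < foot n"
  by (simp add: foot_def)

lemma H1_infinite_dim: "finite B \<Longrightarrow> \<not> graph_H1 G \<subseteq> cfun.span B"
proof
  assume B: "finite B" "graph_H1 G \<subseteq> cfun.span B"
  let ?I = "{1..card B + 1}"
  have ind: "inj_on tooth_fun ?I" "\<not> cfun.dependent (tooth_fun ` ?I)"
    by (rule mass.orthogonal_independent; simp add: tooth_fun_H1 mass_tooth_fun foot_pos)+
  have "tooth_fun ` ?I \<subseteq> cfun.span B" using B(2) tooth_fun_H1(1) by auto
  hence "card (tooth_fun ` ?I) \<le> card B" using cfun.independent_span_bound[OF B(1) ind(2)] by blast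
  thus False using card_image[OF ind(1)] by simp
qed

sublocale discrete_metric_graph G coercivity_const
proof (unfold_locales, goal_cases)
  case (1 u)
  thus ?case by (rule mass_le_energy)
next
  case (2 u)
  thus ?case by (rule mass_definite)
next
  case (3 x)
  thus ?case by (intro H1_complete) auto
next
  case (4 x M)
  thus ?case by (intro H1_compact) auto
next
  case (5 B)
  thus ?case by (rule H1_infinite_dim)
qed

text \<open>
  The functions on the teeth \<open>1\<close> to \<open>k\<close> are orthogonal for both forms, and the Rayleigh quotient of the
  one on tooth \<open>n\<close> is \<open>3 n powr (2 \<alpha>)\<close>.
\<close>

lemma eigenvalue_le:
  assumes k: "1 \<le> k"
  shows "eigenvalue (neumann_laplacian G) k \<le> 3 * real k powr (2 * \<alpha>)"
proof -
  obtain e where e: "Rayleigh_basis fscale (graph_H1 G) (energy_form G) (graph_inner G) coercivity_const e"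
    and ev: "\<forall>k. eigenvalue (neumann_laplacian G) k = Rayleigh_basis.lam (energy_form G) e (k - 1)"
    by (rule eigenvalue_Rayleigh_basis)
  interpret R: Rayleigh_basis fscale "graph_H1 G" "energy_form G" "graph_inner G" coercivity_const e by (rule e)
  let ?w = "\<lambda>i. tooth_fun (Suc i)"
  have w: "?w i \<in> graph_H1 G" for i by (rule tooth_fun_H1(1)) simp
  have E: "energy.Q (\<Sum>i\<le>k - 1. fscale (c i) (?w i)) = (\<Sum>i\<le>k - 1. (cmod (c i))\<^sup>2 * foot (Suc i))" for c
    by (subst energy.Q_orthogonal_sum) (auto simp: w energy_tooth_fun)
  have H: "mass.Q (\<Sum>i\<le>k - 1. fscale (c i) (?w i)) = (\<Sum>i\<le>k - 1. (cmod (c i))\<^sup>2 * (foot (Suc i) ^ 3 / 3))" for c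
    by (subst mass.Q_orthogonal_sum) (auto simp: w mass_tooth_fun)
  have "R.lam (k - 1) \<le> 3 * real k powr (2 * \<alpha>)"
  proof (rule R.lam_le_if_subspace[of _ ?w])
    show "(\<Sum>i\<le>k - 1. fscale (c i) (?w i)) \<noteq> 0" if nz: "\<exists>i\<le>k - 1. c i \<noteq> 0" for c
    proof
      obtain i where i: "i \<le> k - 1" "c i \<noteq> 0" using nz by blast
      assume "(\<Sum>i\<le>k - 1. fscale (c i) (?w i)) = 0"
      hence "(\<Sum>i\<le>k - 1. (cmod (c i))\<^sup>2 * (foot (Suc i) ^ 3 / 3)) = 0" using H[of c] by (simp add: mass.zero_left)
      hence "(cmod (c i))\<^sup>2 * (foot (Suc i) ^ 3 / 3) = 0"
        using i by (subst (asm) sum_nonneg_eq_0_iff) auto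
      thus False using i foot_pos[of "Suc i"] by simp
    qed
    fix c
    have "foot (Suc i) \<le> 3 * real k powr (2 * \<alpha>) * (foot (Suc i) ^ 3 / 3)" if i: "i \<le> k - 1" for i
    proof -
      have "Suc i \<le> k" using i k by simp
      hence "1 \<le> real k powr \<alpha> * foot (Suc i)"
        using k \<alpha>_pos by (simp add: foot_def powr_minus_divide powr_mono2)
      hence "1 \<le> (real k powr \<alpha> * foot (Suc i))\<^sup>2" by (rule one_le_power)
      also have "\<dots> = real k powr (2 * \<alpha>) * (foot (Suc i))\<^sup>2"
        by (simp add: power_mult_distrib power2_eq_square powr_add[symmetric])
      finally have "foot (Suc i) * 1 \<le> foot (Suc i) * (real k powr (2 * \<alpha>) * (foot (Suc i))\<^sup>2)"
        by (intro mult_left_mono) auto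
      thus ?thesis by (simp add: power3_eq_cube power2_eq_square mult_ac)
    qed
    hence "(\<Sum>i\<le>k - 1. (cmod (c i))\<^sup>2 * foot (Suc i)) \<le>
      (\<Sum>i\<le>k - 1. (cmod (c i))\<^sup>2 * (3 * real k powr (2 * \<alpha>) * (foot (Suc i) ^ 3 / 3)))"
      by (intro sum_mono mult_left_mono) auto
    also have "\<dots> = 3 * real k powr (2 * \<alpha>) * (\<Sum>i\<le>k - 1. (cmod (c i))\<^sup>2 * (foot (Suc i) ^ 3 / 3))"
      unfolding sum_distrib_left by (intro sum.cong) (simp_all only: mult_ac)
    finally show "energy.Q (\<Sum>i\<le>k - 1. fscale (c i) (?w i)) \<le> 3 * real k powr (2 * \<alpha>) * mass.Q (\<Sum>i\<le>k - 1. fscale (c i) (?w i))"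
      unfolding E H .
  qed (rule w)
  thus ?thesis by (simp add: ev)
qed

text \<open>
  The values at the points of the grid are linear functionals, at most \<open>k - 1\<close> in number.
\<close>

lemma eigenvalue_ge_grid:
  assumes K: "1 \<le> K" and card: "card (grid K) \<le> k - 1"
  shows "real K powr (4 * \<alpha> - 2) / mass_const \<le> eigenvalue (neumann_laplacian G) k"
proof -
  obtain e where e: "Rayleigh_basis fscale (graph_H1 G) (energy_form G) (graph_inner G) coercivity_const e"
    and ev: "\<forall>k. eigenvalue (neumann_laplacian G) k = Rayleigh_basis.lam (energy_form G) e (k - 1)"
    by (rule eigenvalue_Rayleigh_basis)
  interpret R: Rayleigh_basis fscale "graph_H1 G" "energy_form G" "graph_inner G" coercivity_const e by (rule e)
  obtain p where p: "bij_betw p {0..<card (grid K)} (grid K)"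
    using ex_bij_betw_nat_finite[OF finite_grid] by blast
  have "real K powr (4 * \<alpha> - 2) / mass_const \<le> R.lam (k - 1)"
  proof (rule R.lam_ge_if_functionals[of _ "\<lambda>j v. v (p j)"])
    fix v assume v: "v \<in> graph_H1 G" and vp: "\<And>j. j < k - 1 \<Longrightarrow> v (p j) = 0"
    have "v q = 0" if "q \<in> grid K" for q
    proof -
      have "q \<in> p ` {0..<card (grid K)}" using p that by (simp add: bij_betw_def)
      then obtain j where "j < card (grid K)" "q = p j" by auto
      thus ?thesis using vp[of j] card by simp
    qed
    hence "mass.Q v \<le> mass_const * real K powr (2 - 4 * \<alpha>) * energy.Q v"
      using mass_le_energy_grid[OF v K, of 0] by simp
    hence "real K powr (4 * \<alpha> - 2) / mass_const * mass.Q v \<le>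
      real K powr (4 * \<alpha> - 2) / mass_const * (mass_const * real K powr (2 - 4 * \<alpha>) * energy.Q v)"
      using mass_const_pos by (intro mult_left_mono) auto
    also have "\<dots> = (real K powr (4 * \<alpha> - 2) * real K powr (2 - 4 * \<alpha>)) * energy.Q v"
      using mass_const_pos by simp
    also have "\<dots> = energy.Q v" using K by (simp add: powr_add[symmetric])
    finally show "real K powr (4 * \<alpha> - 2) / mass_const * mass.Q v \<le> energy.Q v" .
  qed (simp add: sum_fun_apply)
  thus ?thesis by (simp add: ev)
qed

text \<open>
  The largest \<open>K\<close> whose grid is known to have at most \<open>k - 1\<close> points is of the order of \<open>k\<close>.
\<close>

lemma eigenvalue_ge:
  obtains c where "0 < c" "\<forall>\<^sub>F k in sequentially. c * real k powr (4 * \<alpha> - 2) \<le> eigenvalue (neumann_laplacian G) k"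
proof -
  define D where "D = nat \<lceil>2 / (1 - \<alpha>) + 4\<rceil>"
  have D: "2 / (1 - \<alpha>) + 4 \<le> real D" unfolding D_def by linarith
  have "0 \<le> 2 / (1 - \<alpha>)" using \<alpha>_lt by simp
  hence D1: "1 \<le> D" using D by linarith
  define c where "c = (1 / (2 * real D)) powr (4 * \<alpha> - 2) / mass_const"
  show ?thesis
  proof (rule that)
    show "0 < c" using D1 mass_const_pos by (simp add: c_def)
    have "c * real k powr (4 * \<alpha> - 2) \<le> eigenvalue (neumann_laplacian G) k" if k: "k \<ge> 2 * D + 2" for k
    proof -
      define K where "K = (k - 1) div D"
      have "D * 1 \<le> k - 1" using k by simp
      hence K1: "1 \<le> K" using D1 by (simp add: K_def less_eq_div_iff_mult_less_eq)
      have "real (card (grid K)) \<le> real D * real K"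
        using card_grid_le[OF K1] mult_right_mono[OF D, of "real K"] by simp
      hence "card (grid K) \<le> D * K" by (simp flip: of_nat_mult)
      also have "\<dots> \<le> k - 1" by (simp add: K_def)
      finally have ev: "real K powr (4 * \<alpha> - 2) / mass_const \<le> eigenvalue (neumann_laplacian G) k"
        by (rule eigenvalue_ge_grid[OF K1])
      have "k - 1 < D * K + D"
        using D1 dividend_less_times_div[of D "k - 1"] by (simp add: K_def)
      hence "k \<le> D * K + D" by simp
      also have "\<dots> \<le> 2 * D * K" using K1 by simp
      finally have "real k \<le> real (2 * D * K)" by (simp only: of_nat_le_iff)
      hence "real k \<le> 2 * real D * real K" by simp
      hence "1 / (2 * real D) * real k \<le> real K" using D1 by (simp add: field_simps)
      hence "(1 / (2 * real D) * real k) powr (4 * \<alpha> - 2) \<le> real K powr (4 * \<alpha> - 2)"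
        using \<alpha>_gt by (intro powr_mono2) auto
      hence "(1 / (2 * real D)) powr (4 * \<alpha> - 2) * real k powr (4 * \<alpha> - 2) \<le> real K powr (4 * \<alpha> - 2)"
        by (subst (asm) powr_mult) simp_all
      hence "c * real k powr (4 * \<alpha> - 2) \<le> real K powr (4 * \<alpha> - 2) / mass_const"
        using mass_const_pos by (simp add: c_def divide_right_mono)
      with ev show ?thesis by linarith
    qed
    thus "\<forall>\<^sub>F k in sequentially. c * real k powr (4 * \<alpha> - 2) \<le> eigenvalue (neumann_laplacian G) k"
      unfolding eventually_sequentially by blast
  qed
qed

end

theorem theorem2p7:
  fixes \<alpha> :: real
  assumes "1 / 2 < \<alpha>" and "\<alpha> < 1"
  shows "\<exists>c C. 0 < c \<and> 0 < C \<and>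
    (\<forall>\<^sub>F k in sequentially.
       c * real k powr (4 * \<alpha> - 2) \<le> eigenvalue (neumann_laplacian (diagonal_comb \<alpha>)) k \<and>
       eigenvalue (neumann_laplacian (diagonal_comb \<alpha>)) k \<le> C * real k powr (2 * \<alpha>))"
proof -
  interpret comb \<alpha> by unfold_locales fact+
  obtain c where c: "0 < c" "\<forall>\<^sub>F k in sequentially. c * real k powr (4 * \<alpha> - 2) \<le> eigenvalue (neumann_laplacian G) k"
    by (rule eigenvalue_ge)
  have "\<forall>\<^sub>F k in sequentially. eigenvalue (neumann_laplacian G) k \<le> 3 * real k powr (2 * \<alpha>)"
    using eventually_ge_at_top[of 1] by eventually_elim (rule eigenvalue_le)
  with c(2) have "\<forall>\<^sub>F k in sequentially.
       c * real k powr (4 * \<alpha> - 2) \<le> eigenvalue (neumann_laplacian G) k \<and>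
       eigenvalue (neumann_laplacian G) k \<le> 3 * real k powr (2 * \<alpha>)"
    by (rule eventually_conj)
  with c(1) show ?thesis by (intro exI[of _ c] exI[of _ 3]) simp
qed

end
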